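(* Let $\Omega\subseteq\mathbb{C}^n$ be a domain, let $\mathcal{H}\in B_1^*(\Omega)$, and let $1\le p<q<\infty$ be integers. Let $\Theta:\Omega\to\mathcal{B}(\mathbb{C}^p,\mathbb{C}^q)$, $\Theta\in\mathcal{M}(\mathcal{H})\otimes\mathcal{B}(\mathbb{C}^p,\mathbb{C}^q)$, have a left inverse $\Psi\in\mathcal{M}(\mathcal{H})\otimes\mathcal{B}(\mathbb{C}^q,\mathbb{C}^p)$, and let $\mathcal{H}_\Theta=(\mathcal{H}\otimes\mathbb{C}^q)/M_\Theta(\mathcal{H}\otimes\mathbb{C}^p)$. Then there exists a hermitian anti-holomorphic vector bundle $V^*_\Theta$ of dimension $q-p$ over $\Omega$ with fibre $V^*_\Theta(w)=(\operatorname{ran}\Theta(w))^\perp=\ker\Theta(w)^*$ such that $$E^*_{\mathcal{H}_\Theta}\cong E^*_{\mathcal{H}}\otimes V^*_\Theta .$$ Moreover, $\mathcal{H}_\Theta\in B^*_{q-p}(\Omega)$. Finally, one has the identity $$\mathcal{K}_{E^*_{\mathcal{H}_\Theta}}-\mathcal{K}_{E^*_{\mathcal{H}}}\otimes I_{V^*_\Theta}=I_{E^*_{\mathcal{H}}}\otimes\mathcal{K}_{V^*_\Theta}.$$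
   Context: A Hilbert module over $\mathbb{C}[z_1,\dots,z_n]$ is a Hilbert space $\mathcal{H}$ with commuting bounded operators $M_{z_1},\dots,M_{z_n}$ on it, acting by $p\cdot h=p(M_{z_1},\dots,M_{z_n})h$. A domain is a connected open set. For a positive integer $m$, $B_m^*(\Omega)$ is the set of Hilbert modules $\mathcal{H}$ over $\mathbb{C}[z_1,\dots,z_n]$ such that: (i) for every $w\in\Omega$ the column operator $(M_z-wI_{\mathcal{H}})^*:\mathcal{H}\to\mathcal{H}^n$, $h\mapsto (M_{z_1}-w_1I)^*h\oplus\cdots\oplus(M_{z_n}-w_nI)^*h$, has closed range; (ii) $\dim\ker(M_z-wI_{\mathcal{H}})^*=\dim\bigcap_{i=1}^n\ker(M_{z_i}-w_iI)^*=m$ for every $w\in\Omega$; (iii) the closed linear span of $\bigcup_{w\in\Omega}\ker(M_z-wI_{\mathcal{H}})^*$ is $\mathcal{H}$. For such $\mathcal{H}$, $E^*_{\mathcal{H}}$ is the rank $m$ hermitian anti-holomorphic vector bundle over $\Omega$ with fibre $E^*_{\mathcal{H}}(w)=\ker(M_z-wI_{\mathcal{H}})^*\subseteq\mathcal{H}$ and inner product inherited from $\mathcal{H}$. $\mathcal{M}(\mathcal{H})$ is the multiplier algebra: functions $\varphi:\Omega\to\mathbb{C}$ for which pointwise multiplication defines a bounded operator $M_\varphi$ on $\mathcal{H}$ (elements of $\mathcal{H}$ being regarded, locally, as functions on $\Omega$ via evaluation against $E_{\mathcal{H}}^*(w)$); equivalently there is a bounded $M_\varphi$ on $\mathcal{H}$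 with $M_\varphi^*k=\overline{\varphi(w)}k$ for all $w\in\Omega$, $k\in E^*_{\mathcal{H}}(w)$. An element $\Theta=[\theta_{i,j}]$ of $\mathcal{M}(\mathcal{H})\otimes\mathcal{B}(\mathbb{C}^p,\mathbb{C}^q)$ is a $q\times p$ matrix of multipliers, and $M_\Theta:\mathcal{H}\otimes\mathbb{C}^p\to\mathcal{H}\otimes\mathbb{C}^q$ is the corresponding matrix of operators $[M_{\theta_{i,j}}]$, a module map. $\Psi$ is a left inverse of $\Theta$ if $\Psi(w)\Theta(w)=I$ for all $w\in\Omega$ (so $M_\Theta$ has closed range). The quotient carries the quotient norm and induced module action; it is identified with the orthogonal complement of $\operatorname{ran}M_\Theta$ with the compressed action. $V_\Theta^*$ is a subbundle of $\Omega\times\mathbb{C}^q$ with the inherited inner product. $\cong$ denotes equivalence of hermitian anti-holomorphic vector bundles: an anti-holomorphic bundle isomorphism that is isometric on each fibre. The curvature $\mathcal{K}_E$ of (the Chern connection of) a hermitian anti-holomorphic vector bundle $E$ is given, in a local anti-holomorphic frame $\{f_i\}$ with Gramian $G(w)=(\langle f_i(w),f_j(w)\rangle)_{i,j}$ (row $i$, column $j$), by $\mathcal{K}_E=\bar\partial[G^{-1}\partial G]$. The curvature identity is understood through the identification $E^*_{\mathcal{H}_\Theta}\cong E^*_{\mathcal{H}}\otimes V^*_\Theta$: for local anti-holomorphic frames $k_w$ of $E^*_{\mathcal{H}}$ and $\{f_i\}$ of $V^*_\Theta$, the matrices are taken relative to the frames $\{k_w\otimes f_i(w)\}$, $k_w$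 and $\{f_i(w)\}$. *)

theory Defs
  imports "HOL-Analysis.Analysis"
begin

section \<open>Complex Hilbert spaces\<close>

text \<open>The complex inner product is linear in the first argument, and the real inner product of the
  library is its real part, so that norm, metric and topology are the ones of the library.\<close>

class complex_hilbert = real_inner + complete_space +
  fixes scaleC :: "complex \<Rightarrow> 'a \<Rightarrow> 'a" (infixr \<open>*\<^sub>C\<close> 75)
    and cinner :: "'a \<Rightarrow> 'a \<Rightarrow> complex"
  assumes scaleC_add_right: "c *\<^sub>C (x + y) = c *\<^sub>C x + c *\<^sub>C y"
    and scaleC_add_left: "(c + d) *\<^sub>C x = c *\<^sub>C x + d *\<^sub>C x"
    and scaleC_scaleC: "c *\<^sub>C d *\<^sub>C x = (c * d) *\<^sub>C x"
    and scaleC_one: "1 *\<^sub>C x = x"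
    and scaleR_scaleC: "r *\<^sub>R x = complex_of_real r *\<^sub>C x"
    and cinner_commute: "cinner x y = cnj (cinner y x)"
    and cinner_add_left: "cinner (x + y) z = cinner x z + cinner y z"
    and cinner_scaleC_left: "cinner (c *\<^sub>C x) y = c * cinner x y"
    and inner_eq_Re_cinner: "x \<bullet> y = Re (cinner x y)"

global_interpretation cvs: vector_space "scaleC :: complex \<Rightarrow> 'a \<Rightarrow> 'a::complex_hilbert"
  by unfold_locales
    (simp_all add: scaleC_add_right scaleC_add_left scaleC_scaleC scaleC_one)

instantiation complex :: complex_hilbert
begin
definition scaleC_complex :: "complex \<Rightarrow> complex \<Rightarrow> complex" where
  "scaleC_complex c x = c * x"
definition cinner_complex :: "complex \<Rightarrow> complex \<Rightarrow> complex" where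
  "cinner_complex x y = x * cnj y"
instance
  by standard
    (simp_all add: scaleC_complex_def cinner_complex_def algebra_simps scaleR_conv_of_real
      inner_complex_def)
end

text \<open>\<open>'a ^ 'm\<close> is the Hilbert space direct sum of copies of \<open>'a\<close>; it models
  the tensor product of \<open>'a\<close> with \<open>complex ^ 'm\<close>.\<close>

instantiation vec :: (complex_hilbert, finite) complex_hilbert
begin
definition scaleC_vec :: "complex \<Rightarrow> 'a ^ 'b \<Rightarrow> 'a ^ 'b" where
  "scaleC_vec c x = (\<chi> i. c *\<^sub>C (x $ i))"
definition cinner_vec :: "'a ^ 'b \<Rightarrow> 'a ^ 'b \<Rightarrow> complex" where
  "cinner_vec x y = (\<Sum>i\<in>UNIV. cinner (x $ i) (y $ i))"
instance
proof
  fix x y z :: "'a ^ 'b" and c d :: complex and r :: real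
  show "c *\<^sub>C (x + y) = c *\<^sub>C x + c *\<^sub>C y"
    by (simp add: scaleC_vec_def vec_eq_iff scaleC_add_right)
  show "(c + d) *\<^sub>C x = c *\<^sub>C x + d *\<^sub>C x"
    by (simp add: scaleC_vec_def vec_eq_iff scaleC_add_left)
  show "c *\<^sub>C d *\<^sub>C x = (c * d) *\<^sub>C x"
    by (simp add: scaleC_vec_def vec_eq_iff scaleC_scaleC)
  show "1 *\<^sub>C x = x"
    by (simp add: scaleC_vec_def vec_eq_iff scaleC_one)
  show "r *\<^sub>R x = complex_of_real r *\<^sub>C x"
    by (simp add: scaleC_vec_def vec_eq_iff scaleR_scaleC)
  show "cinner x y = cnj (cinner y x)"
    by (simp add: cinner_vec_def cinner_commute[symmetric])
  show "cinner (x + y) z = cinner x z + cinner y z"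
    by (simp add: cinner_vec_def cinner_add_left sum.distrib)
  show "cinner (c *\<^sub>C x) y = c * cinner x y"
    by (simp add: cinner_vec_def scaleC_vec_def cinner_scaleC_left sum_distrib_left)
  show "x \<bullet> y = Re (cinner x y)"
    by (simp add: cinner_vec_def inner_vec_def inner_eq_Re_cinner)
qed
end

definition tensor :: "'h::complex_hilbert \<Rightarrow> complex ^ 'm \<Rightarrow> 'h ^ 'm" where
  "tensor k v = (\<chi> j. (v $ j) *\<^sub>C k)"

lemma cinner_tensor: "cinner (tensor k v) (tensor k' v') = cinner k k' * cinner v v'"
proof -
  have r: "cinner x (c *\<^sub>C y) = cnj c * cinner x y" for x y :: 'a and c
    by (subst cinner_commute) (simp add: cinner_scaleC_left cinner_commute[of x y])
  show ?thesis
    by (simp add: cinner_vec_def tensor_def cinner_scaleC_left r sum_distrib_left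
        cinner_complex_def mult_ac)
qed

definition orth_compl :: "'h::complex_hilbert set \<Rightarrow> 'h set" where
  "orth_compl A = {x. \<forall>y\<in>A. cinner x y = 0}"

definition orth_proj :: "'h::complex_hilbert set \<Rightarrow> 'h \<Rightarrow> 'h" where
  "orth_proj S x = (THE y. y \<in> S \<and> x - y \<in> orth_compl S)"

text \<open>Hilbert spaces that are not a whole type are closed subspaces \<open>S\<close> of one; an operator on such an
  \<open>S\<close> is a function of which only the values on \<open>S\<close> matter.\<close>

definition bounded_operator_on :: "'h::complex_hilbert set \<Rightarrow> ('h \<Rightarrow> 'h) \<Rightarrow> bool" where
  "bounded_operator_on S T \<longleftrightarrow>
     (\<forall>x\<in>S. T x \<in> S) \<and>
     (\<forall>x\<in>S. \<forall>y\<in>S. T (x + y) = T x + T y) \<and>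
     (\<forall>c. \<forall>x\<in>S. T (c *\<^sub>C x) = c *\<^sub>C T x) \<and>
     (\<exists>K. \<forall>x\<in>S. norm (T x) \<le> K * norm x)"

definition adjoint_on :: "'h::complex_hilbert set \<Rightarrow> ('h \<Rightarrow> 'h) \<Rightarrow> 'h \<Rightarrow> 'h" where
  "adjoint_on S T y = (THE z. z \<in> S \<and> (\<forall>x\<in>S. cinner (T x) y = cinner x z))"


section \<open>Hilbert modules and the classes \<open>B\<^sub>m\<^sup>*(\<Omega>)\<close>\<close>

definition hilbert_module :: "'h::complex_hilbert set \<Rightarrow> ('n \<Rightarrow> 'h \<Rightarrow> 'h) \<Rightarrow> bool" where
  "hilbert_module S M \<longleftrightarrow>
     cvs.subspace S \<and> closed S \<and>
     (\<forall>i. bounded_operator_on S (M i)) \<and>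
     (\<forall>i j. \<forall>x\<in>S. M i (M j x) = M j (M i x))"

text \<open>The column operator \<open>(M\<^sub>z - w I)\<^sup>*\<close>.\<close>

definition column_adjoint ::
  "'h::complex_hilbert set \<Rightarrow> ('n \<Rightarrow> 'h \<Rightarrow> 'h) \<Rightarrow> complex ^ 'n \<Rightarrow> 'h \<Rightarrow> 'h ^ 'n" where
  "column_adjoint S M w h = (\<chi> i. adjoint_on S (\<lambda>x. M i x - (w $ i) *\<^sub>C x) h)"

definition eigenspace ::
  "'h::complex_hilbert set \<Rightarrow> ('n \<Rightarrow> 'h \<Rightarrow> 'h) \<Rightarrow> complex ^ 'n \<Rightarrow> 'h set" where
  "eigenspace S M w = {h \<in> S. column_adjoint S M w h = 0}"

text \<open>The requirement \<open>0 < m\<close> also excludes the case of an infinite-dimensional kernel, to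
  which the dimension function of the library assigns the value \<open>0\<close>.\<close>

definition B_star ::
  "(complex ^ 'n) set \<Rightarrow> nat \<Rightarrow> 'h::complex_hilbert set \<Rightarrow> ('n \<Rightarrow> 'h \<Rightarrow> 'h) \<Rightarrow> bool" where
  "B_star \<Omega> m S M \<longleftrightarrow>
     0 < m \<and> hilbert_module S M \<and>
     (\<forall>w\<in>\<Omega>. closed (column_adjoint S M w ` S)) \<and>
     (\<forall>w\<in>\<Omega>. cvs.dim (eigenspace S M w) = m) \<and>
     closure (cvs.span (\<Union>w\<in>\<Omega>. eigenspace S M w)) = S"


section \<open>Multipliers and the quotient module\<close>

text \<open>From here on the module is a whole type. An element \<open>h\<close> is regarded as the function sending
  \<open>w\<close> to the functional \<open>k \<mapsto> \<langle>h, k\<rangle>\<close> on the eigenspace at \<open>w\<close>; \<open>T\<close> is pointwise multiplication by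
  \<open>\<phi>\<close>.\<close>

definition is_mult_op ::
  "(complex ^ 'n) set \<Rightarrow> ('n \<Rightarrow> 'h \<Rightarrow> 'h) \<Rightarrow> (complex ^ 'n \<Rightarrow> complex) \<Rightarrow>
     ('h::complex_hilbert \<Rightarrow> 'h) \<Rightarrow> bool" where
  "is_mult_op \<Omega> M \<phi> T \<longleftrightarrow>
     bounded_operator_on UNIV T \<and>
     (\<forall>h. \<forall>w\<in>\<Omega>. \<forall>k\<in>eigenspace UNIV M w. cinner (T h) k = \<phi> w * cinner h k)"

definition multipliers ::
  "(complex ^ 'n) set \<Rightarrow> ('n \<Rightarrow> 'h::complex_hilbert \<Rightarrow> 'h) \<Rightarrow> (complex ^ 'n \<Rightarrow> complex) set" where
  "multipliers \<Omega> M = {\<phi>. \<exists>T. is_mult_op \<Omega> M \<phi> T}"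

definition mult_op ::
  "(complex ^ 'n) set \<Rightarrow> ('n \<Rightarrow> 'h \<Rightarrow> 'h) \<Rightarrow> (complex ^ 'n \<Rightarrow> complex) \<Rightarrow>
     'h::complex_hilbert \<Rightarrow> 'h" where
  "mult_op \<Omega> M \<phi> = (THE T. is_mult_op \<Omega> M \<phi> T)"

definition matrix_mult_op ::
  "(complex ^ 'n) set \<Rightarrow> ('n \<Rightarrow> 'h \<Rightarrow> 'h) \<Rightarrow> (complex ^ 'n \<Rightarrow> complex ^ 'p ^ 'q) \<Rightarrow>
     'h::complex_hilbert ^ 'p \<Rightarrow> 'h ^ 'q" where
  "matrix_mult_op \<Omega> M \<Theta> x =
     (\<chi> i. \<Sum>j\<in>UNIV. mult_op \<Omega> M (\<lambda>w. \<Theta> w $ i $ j) (x $ j))"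

text \<open>The quotient module, identified with the orthogonal complement of the range of
  \<open>M\<^sub>\<Theta>\<close> with the compressed action.\<close>

definition quot_space ::
  "(complex ^ 'n) set \<Rightarrow> ('n \<Rightarrow> 'h \<Rightarrow> 'h) \<Rightarrow> (complex ^ 'n \<Rightarrow> complex ^ 'p ^ 'q) \<Rightarrow>
     ('h::complex_hilbert ^ 'q) set" where
  "quot_space \<Omega> M \<Theta> = orth_compl (range (matrix_mult_op \<Omega> M \<Theta>))"

definition quot_action ::
  "(complex ^ 'n) set \<Rightarrow> ('n \<Rightarrow> 'h \<Rightarrow> 'h) \<Rightarrow> (complex ^ 'n \<Rightarrow> complex ^ 'p ^ 'q) \<Rightarrow>
     'n \<Rightarrow> 'h::complex_hilbert ^ 'q \<Rightarrow> 'h ^ 'q" where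
  "quot_action \<Omega> M \<Theta> i x = orth_proj (quot_space \<Omega> M \<Theta>) (\<chi> j. M i (x $ j))"

definition conj_transpose :: "complex ^ 'p ^ 'q \<Rightarrow> complex ^ 'q ^ 'p" where
  "conj_transpose A = (\<chi> i j. cnj (A $ j $ i))"


section \<open>Hermitian anti-holomorphic vector bundles\<close>

definition antiholomorphic_on ::
  "(complex ^ 'n \<Rightarrow> 'h::complex_hilbert) \<Rightarrow> (complex ^ 'n) set \<Rightarrow> bool" where
  "antiholomorphic_on f U \<longleftrightarrow>
     (\<forall>w\<in>U. \<exists>D. (f has_derivative D) (at w) \<and> (\<forall>c v. D (c *\<^sub>C v) = cnj c *\<^sub>C D v))"

text \<open>All bundles are subbundles of trivial bundles \<open>\<Omega> \<times> 'h\<close>: a bundle is given by its family of fibres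
  \<open>E w \<subseteq> 'h\<close>, with the inner product of \<open>'h\<close>, and its anti-holomorphic sections over an open
  set are the anti-holomorphic \<open>'h\<close>-valued functions with values in the fibres.\<close>

definition local_frame ::
  "(complex ^ 'n \<Rightarrow> 'h::complex_hilbert set) \<Rightarrow> (complex ^ 'n) set \<Rightarrow> 'i set \<Rightarrow>
     ('i \<Rightarrow> complex ^ 'n \<Rightarrow> 'h) \<Rightarrow> bool" where
  "local_frame E U I f \<longleftrightarrow>
     open U \<and> (\<forall>i\<in>I. antiholomorphic_on (f i) U) \<and>
     (\<forall>w\<in>U. inj_on (\<lambda>i. f i w) I \<and> cvs.independent ((\<lambda>i. f i w) ` I) \<and>
        cvs.span ((\<lambda>i. f i w) ` I) = E w)"

definition antihol_bundle ::
  "(complex ^ 'n) set \<Rightarrow> nat \<Rightarrow> (complex ^ 'n \<Rightarrow> 'h::complex_hilbert set) \<Rightarrow> bool" where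
  "antihol_bundle \<Omega> m E \<longleftrightarrow>
     (\<forall>w\<in>\<Omega>. \<exists>U f. w \<in> U \<and> U \<subseteq> \<Omega> \<and> local_frame E U {..<m} f)"

definition bundle_iso ::
  "(complex ^ 'n) set \<Rightarrow> (complex ^ 'n \<Rightarrow> 'h::complex_hilbert set) \<Rightarrow>
     (complex ^ 'n \<Rightarrow> 'k::complex_hilbert set) \<Rightarrow> (complex ^ 'n \<Rightarrow> 'h \<Rightarrow> 'k) \<Rightarrow> bool" where
  "bundle_iso \<Omega> E F \<Phi> \<longleftrightarrow>
     (\<forall>w\<in>\<Omega>. bij_betw (\<Phi> w) (E w) (F w) \<and>
        (\<forall>x\<in>E w. \<forall>y\<in>E w. \<Phi> w (x + y) = \<Phi> w x + \<Phi> w y) \<and>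
        (\<forall>c. \<forall>x\<in>E w. \<Phi> w (c *\<^sub>C x) = c *\<^sub>C \<Phi> w x) \<and>
        (\<forall>x\<in>E w. \<forall>y\<in>E w. cinner (\<Phi> w x) (\<Phi> w y) = cinner x y)) \<and>
     (\<forall>U s. open U \<and> U \<subseteq> \<Omega> \<and> (\<forall>w\<in>U. s w \<in> E w) \<longrightarrow>
        (antiholomorphic_on s U \<longleftrightarrow> antiholomorphic_on (\<lambda>w. \<Phi> w (s w)) U))"

definition bundle_equiv ::
  "(complex ^ 'n) set \<Rightarrow> (complex ^ 'n \<Rightarrow> 'h::complex_hilbert set) \<Rightarrow>
     (complex ^ 'n \<Rightarrow> 'k::complex_hilbert set) \<Rightarrow> bool" where
  "bundle_equiv \<Omega> E F \<longleftrightarrow>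
     (\<exists>m. antihol_bundle \<Omega> m E \<and> antihol_bundle \<Omega> m F) \<and> (\<exists>\<Phi>. bundle_iso \<Omega> E F \<Phi>)"

text \<open>The inner product of the tensor product of two fibres is the one inherited from \<open>'h ^ 'm\<close>,
  by the lemma \<open>cinner_tensor\<close>.\<close>

definition tensor_bundle ::
  "(complex ^ 'n \<Rightarrow> 'h::complex_hilbert set) \<Rightarrow> (complex ^ 'n \<Rightarrow> (complex ^ 'm) set) \<Rightarrow>
     complex ^ 'n \<Rightarrow> ('h ^ 'm) set" where
  "tensor_bundle E V w = cvs.span {tensor k v | k v. k \<in> E w \<and> v \<in> V w}"


section \<open>Curvature\<close>

definition dir_deriv :: "(complex ^ 'n \<Rightarrow> 'a::complex_hilbert) \<Rightarrow> complex ^ 'n \<Rightarrow> complex ^ 'n \<Rightarrow> 'a" where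
  "dir_deriv g w v = vector_derivative (\<lambda>t. g (w + t *\<^sub>R v)) (at 0)"

text \<open>The Wirtinger derivatives with respect to \<open>w\<^sub>i\<close> and to its conjugate.\<close>

definition del :: "'n \<Rightarrow> (complex ^ 'n \<Rightarrow> 'a::complex_hilbert) \<Rightarrow> complex ^ 'n \<Rightarrow> 'a" where
  "del i g w = (1 / 2) *\<^sub>C (dir_deriv g w (axis i 1) - \<i> *\<^sub>C dir_deriv g w (axis i \<i>))"

definition delbar :: "'n \<Rightarrow> (complex ^ 'n \<Rightarrow> 'a::complex_hilbert) \<Rightarrow> complex ^ 'n \<Rightarrow> 'a" where
  "delbar i g w = (1 / 2) *\<^sub>C (dir_deriv g w (axis i 1) + \<i> *\<^sub>C dir_deriv g w (axis i \<i>))"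

definition gramian ::
  "('r \<Rightarrow> complex ^ 'n \<Rightarrow> 'h::complex_hilbert) \<Rightarrow> complex ^ 'n \<Rightarrow> complex ^ 'r ^ 'r" where
  "gramian f w = (\<chi> i j. cinner (f i w) (f j w))"

text \<open>The matrix-valued 2-form \<open>delbar (G\<^sup>-\<^sup>1 del G)\<close>, which is the sum over \<open>i\<close> and \<open>j\<close> of
  \<open>delbar\<^sub>j (G\<^sup>-\<^sup>1 del\<^sub>i G)\<close> times the wedge of \<open>d(cnj w\<^sub>j)\<close> and \<open>d w\<^sub>i\<close>, at the point \<open>w\<close> and
  evaluated on the tangent vectors \<open>u\<close> and \<open>v\<close>; \<open>G\<close> is the Gramian of the frame \<open>f\<close>.\<close>

definition curvature ::
  "('r \<Rightarrow> complex ^ 'n \<Rightarrow> 'h::complex_hilbert) \<Rightarrow> complex ^ 'n \<Rightarrow>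
     complex ^ 'n \<Rightarrow> complex ^ 'n \<Rightarrow> complex ^ 'r ^ 'r" where
  "curvature f w u v =
     (\<Sum>i\<in>UNIV. \<Sum>j\<in>UNIV. (cnj (u $ j) * v $ i - cnj (v $ j) * u $ i) *\<^sub>C
        delbar j (\<lambda>z. matrix_inv (gramian f z) ** del i (gramian f) z) w)"

text \<open>The Kronecker product, for frames \<open>k\<^sub>a \<otimes> f\<^sub>b\<close> indexed by pairs \<open>(a, b)\<close>.\<close>

definition kron :: "complex ^ 'a ^ 'a \<Rightarrow> complex ^ 'b ^ 'b \<Rightarrow> complex ^ ('a \<times> 'b) ^ ('a \<times> 'b)" where
  "kron A B = (\<chi> r s. A $ fst r $ fst s * B $ snd r $ snd s)"

end

theory Submission
  imports Defs "HOL-Complex_Analysis.Cauchy_Integral_Formula"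
begin

text \<open>
  Everything is read off from the joint eigenvectors. If \<open>k\<close> is an eigenvector at \<open>w\<close>, then the adjoint
  of the multiplication by \<open>\<phi>\<close> multiplies \<open>k\<close> by \<open>cnj (\<phi> w)\<close>. Hence the adjoint of \<open>M\<^sub>\<Theta>\<close> sends
  \<open>k \<otimes> v\<close> to \<open>k \<otimes> \<Theta>(w)\<^sup>* v\<close>. The quotient space is the kernel of that adjoint, and it is invariant under
  the adjoints of the coordinate operators, so the eigenspace of the quotient module at \<open>w\<close> consists of
  the \<open>k \<otimes> v\<close> with \<open>\<Theta>(w)\<^sup>* v = 0\<close>. This is the fibre of the tensor product of the two bundles, and the
  identity map is the required isomorphism (\<open>eigenspace_quotient\<close>).

  The left inverse provides two idempotents, \<open>Q w = I - \<Psi>(w)\<^sup>* \<Theta>(w)\<^sup>*\<close> on the fibres and its counterpart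
  \<open>R = I - M\<^sub>\<Psi>\<^sup>* M\<^sub>\<Theta>\<^sup>*\<close> on the module. The first depends anti-holomorphically on \<open>w\<close> and therefore
  moves a basis of one kernel to frames of the neighbouring kernels (\<open>antihol_bundle_V\<close>). The second
  projects onto the quotient space and commutes with the adjoints of the coordinate operators, and in
  this way closed ranges (\<open>closed_range_quotient\<close>) and spanning eigenvectors
  (\<open>eigenvectors_dense_quotient\<close>) pass from the given module to the quotient.

  Two facts of analysis support this. First, the eigenspaces of a module of rank one form an
  anti-holomorphic bundle (\<open>local_section\<close>, \<open>local_frame_exists\<close>): by the open mapping theorem an
  operator with closed range is bounded below on the complement of its kernel, which controls how the
  kernel of the column operator moves with \<open>w\<close>; constancy of its dimension excludes a jump. Multipliers
  are then holomorphic (\<open>multiplier_antihol\<close>). Secondly, the first derivatives of an anti-holomorphic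
  Hilbert space valued map are again differentiable (\<open>dir_deriv_differentiable\<close>), so that the
  derivatives in the curvature exist.

  For the curvature identity, the Gramian of the frame of the tensor product is the Kronecker product
  of the Gramians. The product rule splits the connection form into one term for each factor, and
  \<open>delbar\<close> is additive (\<open>curvature_tensor_product\<close>).
\<close>

section \<open>Complex Hilbert spaces\<close>

subclass (in complex_hilbert) banach ..

lemma cinner_add_right: "cinner x (y + z) = cinner x y + cinner x (z::'a::complex_hilbert)"
  by (metis cinner_add_left cinner_commute complex_cnj_add)

lemma cinner_scaleC_right: "cinner x (c *\<^sub>C y) = cnj c * cinner x (y::'a::complex_hilbert)"
  by (metis cinner_commute cinner_scaleC_left complex_cnj_mult)

lemma cinner_self: "cinner x x = complex_of_real ((norm (x::'a::complex_hilbert))\<^sup>2)"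
proof (rule complex_eqI)
  show "Re (cinner x x) = Re (complex_of_real ((norm x)\<^sup>2))"
    by (simp add: power2_norm_eq_inner inner_eq_Re_cinner)
  show "Im (cinner x x) = Im (complex_of_real ((norm x)\<^sup>2))"
    using cinner_commute[of x x] by (auto simp: complex_eq_iff)
qed

lemma norm_scaleC: "norm (c *\<^sub>C (x::'a::complex_hilbert)) = cmod c * norm x"
proof -
  have "complex_of_real ((norm (c *\<^sub>C x))\<^sup>2) = complex_of_real ((cmod c * norm x)\<^sup>2)"
  proof -
    have "complex_of_real ((norm (c *\<^sub>C x))\<^sup>2) = (c * cnj c) * cinner x x"
      by (simp only: cinner_self[symmetric] cinner_scaleC_left cinner_scaleC_right mult_ac)
    also have "\<dots> = complex_of_real ((cmod c * norm x)\<^sup>2)"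
      by (simp only: cinner_self complex_norm_square[symmetric] power_mult_distrib of_real_mult)
    finally show ?thesis .
  qed
  then show ?thesis
    by (simp only: of_real_eq_iff power2_eq_iff_nonneg norm_ge_zero mult_nonneg_nonneg)
qed

lemma cmod_cinner_le: "cmod (cinner x y) \<le> norm x * norm (y::'a::complex_hilbert)"
proof (cases "cinner x y = 0")
  case False
  \<comment> \<open>Rotate \<open>x\<close> so that the complex inner product becomes the real one.\<close>
  define c where "c = cnj (cinner x y) / cmod (cinner x y)"
  have "c * cinner x y = cmod (cinner x y)"
    using False complex_norm_square[of "cinner x y"]
    by (simp add: c_def field_simps power2_eq_square)
  then have "cmod (cinner x y) = (c *\<^sub>C x) \<bullet> y"
    by (simp add: inner_eq_Re_cinner cinner_scaleC_left)
  also have "\<dots> \<le> norm (c *\<^sub>C x) * norm y"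
    by (rule norm_cauchy_schwarz)
  also have "\<dots> = norm x * norm y"
    using False by (simp add: norm_scaleC c_def norm_divide)
  finally show ?thesis .
qed simp

global_interpretation cinner: bounded_bilinear "cinner :: 'a::complex_hilbert \<Rightarrow> 'a \<Rightarrow> complex"
proof
  show "\<exists>K. \<forall>x y :: 'a. norm (cinner x y) \<le> norm x * norm y * K"
    by (intro exI[of _ 1]) (simp add: cmod_cinner_le)
qed (simp_all add: cinner_add_left cinner_add_right scaleR_scaleC cinner_scaleC_left
    cinner_scaleC_right scaleR_conv_of_real scaleC_complex_def)

global_interpretation scaleC: bounded_bilinear "scaleC :: complex \<Rightarrow> 'a::complex_hilbert \<Rightarrow> 'a"
proof
  show "\<exists>K. \<forall>c (x::'a). norm (c *\<^sub>C x) \<le> norm c * norm x * K"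
    by (intro exI[of _ 1]) (simp add: norm_scaleC)
qed (simp_all add: scaleC_add_left scaleC_add_right scaleR_scaleC scaleC_scaleC
    scaleC_complex_def scaleR_conv_of_real mult.commute)

declare scaleC_one [simp] cinner.zero_left [simp] cinner.zero_right [simp] scaleC.zero_left [simp]
  scaleC.zero_right [simp]

lemma cinner_eq_zero_iff [simp]: "cinner x x = 0 \<longleftrightarrow> x = (0::'a::complex_hilbert)"
  by (simp add: cinner_self)

lemma cinner_ext_right: "(\<And>x. cinner x y = cinner x z) \<Longrightarrow> y = (z::'a::complex_hilbert)"
  by (metis cinner_eq_zero_iff cinner.diff_right right_minus_eq)

lemma scaleC_complex [simp]: "c *\<^sub>C (x::complex) = c * x" by (simp add: scaleC_complex_def)

lemma scaleC_vec_nth [simp]: "(c *\<^sub>C x) $ i = c *\<^sub>C (x $ i)" by (simp add: scaleC_vec_def)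

subsection \<open>Bounded operators\<close>

definition bounded_clinear :: "('a::complex_hilbert \<Rightarrow> 'b::complex_hilbert) \<Rightarrow> bool" where
  "bounded_clinear T \<longleftrightarrow> bounded_linear T \<and> (\<forall>c x. T (c *\<^sub>C x) = c *\<^sub>C T x)"

lemma bounded_clinear_imp_bounded_linear: "bounded_clinear T \<Longrightarrow> bounded_linear T"
  by (simp add: bounded_clinear_def)

lemma bounded_clinear_scaleC: "bounded_clinear T \<Longrightarrow> T (c *\<^sub>C x) = c *\<^sub>C T x"
  by (simp add: bounded_clinear_def)

lemma bounded_clinear_intro:
  assumes "\<And>x y. T (x + y) = T x + T y" "\<And>c x. T (c *\<^sub>C x) = c *\<^sub>C T x"
    and "\<And>x. norm (T x) \<le> K * norm x"
  shows "bounded_clinear T"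
proof -
  have "bounded_linear T"
    using assms by (intro bounded_linear_intro[where K = K]) (auto simp: scaleR_scaleC mult.commute)
  then show ?thesis
    using assms(2) by (simp add: bounded_clinear_def)
qed

lemma bounded_operator_on_UNIV: "bounded_operator_on UNIV T \<longleftrightarrow> bounded_clinear T"
proof
  assume "bounded_operator_on UNIV T"
  then obtain K where "\<forall>x. norm (T x) \<le> K * norm x" and "\<forall>x y. T (x + y) = T x + T y"
    "\<forall>c x. T (c *\<^sub>C x) = c *\<^sub>C T x"
    by (auto simp: bounded_operator_on_def)
  then show "bounded_clinear T"
    by (intro bounded_clinear_intro[where K = K]) auto
next
  assume T: "bounded_clinear T"
  then interpret bounded_linear T by (rule bounded_clinear_imp_bounded_linear)
  show "bounded_operator_on UNIV T"
    using T bounded by (auto simp: bounded_operator_on_def add bounded_clinear_scaleC mult.commute)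
qed

subsection \<open>Orthogonal projection and the Riesz representation\<close>

lemma orth_compl_subspace: "cvs.subspace (orth_compl A)"
  by (auto simp: cvs.subspace_def orth_compl_def cinner_add_left cinner_scaleC_left)

lemma orth_compl_closed: "closed (orth_compl A)"
proof -
  have "orth_compl A = (\<Inter>y\<in>A. {x. cinner x y = 0})"
    by (auto simp: orth_compl_def)
  moreover have "closed {x. cinner x y = 0}" for y :: 'a
    by (intro closed_Collect_eq continuous_intros cinner.continuous_on)
  ultimately show ?thesis
    by auto
qed

lemma orth_complD2: "x \<in> orth_compl A \<Longrightarrow> y \<in> A \<Longrightarrow> cinner y x = 0"
  using cinner_commute[of y x] by (simp add: orth_compl_def)

lemma orth_compl_self_disjoint: "x \<in> S \<Longrightarrow> x \<in> orth_compl S \<Longrightarrow> x = 0"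
  by (auto simp: orth_compl_def)

lemma inner_zero_if_minimal:
  fixes a s :: "'a::real_inner"
  assumes "\<And>t. norm a \<le> norm (a - t *\<^sub>R s)"
  shows "a \<bullet> s = 0"
proof (cases "s = 0")
  case False
  \<comment> \<open>The minimiser of the quadratic polynomial \<open>t \<mapsto> (norm (a - t *\<^sub>R s))\<^sup>2\<close>.\<close>
  define t where "t = (a \<bullet> s) / (s \<bullet> s)"
  have "(norm a)\<^sup>2 \<le> (norm (a - t *\<^sub>R s))\<^sup>2"
    using assms by (simp add: power_mono)
  also have "\<dots> = (norm a)\<^sup>2 - (a \<bullet> s)\<^sup>2 / (s \<bullet> s)"
    using False
    by (simp only: power2_norm_eq_inner inner_diff_left inner_diff_right inner_commute[of s a]
        inner_scaleR_left inner_scaleR_right t_def) (simp add: power2_eq_square field_simps)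
  finally have "(a \<bullet> s)\<^sup>2 / (s \<bullet> s) \<le> 0" by simp
  then show ?thesis
    using False by (simp add: divide_le_0_iff) (meson inner_gt_zero_iff less_le_not_le)
qed simp

text \<open>The minimising sequence for the distance to \<open>S\<close> is a Cauchy sequence by the parallelogram
  identity, and its limit is the foot of the perpendicular.\<close>

lemma orth_projection_exists:
  fixes S :: "'a::complex_hilbert set"
  assumes S: "cvs.subspace S" "closed S"
  shows "\<exists>y\<in>S. x - y \<in> orth_compl S"
proof -
  have S_add: "a + b \<in> S" and S_scale: "c *\<^sub>C a \<in> S" if "a \<in> S" "b \<in> S" for a b c
    using S(1) that by (auto simp: cvs.subspace_def)
  have S_scaleR: "r *\<^sub>R a \<in> S" if "a \<in> S" for a r
    using S_scale[OF that that] by (simp add: scaleR_scaleC)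
  have ne: "S \<noteq> {}"
    using S(1) by (auto simp: cvs.subspace_def)
  define d where "d = infdist x S"
  have d_le: "d \<le> norm (x - s)" if "s \<in> S" for s
    using infdist_le[OF that, of x] by (simp add: d_def dist_norm)
  have d0: "0 \<le> d"
    by (simp add: d_def infdist_nonneg)
  have "\<exists>s\<in>S. (norm (x - s))\<^sup>2 < d\<^sup>2 + 1 / real (Suc n)" for n
  proof -
    have "d < sqrt (d\<^sup>2 + 1 / real (Suc n))"
      by (rule real_less_rsqrt) simp
    then obtain s where s: "s \<in> S" "dist x s < sqrt (d\<^sup>2 + 1 / real (Suc n))"
      using infdist_attains_inf ne cINF_less_iff[of S "dist x"]
      by (auto simp: d_def infdist_notempty ne)
    have "(norm (x - s))\<^sup>2 < (sqrt (d\<^sup>2 + 1 / real (Suc n)))\<^sup>2"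
      using s(2) by (intro power_strict_mono) (auto simp: dist_norm)
    with s(1) show ?thesis by auto
  qed
  then obtain y where y: "\<And>n. y n \<in> S" "\<And>n. (norm (x - y n))\<^sup>2 < d\<^sup>2 + 1 / real (Suc n)"
    by metis
  have close: "(norm (y m - y n))\<^sup>2 \<le> 2 / real (Suc m) + 2 / real (Suc n)" for m n
  proof -
    define u where "u = (1/2) *\<^sub>R (y m + y n)"
    have "u \<in> S"
      using y(1) by (auto simp: u_def intro!: S_scaleR S_add)
    then have "d\<^sup>2 \<le> (norm (x - u))\<^sup>2"
      using d_le d0 by (intro power_mono) auto
    moreover have "(norm (y m - y n))\<^sup>2 = 2 * (norm (x - y m))\<^sup>2 + 2 * (norm (x - y n))\<^sup>2 - 4 * (norm (x - u))\<^sup>2"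
      by (simp add: power2_norm_eq_inner u_def inner_diff_left inner_diff_right inner_add_left
          inner_add_right inner_commute algebra_simps)
    ultimately show ?thesis
      using y(2)[of m] y(2)[of n] by simp
  qed
  have "Cauchy y"
  proof (rule metric_CauchyI)
    fix e :: real assume "0 < e"
    then obtain N where N: "4 / e\<^sup>2 < real N"
      using reals_Archimedean2 by blast
    show "\<exists>N. \<forall>m\<ge>N. \<forall>n\<ge>N. dist (y m) (y n) < e"
    proof (intro exI[of _ N] allI impI)
      fix m n assume "N \<le> m" "N \<le> n"
      have Npos: "0 < real N"
        using N \<open>0 < e\<close> by (smt (verit) divide_nonneg_nonneg zero_le_power2)
      have "2 / real (Suc k) < 2 / real N" if "N \<le> k" for k
        using that Npos by (intro divide_strict_left_mono) auto
      then have "(norm (y m - y n))\<^sup>2 < 4 / real N"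
        using close[of m n] \<open>N \<le> m\<close> \<open>N \<le> n\<close> by (smt (verit) add_divide_distrib)
      also have "\<dots> < e\<^sup>2"
        using N Npos \<open>0 < e\<close> by (simp add: field_simps)
      finally show "dist (y m) (y n) < e"
        using \<open>0 < e\<close> by (simp add: dist_norm power2_less_imp_less)
    qed
  qed
  then obtain l where l: "y \<longlonglongrightarrow> l"
    using Cauchy_convergent convergent_def by blast
  have lS: "l \<in> S"
    using S(2) y(1) l by (meson closed_sequentially)
  have "(\<lambda>n. (norm (x - y n))\<^sup>2) \<longlonglongrightarrow> (norm (x - l))\<^sup>2"
    by (intro tendsto_intros l)
  moreover have "(\<lambda>n. d\<^sup>2 + 1 / real (Suc n)) \<longlonglongrightarrow> d\<^sup>2 + 0"
    using LIMSEQ_inverse_real_of_nat by (intro tendsto_intros) (simp add: inverse_eq_divide)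
  ultimately have "(norm (x - l))\<^sup>2 \<le> d\<^sup>2 + 0"
    using y(2) by (intro LIMSEQ_le) (auto intro: less_imp_le)
  then have minimal: "norm (x - l) \<le> norm (x - s)" if "s \<in> S" for s
    using d_le[OF that] d0 by (smt (verit) power2_le_imp_le)
  have re: "(x - l) \<bullet> s = 0" if "s \<in> S" for s
  proof (rule inner_zero_if_minimal)
    fix t
    show "norm (x - l) \<le> norm (x - l - t *\<^sub>R s)"
      using minimal[of "l + t *\<^sub>R s"] that lS by (simp add: S_add S_scaleR diff_diff_add)
  qed
  have "cinner (x - l) s = 0" if "s \<in> S" for s
    using re[OF that] re[OF S_scale[OF that that, of \<i>]]
    by (auto simp: inner_eq_Re_cinner cinner_scaleC_right complex_eq_iff)
  then show ?thesis
    using lS by (auto simp: orth_compl_def)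
qed

lemma orth_projection_unique:
  assumes S: "cvs.subspace S" and "y \<in> S" "x - y \<in> orth_compl S" "z \<in> S" "x - z \<in> orth_compl S"
  shows "y = z"
proof -
  have "y - z \<in> S"
    using assms by (simp add: cvs.subspace_diff)
  moreover have "y - z \<in> orth_compl S"
    using cvs.subspace_diff[OF orth_compl_subspace assms(5) assms(3)] by simp
  ultimately show ?thesis
    using orth_compl_self_disjoint by fastforce
qed

context
  fixes S :: "'a::complex_hilbert set"
  assumes S: "cvs.subspace S" "closed S"
begin

lemma orth_proj_mem: "orth_proj S x \<in> S" and orth_proj_compl: "x - orth_proj S x \<in> orth_compl S"
proof -
  have "orth_proj S x \<in> S \<and> x - orth_proj S x \<in> orth_compl S"
    unfolding orth_proj_def
    by (rule theI') (use orth_projection_exists[OF S] orth_projection_unique[OF S(1)] in blast)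
  then show "orth_proj S x \<in> S" "x - orth_proj S x \<in> orth_compl S"
    by auto
qed

lemma orth_proj_eqI: "y \<in> S \<Longrightarrow> x - y \<in> orth_compl S \<Longrightarrow> orth_proj S x = y"
  using orth_projection_unique[OF S(1)] orth_proj_mem orth_proj_compl by blast

lemma orth_proj_fixes: "x \<in> S \<Longrightarrow> orth_proj S x = x"
  by (rule orth_proj_eqI) (auto simp: orth_compl_def)

lemma cinner_orth_proj: "y \<in> S \<Longrightarrow> cinner (orth_proj S x) y = cinner x y"
  using orth_proj_compl[of x] by (auto simp: orth_compl_def cinner.diff_left)

lemma norm_orth_proj_le: "norm (orth_proj S x) \<le> norm x"
proof (cases "orth_proj S x = 0")
  case False
  have "(norm (orth_proj S x))\<^sup>2 = cmod (cinner (orth_proj S x) (orth_proj S x))"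
    by (simp only: cinner_self norm_of_real) simp
  also have "\<dots> = cmod (cinner x (orth_proj S x))"
    by (simp add: cinner_orth_proj orth_proj_mem)
  also have "\<dots> \<le> norm x * norm (orth_proj S x)"
    by (rule cmod_cinner_le)
  finally show ?thesis
    using False by (simp add: power2_eq_square)
qed simp

lemma bounded_clinear_orth_proj: "bounded_clinear (orth_proj S)"
proof (rule bounded_clinear_intro[where K = 1])
  fix x y :: 'a and c
  show "orth_proj S (x + y) = orth_proj S x + orth_proj S y"
  proof (rule orth_proj_eqI)
    show "orth_proj S x + orth_proj S y \<in> S"
      by (simp add: S(1) cvs.subspace_add orth_proj_mem)
    show "x + y - (orth_proj S x + orth_proj S y) \<in> orth_compl S"
      using cvs.subspace_add[OF orth_compl_subspace orth_proj_compl[of x] orth_proj_compl[of y]]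
      by (simp add: algebra_simps)
  qed
  show "orth_proj S (c *\<^sub>C x) = c *\<^sub>C orth_proj S x"
  proof (rule orth_proj_eqI)
    show "c *\<^sub>C orth_proj S x \<in> S"
      by (simp add: S(1) cvs.subspace_scale orth_proj_mem)
    show "c *\<^sub>C x - c *\<^sub>C orth_proj S x \<in> orth_compl S"
      using cvs.subspace_scale[OF orth_compl_subspace orth_proj_compl[of x], of c]
      by (simp add: scaleC.diff_right)
  qed
  show "norm (orth_proj S x) \<le> 1 * norm x"
    by (simp add: norm_orth_proj_le)
qed

end

text \<open>The orthogonal complement of the kernel of a non-zero functional is a line; the representing
  vector lies on it.\<close>

lemma Riesz_representation:
  fixes \<phi> :: "'a::complex_hilbert \<Rightarrow> complex"
  assumes \<phi>: "bounded_clinear \<phi>"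
  shows "\<exists>z. \<forall>x. \<phi> x = cinner x z"
proof (cases "\<forall>x. \<phi> x = 0")
  case True
  then show ?thesis by (intro exI[of _ 0]) simp
next
  case False
  interpret bounded_linear \<phi>
    using \<phi> by (rule bounded_clinear_imp_bounded_linear)
  have scaleC: "\<phi> (c *\<^sub>C x) = c * \<phi> x" for c x
    using \<phi> by (simp add: bounded_clinear_scaleC)
  define N where "N = {x. \<phi> x = 0}"
  have N: "cvs.subspace N" "closed N"
    by (auto simp: N_def cvs.subspace_def add scaleC zero
        intro!: closed_Collect_eq continuous_intros continuous_on)
  from False obtain x0 where "\<phi> x0 \<noteq> 0" by auto
  define e where "e = x0 - orth_proj N x0"
  have "\<phi> (orth_proj N x0) = 0"
    using orth_proj_mem[OF N, of x0] by (simp add: N_def)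
  then have e: "\<phi> e \<noteq> 0"
    using \<open>\<phi> x0 \<noteq> 0\<close> by (simp add: e_def diff)
  then have "e \<noteq> 0"
    using zero by auto
  have perp: "cinner y e = 0" if "\<phi> y = 0" for y
    using orth_proj_compl[OF N, of x0] that by (auto simp: e_def N_def intro: orth_complD2)
  have key: "\<phi> x * cinner e e = \<phi> e * cinner x e" for x
    using perp[of "\<phi> e *\<^sub>C x - \<phi> x *\<^sub>C e"]
    by (simp add: diff scaleC cinner.diff_left cinner_scaleC_left)
  show ?thesis
  proof (intro exI allI)
    fix x
    show "\<phi> x = cinner x ((cnj (\<phi> e) / cinner e e) *\<^sub>C e)"
      using key[of x] \<open>e \<noteq> 0\<close> cinner_commute[of e e]
      by (simp add: cinner_scaleC_right field_simps)
  qed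
qed

subsection \<open>Adjoints on closed subspaces\<close>

text \<open>The functional \<open>x \<mapsto> cinner (T x) y\<close> is extended from \<open>S\<close> to the whole space by composing it with the
  projection, and its representing vector is projected back to \<open>S\<close>.\<close>

lemma adjoint_on_exists:
  fixes S :: "'a::complex_hilbert set"
  assumes S: "cvs.subspace S" "closed S" and T: "bounded_operator_on S T"
  shows "\<exists>z\<in>S. \<forall>x\<in>S. cinner (T x) y = cinner x z"
proof -
  obtain K where K: "\<And>x. x \<in> S \<Longrightarrow> norm (T x) \<le> K * norm x"
    using T unfolding bounded_operator_on_def by blast
  let ?P = "orth_proj S"
  have P: "?P (a + b) = ?P a + ?P b" "?P (c *\<^sub>C a) = c *\<^sub>C ?P a" for a b c
    using bounded_clinear_orth_proj[OF S]
    by (auto simp: bounded_clinear_def linear_simps)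
  have "bounded_clinear (\<lambda>x. cinner (T (?P x)) y)"
  proof (rule bounded_clinear_intro[where K = "\<bar>K\<bar> * norm y"])
    fix a b :: 'a and c
    show "cinner (T (?P (a + b))) y = cinner (T (?P a)) y + cinner (T (?P b)) y"
      using T orth_proj_mem[OF S] by (simp add: P bounded_operator_on_def cinner_add_left)
    show "cinner (T (?P (c *\<^sub>C a))) y = c *\<^sub>C cinner (T (?P a)) y"
      using T orth_proj_mem[OF S] by (simp add: P bounded_operator_on_def cinner_scaleC_left)
    have "norm (T (?P a)) \<le> K * norm (?P a)"
      using K orth_proj_mem[OF S] by blast
    also have "\<dots> \<le> \<bar>K\<bar> * norm a"
      by (intro mult_mono norm_orth_proj_le[OF S]) auto
    finally have "norm (T (?P a)) * norm y \<le> \<bar>K\<bar> * norm a * norm y"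
      by (simp add: mult_right_mono)
    then show "norm (cinner (T (?P a)) y) \<le> \<bar>K\<bar> * norm y * norm a"
      using cmod_cinner_le[of "T (?P a)" y] by (simp add: mult_ac)
  qed
  then obtain z where z: "cinner (T (?P x)) y = cinner x z" for x
    using Riesz_representation by metis
  have "cinner (T x) y = cinner x (?P z)" if "x \<in> S" for x
  proof -
    have "cinner (T x) y = cinner x z"
      using z[of x] that by (simp add: orth_proj_fixes[OF S])
    also have "\<dots> = cinner x (?P z)"
      using cinner_orth_proj[OF S that, of z] by (metis cinner_commute)
    finally show ?thesis .
  qed
  then show ?thesis
    using orth_proj_mem[OF S] by blast
qed

lemma adjoint_on_unique:
  fixes S :: "'a::complex_hilbert set"
  assumes "cvs.subspace S" "z \<in> S" "z' \<in> S" "\<forall>x\<in>S. cinner x z = cinner x z'"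
  shows "z = z'"
proof -
  have "z - z' \<in> S"
    using assms by (simp add: cvs.subspace_diff)
  then have "cinner (z - z') (z - z') = 0"
    using assms(4) by (simp add: cinner.diff_right)
  then show ?thesis by simp
qed

lemma adjoint_on_eqI:
  assumes "cvs.subspace S" and "z \<in> S" "\<And>x. x \<in> S \<Longrightarrow> cinner (T x) y = cinner x z"
  shows "adjoint_on S T y = z"
  unfolding adjoint_on_def
  by (rule the_equality) (use assms adjoint_on_unique[OF assms(1)] in auto)

lemma cinner_adjoint_on:
  assumes "cvs.subspace S" "closed S" "bounded_operator_on S T" "x \<in> S"
  shows "cinner (T x) y = cinner x (adjoint_on S T y)"
proof -
  obtain z where "z \<in> S" "\<forall>x\<in>S. cinner (T x) y = cinner x z"
    using adjoint_on_exists[OF assms(1-3)] by blast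
  then show ?thesis
    using adjoint_on_eqI[OF assms(1), of z T y] assms(4) by auto
qed

lemma cinner_adjoint:
  assumes "bounded_clinear T"
  shows "cinner (T x) y = cinner x (adjoint_on UNIV T y)"
  using assms cinner_adjoint_on[of UNIV T x y] by (simp add: bounded_operator_on_UNIV)

lemma bounded_clinear_adjoint:
  assumes T: "bounded_clinear T"
  shows "bounded_clinear (adjoint_on UNIV T)"
proof -
  interpret bounded_linear T
    using T by (rule bounded_clinear_imp_bounded_linear)
  obtain K where K: "\<And>x. norm (T x) \<le> norm x * K"
    using bounded by blast
  note adj = cinner_adjoint[OF T, symmetric]
  show ?thesis
  proof (rule bounded_clinear_intro[where K = K])
    fix x y c
    show "adjoint_on UNIV T (x + y) = adjoint_on UNIV T x + adjoint_on UNIV T y"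
      by (rule cinner_ext_right) (simp add: adj cinner_add_right)
    show "adjoint_on UNIV T (c *\<^sub>C x) = c *\<^sub>C adjoint_on UNIV T x"
      by (rule cinner_ext_right) (simp add: adj cinner_scaleC_right)
    let ?z = "adjoint_on UNIV T x"
    show "norm ?z \<le> K * norm x"
    proof (cases "?z = 0")
      case True
      then show ?thesis
        using K[of x] by (simp add: mult.commute) (meson norm_ge_zero order_trans)
    next
      case False
      have "(norm ?z)\<^sup>2 = cmod (cinner ?z ?z)"
        by (simp only: cinner_self norm_of_real) simp
      also have "\<dots> = cmod (cinner (T ?z) x)"
        by (simp add: adj)
      also have "\<dots> \<le> norm ?z * K * norm x"
        using cmod_cinner_le[of "T ?z" x] K[of ?z] by (meson mult_right_mono norm_ge_zero order_trans)
      finally show ?thesis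
        using False by (simp add: power2_eq_square mult_ac)
    qed
  qed
qed

subsection \<open>Closure properties of bounded operators\<close>

lemma bounded_clinear_ident: "bounded_clinear (\<lambda>x. x)"
  by (simp add: bounded_clinear_def bounded_linear_ident)

lemma bounded_clinear_zero: "bounded_clinear (\<lambda>x. 0)"
  by (simp add: bounded_clinear_def bounded_linear_zero)

lemma bounded_clinear_add:
  "bounded_clinear f \<Longrightarrow> bounded_clinear g \<Longrightarrow> bounded_clinear (\<lambda>x. f x + g x)"
  by (simp add: bounded_clinear_def bounded_linear_add scaleC_add_right)

lemma bounded_clinear_diff:
  "bounded_clinear f \<Longrightarrow> bounded_clinear g \<Longrightarrow> bounded_clinear (\<lambda>x. f x - g x)"
  by (simp add: bounded_clinear_def bounded_linear_sub scaleC.diff_right)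

lemma bounded_clinear_sum:
  "(\<And>i. i \<in> I \<Longrightarrow> bounded_clinear (f i)) \<Longrightarrow> bounded_clinear (\<lambda>x. \<Sum>i\<in>I. f i x)"
  by (auto simp: bounded_clinear_def bounded_linear_sum scaleC.sum_right)

lemma bounded_clinear_compose:
  "bounded_clinear f \<Longrightarrow> bounded_clinear g \<Longrightarrow> bounded_clinear (\<lambda>x. f (g x))"
  by (simp add: bounded_clinear_def bounded_linear_compose)

lemma bounded_clinear_scaleC_const: "bounded_clinear f \<Longrightarrow> bounded_clinear (\<lambda>x. c *\<^sub>C f x)"
  by (simp add: bounded_clinear_def scaleC.bounded_linear_right[THEN bounded_linear_compose]
      scaleC_scaleC mult.commute)

lemma bounded_clinear_vec_nth: "bounded_clinear (\<lambda>x. x $ i)"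
  by (simp add: bounded_clinear_def bounded_linear_vec_nth)

lemma norm_vec_le_sum: "norm (x :: 'a::real_normed_vector ^ 'n) \<le> (\<Sum>i\<in>UNIV. norm (x $ i))"
  unfolding norm_vec_def by (rule L2_set_le_sum) simp

lemma bounded_linear_vec_lambda:
  fixes f :: "'n::finite \<Rightarrow> 'a::real_normed_vector \<Rightarrow> 'b::real_normed_vector"
  assumes "\<And>i. bounded_linear (f i)"
  shows "bounded_linear (\<lambda>x. \<chi> i. f i x)"
proof -
  have "\<forall>i. \<exists>K. \<forall>x. norm (f i x) \<le> norm x * K"
    using assms bounded_linear.bounded by blast
  then obtain K where K: "\<And>i x. norm (f i x) \<le> norm x * K i"
    by metis
  show ?thesis
  proof (rule bounded_linear_intro[where K = "\<Sum>i\<in>UNIV. K i"])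
    fix x y :: 'a and r
    show "(\<chi> i. f i (x + y)) = (\<chi> i. f i x) + (\<chi> i. f i y)"
      "(\<chi> i. f i (r *\<^sub>R x)) = r *\<^sub>R (\<chi> i. f i x)"
      using assms by (auto simp: vec_eq_iff linear_simps)
    have "norm (\<chi> i. f i x) \<le> (\<Sum>i\<in>UNIV. norm (f i x))"
      using norm_vec_le_sum[of "\<chi> i. f i x"] by simp
    also have "\<dots> \<le> (\<Sum>i\<in>UNIV. norm x * K i)"
      by (intro sum_mono K)
    finally show "norm (\<chi> i. f i x) \<le> norm x * (\<Sum>i\<in>UNIV. K i)"
      by (simp add: sum_distrib_left)
  qed
qed

lemma bounded_clinear_vec_lambda:
  fixes f :: "'n::finite \<Rightarrow> 'a::complex_hilbert \<Rightarrow> 'b::complex_hilbert"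
  assumes "\<And>i. bounded_clinear (f i)"
  shows "bounded_clinear (\<lambda>x. \<chi> i. f i x)"
  using assms by (auto simp: bounded_clinear_def bounded_linear_vec_lambda vec_eq_iff)

lemmas bounded_clinear_intros = bounded_clinear_ident bounded_clinear_zero bounded_clinear_add
  bounded_clinear_diff bounded_clinear_sum bounded_clinear_scaleC_const bounded_clinear_vec_nth
  bounded_clinear_vec_lambda

lemma kernel_subspace: "bounded_clinear T \<Longrightarrow> cvs.subspace {x. T x = 0}"
  by (auto simp: cvs.subspace_def bounded_clinear_def linear_simps)

lemma kernel_closed: "bounded_clinear T \<Longrightarrow> closed {x. T x = 0}"
  by (rule closed_Collect_eq[OF linear_continuous_on continuous_on_const])
    (rule bounded_clinear_imp_bounded_linear)

lemma closure_cvs_subspace: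
  fixes S :: "'a::complex_hilbert set"
  assumes "cvs.subspace S"
  shows "cvs.subspace (closure S)"
  unfolding cvs.subspace_def
proof (intro conjI ballI allI)
  show "0 \<in> closure S"
    using cvs.subspace_0[OF assms] closure_subset by blast
next
  fix x y assume "x \<in> closure S" "y \<in> closure S"
  then obtain a b where "\<And>n. a n \<in> S" "a \<longlonglongrightarrow> x" "\<And>n. b n \<in> S" "b \<longlonglongrightarrow> y"
    unfolding closure_sequential by blast
  then show "x + y \<in> closure S"
    unfolding closure_sequential
    by (intro exI[of _ "\<lambda>n. a n + b n"]) (auto intro: tendsto_add cvs.subspace_add[OF assms])
next
  fix c x assume "x \<in> closure S"
  then obtain a where "\<And>n. a n \<in> S" "a \<longlonglongrightarrow> x"
    unfolding closure_sequential by blast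
  then show "c *\<^sub>C x \<in> closure S"
    unfolding closure_sequential
    by (intro exI[of _ "\<lambda>n. c *\<^sub>C a n"])
      (auto intro: scaleC.tendsto tendsto_const cvs.subspace_scale[OF assms])
qed

lemma bounded_operator_onI:
  assumes "bounded_clinear T" "\<And>x. x \<in> S \<Longrightarrow> T x \<in> S"
  shows "bounded_operator_on S T"
  using assms bounded_operator_on_UNIV[of T] unfolding bounded_operator_on_def by blast

section \<open>Operators with closed range\<close>

text \<open>This is the open mapping theorem for \<open>T\<close> as a map onto its range. Baire's theorem gives a ball in the
  range that is approximated by images of a bounded set; a preimage with error at most half of the
  given vector then exists with linear control of its norm, and the errors are removed successively
  by a geometric series.\<close>

lemma bounded_preimages_of_closed_range:
  fixes T :: "'a::banach \<Rightarrow> 'b::banach"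
  assumes T: "bounded_linear T" and closed: "closed (range T)"
  shows "\<exists>K>0. \<forall>y\<in>range T. \<exists>x. T x = y \<and> norm x \<le> K * norm y"
proof -
  interpret bounded_linear T by fact
  let ?Y = "range T"
  have Y_add: "a + b \<in> ?Y" and Y_diff: "a - b \<in> ?Y" and Y_scale: "r *\<^sub>R a \<in> ?Y"
    if "a \<in> ?Y" "b \<in> ?Y" for a b r
    using that by (auto simp only: add[symmetric] diff[symmetric] scaleR[symmetric])
  define C where "C n = closure (T ` cball 0 (real n))" for n
  have C_sub: "C n \<subseteq> ?Y" for n
    unfolding C_def using closed by (intro closure_minimal) auto
  have cover: "\<Union>(range C) = ?Y"
  proof
    show "?Y \<subseteq> \<Union>(range C)"
    proof clarify
      fix x :: 'a
      obtain n where "norm x \<le> real n"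
        using real_arch_simple by blast
      then have "T x \<in> C n"
        unfolding C_def by (intro closure_subset[THEN subsetD]) auto
      then show "T x \<in> \<Union>(range C)" by blast
    qed
  qed (use C_sub in blast)
  have "\<exists>n. (top_of_set ?Y) interior_of (C n) \<noteq> {}"
  proof (rule ccontr)
    assume "\<nexists>n. (top_of_set ?Y) interior_of (C n) \<noteq> {}"
    then have "(top_of_set ?Y) interior_of (\<Union>(range C)) = {}"
      using closed C_sub
      by (intro Baire_category_alt)
        (auto simp: C_def closed_subset completely_metrizable_space_closedin
          completely_metrizable_space_euclidean)
    then show False
      using interior_of_topspace[of "top_of_set ?Y"] by (auto simp: cover)
  qed
  then obtain n y0 where "y0 \<in> (top_of_set ?Y) interior_of (C n)" by blast
  then obtain U where U: "open U" "y0 \<in> U" "y0 \<in> ?Y" "?Y \<inter> U \<subseteq> C n"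
    by (auto simp: interior_of_def openin_open)
  then obtain e where e: "e > 0" "ball y0 e \<subseteq> U"
    using openE by blast
  have approx: "\<exists>x. norm x \<le> 2 * real n \<and> norm (y - T x) < d"
    if y: "y \<in> ?Y" "norm y < e" and d: "d > 0" for y d
  proof -
    have "y0 + y \<in> ?Y"
      using y(1) U(3) by (intro Y_add)
    moreover have "y0 + y \<in> U"
      using e(2) y(2) by (intro subsetD[OF e(2)]) (simp add: dist_norm)
    ultimately have "y0 + y \<in> C n" "y0 \<in> C n"
      using U(2-4) by blast+
    then have "\<exists>z\<in>T ` cball 0 (real n). dist z (y0 + y) < d / 2"
      "\<exists>z\<in>T ` cball 0 (real n). dist z y0 < d / 2"
      using half_gt_zero[OF d] unfolding C_def closure_approachable by blast+
    then obtain x1 x2 where x: "norm x1 \<le> real n" "dist (T x1) (y0 + y) < d / 2"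
      "norm x2 \<le> real n" "dist (T x2) y0 < d / 2"
      by auto
    have eq: "y - T (x1 - x2) = (T x2 - y0) - (T x1 - (y0 + y))"
      by (simp add: diff)
    have "norm (y - T (x1 - x2)) < d"
      using x(2,4) norm_triangle_ineq4[of "T x2 - y0" "T x1 - (y0 + y)"]
      unfolding eq dist_norm by linarith
    moreover have "norm (x1 - x2) \<le> 2 * real n"
      using x norm_triangle_ineq4[of x1 x2] by simp
    ultimately show ?thesis by blast
  qed
  define K where "K = 4 * real n / e + 1"
  have K: "K > 0"
    using e by (simp add: K_def add_nonneg_pos)
  have half: "\<exists>x. norm x \<le> K * norm y \<and> norm (y - T x) \<le> norm y / 2" if y: "y \<in> ?Y" for y
  proof (cases "y = 0")
    case True
    then show ?thesis by (intro exI[of _ 0]) (simp add: zero)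
  next
    case False
    define s where "s = e / (2 * norm y)"
    have s: "s > 0" "norm (s *\<^sub>R y) = e / 2"
      using e False by (auto simp: s_def)
    then obtain x where x: "norm x \<le> 2 * real n" "norm (s *\<^sub>R y - T x) < e / 4"
      using approx[of "s *\<^sub>R y" "e / 4"] Y_scale y e by fastforce
    have "norm (y - T ((1 / s) *\<^sub>R x)) = norm ((1 / s) *\<^sub>R (s *\<^sub>R y - T x))"
      using s by (simp add: scaleR scaleR_diff_right)
    also have "\<dots> = norm (s *\<^sub>R y - T x) / s"
      using s by simp
    also have "\<dots> \<le> norm y / 2"
      using x(2) e False by (simp add: s_def field_simps)
    finally have 1: "norm (y - T ((1 / s) *\<^sub>R x)) \<le> norm y / 2" .
    have "norm ((1 / s) *\<^sub>R x) \<le> (4 * real n / e) * norm y"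
      using x(1) s e False by (simp add: s_def field_simps)
    also have "\<dots> \<le> K * norm y"
      by (intro mult_right_mono) (auto simp: K_def)
    finally show ?thesis
      using 1 by blast
  qed
  then obtain g where g: "\<And>y. y \<in> ?Y \<Longrightarrow> norm (g y) \<le> K * norm y"
    "\<And>y. y \<in> ?Y \<Longrightarrow> norm (y - T (g y)) \<le> norm y / 2"
    by metis
  have "\<exists>x. T x = y \<and> norm x \<le> 2 * K * norm y" if y: "y \<in> ?Y" for y
  proof -
    define r where "r = rec_nat y (\<lambda>_ z. z - T (g z))"
    have r: "r 0 = y" "r (Suc n) = r n - T (g (r n))" for n
      by (simp_all add: r_def)
    have rY: "r n \<in> ?Y" for n
      by (induction n) (auto simp: r y intro!: Y_diff)
    have r_le: "norm (r n) \<le> norm y * (1/2) ^ n" for n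
    proof (induction n)
      case (Suc n)
      then show ?case
        using g(2)[OF rY[of n]] by (simp add: r)
    qed (simp add: r)
    have g_le: "norm (g (r n)) \<le> K * norm y * (1/2) ^ n" for n
    proof -
      have "norm (g (r n)) \<le> K * norm (r n)"
        by (rule g(1)[OF rY])
      also have "\<dots> \<le> K * (norm y * (1/2) ^ n)"
        using K by (intro mult_left_mono r_le) auto
      finally show ?thesis
        by (simp add: mult.assoc)
    qed
    have geo: "(\<lambda>n. K * norm y * (1/2) ^ n) sums (K * norm y * 2)"
      using sums_mult[OF geometric_sums[of "1/2 :: real"], of "K * norm y"] by simp
    have summ: "summable (\<lambda>n. norm (g (r n)))"
      by (rule summable_comparison_test'[OF sums_summable[OF geo], of 0]) (use g_le in auto)
    let ?x = "\<Sum>n. g (r n)"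
    have "norm ?x \<le> (\<Sum>n. norm (g (r n)))"
      by (rule summable_norm[OF summ])
    also have "\<dots> \<le> K * norm y * 2"
      using suminf_le[OF g_le summ sums_summable[OF geo]] sums_unique[OF geo] by simp
    finally have x_le: "norm ?x \<le> 2 * K * norm y" by (simp add: mult_ac)
    have "(\<lambda>n. T (g (r n))) sums T ?x"
      by (rule sums[OF summable_sums[OF summable_norm_cancel[OF summ]]])
    moreover have "(\<lambda>n. T (g (r n))) sums y"
    proof -
      have "(\<Sum>k<n. T (g (r k))) = y - r n" for n
        by (induction n) (simp_all add: r)
      moreover have "r \<longlonglongrightarrow> 0"
      proof (rule Lim_null_comparison)
        show "\<forall>\<^sub>F n in sequentially. norm (r n) \<le> norm y * (1/2) ^ n"
          by (simp add: r_le)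
        show "(\<lambda>n. norm y * (1/2) ^ n) \<longlonglongrightarrow> 0"
          by (intro tendsto_mult_right_zero LIMSEQ_realpow_zero) auto
      qed
      ultimately show ?thesis
        unfolding sums_def using tendsto_diff[OF tendsto_const[of y]] by fastforce
    qed
    ultimately show ?thesis
      using x_le sums_unique2 by blast
  qed
  then show ?thesis
    using K by (intro exI[of _ "2 * K"]) auto
qed

text \<open>A vector orthogonal to the kernel is the shortest one with its image, hence at most as long as the
  preimage that the open mapping theorem provides.\<close>

lemma bounded_below_on_orth_kernel:
  fixes T :: "'a::complex_hilbert \<Rightarrow> 'b::complex_hilbert"
  assumes T: "bounded_clinear T" and closed: "closed (range T)"
  shows "\<exists>c>0. \<forall>h\<in>orth_compl {x. T x = 0}. norm h \<le> c * norm (T h)"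
proof -
  interpret bounded_linear T
    using T by (rule bounded_clinear_imp_bounded_linear)
  obtain K where K: "K > 0" "\<And>y. y \<in> range T \<Longrightarrow> \<exists>x. T x = y \<and> norm x \<le> K * norm y"
    using bounded_preimages_of_closed_range[OF bounded_linear_axioms closed] by blast
  have "norm h \<le> K * norm (T h)" if h: "h \<in> orth_compl {x. T x = 0}" for h
  proof (cases "h = 0")
    case True
    then show ?thesis using K(1) by simp
  next
    case False
    obtain x where x: "T x = T h" "norm x \<le> K * norm (T h)"
      using K(2) by blast
    have "cinner h (h - x) = 0"
      using h x(1) by (simp add: orth_compl_def diff)
    then have "cinner h x = complex_of_real ((norm h)\<^sup>2)"
      by (simp only: cinner.diff_right cinner_self) simp
    then have "cmod (cinner h x) = (norm h)\<^sup>2"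
      by (simp only: norm_of_real) simp
    then have "(norm h)\<^sup>2 \<le> norm h * norm x"
      using cmod_cinner_le[of h x] by simp
    then show ?thesis
      using x(2) False by (simp add: power2_eq_square)
  qed
  then show ?thesis
    using K(1) by blast
qed

section \<open>Anti-holomorphic maps\<close>

text \<open>The condition at a single point is isolated because the local sections of the eigenbundle are first
  known to be differentiable at one point only.\<close>

definition antihol_at :: "(complex ^ 'n \<Rightarrow> 'h::complex_hilbert) \<Rightarrow> complex ^ 'n \<Rightarrow> bool" where
  "antihol_at f w \<longleftrightarrow>
     (\<exists>D. (f has_derivative D) (at w) \<and> (\<forall>c v. D (c *\<^sub>C v) = cnj c *\<^sub>C D v))"

lemma antiholomorphic_on_iff: "antiholomorphic_on f U \<longleftrightarrow> (\<forall>w\<in>U. antihol_at f w)"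
  by (simp add: antiholomorphic_on_def antihol_at_def)

lemma antihol_at_cong:
  assumes "open U" "w \<in> U" "\<And>x. x \<in> U \<Longrightarrow> f x = g x"
  shows "antihol_at f w \<longleftrightarrow> antihol_at g w"
proof -
  have "(f has_derivative D) (at w) \<longleftrightarrow> (g has_derivative D) (at w)" for D
    using has_derivative_transform_within_open[OF _ assms(1,2), where f = f and g = g]
      has_derivative_transform_within_open[OF _ assms(1,2), where f = g and g = f] assms(3)
    by (metis (no_types))
  then show ?thesis
    by (simp add: antihol_at_def)
qed

lemma antihol_at_imp_isCont: "antihol_at f w \<Longrightarrow> isCont f w"
  by (auto simp: antihol_at_def intro: has_derivative_continuous)

lemma antihol_at_const: "antihol_at (\<lambda>w. c) w"
  unfolding antihol_at_def by (intro exI[of _ "\<lambda>v. 0"]) (auto intro!: derivative_eq_intros)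

lemma antihol_at_bounded_clinear:
  assumes "bounded_clinear T" "antihol_at f w"
  shows "antihol_at (\<lambda>w. T (f w)) w"
proof -
  obtain D where D: "(f has_derivative D) (at w)" "\<And>c v. D (c *\<^sub>C v) = cnj c *\<^sub>C D v"
    using assms by (auto simp: antihol_at_def)
  show ?thesis
    unfolding antihol_at_def
    using bounded_linear.has_derivative[OF bounded_clinear_imp_bounded_linear[OF assms(1)] D(1)]
    by (intro exI[of _ "\<lambda>v. T (D v)"]) (simp add: D(2) bounded_clinear_scaleC[OF assms(1)])
qed

lemma antihol_at_cinner_left: "antihol_at f w \<Longrightarrow> antihol_at (\<lambda>w. cinner (f w) k) w"
  by (rule antihol_at_bounded_clinear[of "\<lambda>x. cinner x k"])
    (simp add: bounded_clinear_def cinner.bounded_linear_left cinner_scaleC_left)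

lemma antihol_at_scaleC:
  assumes "antihol_at f w" "antihol_at g w"
  shows "antihol_at (\<lambda>w. f w *\<^sub>C g w) w"
proof -
  obtain D D' where D: "(f has_derivative D) (at w)" "\<And>c v. D (c *\<^sub>C v) = cnj c *\<^sub>C D v"
    "(g has_derivative D') (at w)" "\<And>c v. D' (c *\<^sub>C v) = cnj c *\<^sub>C D' v"
    using assms by (auto simp: antihol_at_def)
  show ?thesis
    unfolding antihol_at_def using scaleC.FDERIV[OF D(1,3)]
    by (intro exI[of _ "\<lambda>v. f w *\<^sub>C D' v + D v *\<^sub>C g w"])
      (simp add: D(2,4) scaleC_add_right scaleC_scaleC mult.commute)
qed

lemma antihol_at_mult:
  "antihol_at f w \<Longrightarrow> antihol_at g w \<Longrightarrow> antihol_at (\<lambda>w. f w * g w :: complex) w"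
  using antihol_at_scaleC[of f w g] by simp

lemma antihol_at_add:
  assumes "antihol_at f w" "antihol_at g w"
  shows "antihol_at (\<lambda>w. f w + g w) w"
proof -
  obtain D D' where D: "(f has_derivative D) (at w)" "\<And>c v. D (c *\<^sub>C v) = cnj c *\<^sub>C D v"
    "(g has_derivative D') (at w)" "\<And>c v. D' (c *\<^sub>C v) = cnj c *\<^sub>C D' v"
    using assms by (auto simp: antihol_at_def)
  show ?thesis
    unfolding antihol_at_def using has_derivative_add[OF D(1,3)]
    by (intro exI[of _ "\<lambda>v. D v + D' v"]) (simp add: D(2,4) scaleC_add_right)
qed

lemma antihol_at_diff:
  assumes "antihol_at f w" "antihol_at g w"
  shows "antihol_at (\<lambda>w. f w - g w) w"
proof -
  have "antihol_at (\<lambda>w. f w + (-1) *\<^sub>C g w) w"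
    by (intro antihol_at_add antihol_at_scaleC antihol_at_const assms)
  then show ?thesis
    by (simp add: scaleC.minus_left)
qed

lemma antihol_at_sum:
  "finite I \<Longrightarrow> (\<And>i. i \<in> I \<Longrightarrow> antihol_at (f i) w) \<Longrightarrow> antihol_at (\<lambda>w. \<Sum>i\<in>I. f i w) w"
  by (induction I rule: finite_induct) (auto intro: antihol_at_const antihol_at_add)

lemma antihol_at_inverse:
  fixes f :: "complex ^ 'n \<Rightarrow> complex"
  assumes "antihol_at f w" "f w \<noteq> 0"
  shows "antihol_at (\<lambda>w. 1 / f w) w"
proof -
  obtain D where D: "(f has_derivative D) (at w)" "\<And>c v. D (c *\<^sub>C v) = cnj c *\<^sub>C D v"
    using assms by (auto simp: antihol_at_def)
  show ?thesis
    unfolding antihol_at_def using Deriv.has_derivative_inverse[OF assms(2) D(1)]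
    by (intro exI[of _ "\<lambda>v. - (inverse (f w) * D v * inverse (f w))"])
      (simp add: D(2) inverse_eq_divide)
qed

lemma has_derivative_vec_lambda:
  fixes f :: "'n::finite \<Rightarrow> 'a::real_normed_vector \<Rightarrow> 'b::real_normed_vector"
  assumes "\<And>i. (f i has_derivative D i) (at x)"
  shows "((\<lambda>x. \<chi> i. f i x) has_derivative (\<lambda>v. \<chi> i. D i v)) (at x)"
proof -
  have "(\<lambda>y. (1 / norm (y - x)) *\<^sub>R (f i y - (f i x + D i (y - x)))) \<midarrow>x\<rightarrow> 0" for i
    using assms[of i] by (simp add: has_derivative_within)
  then have "(\<lambda>y. (\<Sum>i\<in>UNIV. norm ((1 / norm (y - x)) *\<^sub>R (f i y - (f i x + D i (y - x)))))) \<midarrow>x\<rightarrow> (\<Sum>i\<in>(UNIV::'n set). 0)"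
    by (intro tendsto_sum tendsto_norm_zero)
  then have lim: "(\<lambda>y. (\<Sum>i\<in>UNIV. norm ((1 / norm (y - x)) *\<^sub>R (f i y - (f i x + D i (y - x)))))) \<midarrow>x\<rightarrow> 0"
    by simp
  have "(\<lambda>y. (1 / norm (y - x)) *\<^sub>R ((\<chi> i. f i y) - ((\<chi> i. f i x) + (\<chi> i. D i (y - x))))) \<midarrow>x\<rightarrow> 0"
  proof (rule Lim_null_comparison[OF _ lim])
    show "\<forall>\<^sub>F y in at x. norm ((1 / norm (y - x)) *\<^sub>R ((\<chi> i. f i y) - ((\<chi> i. f i x) + (\<chi> i. D i (y - x)))))
        \<le> (\<Sum>i\<in>UNIV. norm ((1 / norm (y - x)) *\<^sub>R (f i y - (f i x + D i (y - x)))))"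
      by (intro always_eventually allI order_trans[OF norm_vec_le_sum]) simp
  qed
  then show ?thesis
    using assms by (auto simp: has_derivative_within intro!: bounded_linear_vec_lambda)
qed

lemma antihol_at_vec_lambda:
  fixes f :: "'m::finite \<Rightarrow> complex ^ 'n \<Rightarrow> 'h::complex_hilbert"
  assumes "\<And>i. antihol_at (f i) w"
  shows "antihol_at (\<lambda>w. \<chi> i. f i w) w"
proof -
  obtain D where D: "\<And>i. (f i has_derivative D i) (at w)" "\<And>i c v. D i (c *\<^sub>C v) = cnj c *\<^sub>C D i v"
    using assms unfolding antihol_at_def by meson
  show ?thesis
    unfolding antihol_at_def using has_derivative_vec_lambda[OF D(1)]
    by (intro exI[of _ "\<lambda>v. \<chi> i. D i v"]) (simp add: D(2) vec_eq_iff)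
qed

lemma antihol_at_vec_nth: "antihol_at f w \<Longrightarrow> antihol_at (\<lambda>w. f w $ i) w"
  by (rule antihol_at_bounded_clinear[OF bounded_clinear_vec_nth])

lemma norm_tensor: "norm (tensor (k::'h::complex_hilbert) (v::complex ^ 'm)) = norm k * norm v"
proof -
  have "complex_of_real ((norm (tensor k v))\<^sup>2) = complex_of_real ((norm k * norm v)\<^sup>2)"
    using cinner_tensor[of k v k v] unfolding cinner_self power_mult_distrib of_real_mult .
  then have "(norm (tensor k v))\<^sup>2 = (norm k * norm v)\<^sup>2"
    by (simp only: of_real_eq_iff)
  then show ?thesis
    by (simp add: power2_eq_iff_nonneg)
qed

lemma bounded_bilinear_tensor:
  "bounded_bilinear (tensor :: 'h::complex_hilbert \<Rightarrow> complex ^ 'm::finite \<Rightarrow> 'h ^ 'm)"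
proof
  fix k k' :: 'h and v v' :: "complex ^ 'm" and r
  show "tensor (k + k') v = tensor k v + tensor k' v" "tensor k (v + v') = tensor k v + tensor k v'"
    by (simp_all add: tensor_def vec_eq_iff scaleC_add_left scaleC_add_right)
  show "tensor (r *\<^sub>R k) v = r *\<^sub>R tensor k v" "tensor k (r *\<^sub>R v) = r *\<^sub>R tensor k v"
    by (simp_all add: tensor_def vec_eq_iff scaleR_scaleC scaleC_scaleC mult.commute)
  show "\<exists>K. \<forall>k v. norm (tensor k v :: 'h ^ 'm) \<le> norm k * norm v * K"
    by (intro exI[of _ 1]) (simp add: norm_tensor)
qed

lemma tensor_scaleC_left: "tensor (c *\<^sub>C k) v = c *\<^sub>C tensor k v"
  and tensor_scaleC_right: "tensor k (c *\<^sub>C v) = c *\<^sub>C tensor k v"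
  by (simp_all add: tensor_def vec_eq_iff scaleC_scaleC mult.commute)

lemma antihol_at_tensor:
  assumes "antihol_at k w" "antihol_at v w"
  shows "antihol_at (\<lambda>w. tensor (k w) (v w :: complex ^ 'm::finite)) w"
  unfolding tensor_def using assms
  by (intro antihol_at_vec_lambda antihol_at_scaleC antihol_at_vec_nth)

subsection \<open>Anti-holomorphic maps are twice differentiable\<close>

text \<open>The estimate is linear in \<open>B\<close>, which makes it uniform over families of scalar functions obtained from
  one vector-valued function. The disc of radius \<open>r / 4\<close> about a point of the disc of radius \<open>r / 2\<close> stays inside
  the disc where \<open>\<phi>\<close> is holomorphic.\<close>

lemma Cauchy_deriv_bound:
  fixes \<phi> :: "complex \<Rightarrow> complex"
  assumes hol: "\<phi> holomorphic_on ball 0 r" and r: "r > 0"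
    and bound: "\<And>z. z \<in> ball 0 r \<Longrightarrow> cmod (\<phi> z) < B" and x: "cmod x \<le> r / 2" and n: "n > 0"
  shows "cmod ((deriv ^^ n) \<phi> x) \<le> fact n * B / (r / 4) ^ n"
proof (rule Cauchy_higher_deriv_bound[where y = 0])
  have sub: "cball x (r / 4) \<subseteq> ball 0 r"
  proof
    fix z assume "z \<in> cball x (r / 4)"
    then show "z \<in> ball 0 r"
      using x r norm_triangle_ineq2[of z x] by (simp add: dist_norm norm_minus_commute)
  qed
  show "continuous_on (cball x (r / 4)) \<phi>"
    by (rule holomorphic_on_imp_continuous_on[OF holomorphic_on_subset[OF hol sub]])
  show "\<phi> holomorphic_on ball x (r / 4)"
    using sub ball_subset_cball by (intro holomorphic_on_subset[OF hol]) blast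
  show "\<phi> z \<in> ball 0 B" if "z \<in> ball x (r / 4)" for z
    using sub ball_subset_cball that bound by (auto simp: subset_iff)
qed (use r n in auto)

lemma second_order_remainder:
  fixes \<phi> :: "complex \<Rightarrow> complex"
  assumes hol: "\<phi> holomorphic_on ball 0 r" and r: "r > 0"
    and bound: "\<And>z. z \<in> ball 0 r \<Longrightarrow> cmod (\<phi> z) < B" and z: "cmod z \<le> r / 2"
  shows "cmod (\<phi> z - \<phi> 0 - z * deriv \<phi> 0) \<le> 32 * B / r\<^sup>2 * (cmod z)\<^sup>2"
proof -
  have "cmod ((deriv ^^ 0) \<phi> z - (\<Sum>i\<le>1. (deriv ^^ i) \<phi> 0 * (z - 0) ^ i / fact i))
      \<le> 32 * B / r\<^sup>2 * cmod (z - 0) ^ Suc 1 / fact 1"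
  proof (rule complex_Taylor)
    show "convex (cball 0 (r / 2) :: complex set)" by simp
    show "((deriv ^^ i) \<phi> has_field_derivative (deriv ^^ Suc i) \<phi> x) (at x within cball 0 (r / 2))"
      if "x \<in> cball 0 (r / 2)" for i x
    proof -
      have "(deriv ^^ i) \<phi> holomorphic_on ball 0 r"
        using hol by (intro holomorphic_higher_deriv) auto
      then have "((deriv ^^ i) \<phi> has_field_derivative deriv ((deriv ^^ i) \<phi>) x) (at x)"
        using that r by (intro holomorphic_derivI[of _ "ball 0 r"]) auto
      then show ?thesis
        by (simp add: has_field_derivative_at_within)
    qed
    show "cmod ((deriv ^^ Suc 1) \<phi> x) \<le> 32 * B / r\<^sup>2" if "x \<in> cball 0 (r / 2)" for x
      using Cauchy_deriv_bound[OF hol r bound, of x "Suc 1"] that r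
      by (simp add: power2_eq_square field_simps)
  qed (use r z in auto)
  then show ?thesis
    by (simp add: power2_eq_square algebra_simps)
qed

subsection \<open>Directional derivatives of anti-holomorphic maps\<close>

text \<open>Along the complex line parametrised by \<open>cnj s\<close> an anti-holomorphic map becomes holomorphic in \<open>s\<close>.\<close>

lemma antihol_at_line:
  assumes "antihol_at f w"
  shows "((\<lambda>s. f (w + cnj s *\<^sub>C v)) has_derivative (\<lambda>s. s *\<^sub>C dir_deriv f w v)) (at 0)"
    and "((\<lambda>t. f (w + t *\<^sub>R v)) has_vector_derivative dir_deriv f w v) (at 0)"
    and "dir_deriv f w (c *\<^sub>C v) = cnj c *\<^sub>C dir_deriv f w v"
proof -
  obtain D where D: "(f has_derivative D) (at w)" "\<And>c v. D (c *\<^sub>C v) = cnj c *\<^sub>C D v"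
    using assms by (auto simp: antihol_at_def)
  have line: "((\<lambda>t. f (w + t *\<^sub>R v)) has_vector_derivative D v) (at 0)" for v
  proof -
    have "((\<lambda>t. w + t *\<^sub>R v) has_derivative (\<lambda>t. t *\<^sub>R v)) (at 0)"
      by (auto intro!: derivative_eq_intros)
    then have "((\<lambda>t. f (w + t *\<^sub>R v)) has_derivative (\<lambda>t. D (t *\<^sub>R v))) (at 0)"
      using has_derivative_compose[of "\<lambda>t. w + t *\<^sub>R v" _ 0 UNIV f D] D(1) by simp
    then show ?thesis
      using linear_scale[OF has_derivative_linear[OF D(1)]] by (simp add: has_vector_derivative_def)
  qed
  have dir: "dir_deriv f w v = D v" for v
    unfolding dir_deriv_def by (rule vector_derivative_at[OF line])
  show "((\<lambda>t. f (w + t *\<^sub>R v)) has_vector_derivative dir_deriv f w v) (at 0)"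
    unfolding dir by (rule line)
  show "dir_deriv f w (c *\<^sub>C v) = cnj c *\<^sub>C dir_deriv f w v"
    by (simp add: dir D(2))
  have "((\<lambda>s. w + cnj s *\<^sub>C v) has_derivative (\<lambda>s. cnj s *\<^sub>C v)) (at 0)"
    by (auto intro!: derivative_eq_intros bounded_linear.has_derivative[OF bounded_linear_cnj]
        bounded_linear.has_derivative[OF scaleC.bounded_linear_left])
  then have "((\<lambda>s. f (w + cnj s *\<^sub>C v)) has_derivative (\<lambda>s. D (cnj s *\<^sub>C v))) (at 0)"
    using has_derivative_compose[of "\<lambda>s. w + cnj s *\<^sub>C v" _ 0 UNIV f D] D(1) by simp
  then show "((\<lambda>s. f (w + cnj s *\<^sub>C v)) has_derivative (\<lambda>s. s *\<^sub>C dir_deriv f w v)) (at 0)"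
    by (simp add: dir D(2))
qed

lemma cinner_line_field_derivative:
  assumes "antihol_at f (w + cnj s *\<^sub>C v)"
  shows "((\<lambda>s. cinner (f (w + cnj s *\<^sub>C v)) h) has_field_derivative
    cinner (dir_deriv f (w + cnj s *\<^sub>C v) v) h) (at s)"
proof -
  let ?z = "w + cnj s *\<^sub>C v"
  have "((\<lambda>u. f (?z + cnj u *\<^sub>C v)) has_derivative (\<lambda>u. u *\<^sub>C dir_deriv f ?z v)) (at (s - s))"
    using antihol_at_line(1)[OF assms] by simp
  moreover have "((\<lambda>u. u - s) has_derivative (\<lambda>u. u)) (at s)"
    by (auto intro!: derivative_eq_intros)
  ultimately have "((\<lambda>u. f (?z + cnj (u - s) *\<^sub>C v)) has_derivative (\<lambda>u. u *\<^sub>C dir_deriv f ?z v)) (at s)"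
    by (rule has_derivative_compose[rotated])
  then have "((\<lambda>u. f (w + cnj u *\<^sub>C v)) has_derivative (\<lambda>u. u *\<^sub>C dir_deriv f ?z v)) (at s)"
    by (simp add: scaleC.diff_left)
  from bounded_linear.has_derivative[OF cinner.bounded_linear_left this, of h]
  show ?thesis
    by (simp add: has_field_derivative_def cinner_scaleC_left mult_commute_abs)
qed

text \<open>Pairing with a vector \<open>h\<close> reduces the claim to a scalar function of two complex variables,
  holomorphic in each. Its partial derivative is a uniform limit of difference quotients, hence
  holomorphic in the other variable, and the Cauchy estimates are uniform over the unit ball of
  vectors \<open>h\<close>, so that the Riesz representation turns the scalar derivatives into a vector.\<close>

lemma dir_deriv_differentiable:
  fixes f :: "complex ^ 'n::finite \<Rightarrow> 'h::complex_hilbert"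
  assumes U: "open U" "w \<in> U" and f: "\<And>z. z \<in> U \<Longrightarrow> antihol_at f z"
  shows "\<exists>q. ((\<lambda>t. dir_deriv f (w + t *\<^sub>R b) a) has_vector_derivative q) (at 0)"
proof -
  \<comment> \<open>A bidisc of radius \<open>r\<close> in the directions \<open>b\<close> and \<open>a\<close> on which \<open>f\<close> is bounded by \<open>B\<close>.\<close>
  define B where "B = norm (f w) + 1"
  have "\<forall>\<^sub>F z in nhds w. norm (f z) < B"
  proof (rule order_tendstoD(2))
    show "((\<lambda>z. norm (f z)) \<longlongrightarrow> norm (f w)) (nhds w)"
      using antihol_at_imp_isCont[OF f[OF U(2)]]
      by (intro tendsto_norm) (simp add: isCont_def tendsto_at_iff_tendsto_nhds)
  qed (simp add: B_def)
  with eventually_nhds_in_open[OF U] have "\<forall>\<^sub>F z in nhds w. z \<in> U \<and> norm (f z) < B"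
    by eventually_elim simp
  then obtain \<delta> where \<delta>: "\<delta> > 0" "\<And>z. dist z w < \<delta> \<Longrightarrow> z \<in> U \<and> norm (f z) < B"
    unfolding eventually_nhds_metric by blast
  define r where "r = \<delta> / (norm a + norm b + 1)"
  have pos: "norm a + norm b + 1 > 0"
    by (simp add: add_nonneg_pos)
  have r: "r > 0"
    using \<delta>(1) pos by (simp add: r_def)
  have near: "w + cnj t *\<^sub>C b + cnj s *\<^sub>C a \<in> U \<and> norm (f (w + cnj t *\<^sub>C b + cnj s *\<^sub>C a)) < B"
    if "cmod s < r" "cmod t < r" for s t
  proof (rule \<delta>(2))
    have "norm (cnj t *\<^sub>C b + cnj s *\<^sub>C a) \<le> cmod t * norm b + cmod s * norm a"
      using norm_triangle_ineq[of "cnj t *\<^sub>C b" "cnj s *\<^sub>C a"] by (simp add: norm_scaleC)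
    also have "\<dots> \<le> r * norm b + r * norm a"
      using that by (intro add_mono mult_right_mono) auto
    also have "\<dots> < r * (norm a + norm b + 1)"
      using r by (simp add: algebra_simps)
    also have "\<dots> = \<delta>"
      using pos by (simp add: r_def)
    finally show "dist (w + cnj t *\<^sub>C b + cnj s *\<^sub>C a) w < \<delta>"
      by (simp add: dist_norm add.assoc)
  qed
  have nearU: "w + cnj t *\<^sub>C b \<in> U" if "cmod t < r" for t
    using near[of 0 t] that r by simp
  define u where "u h s t = cinner (f (w + cnj t *\<^sub>C b + cnj s *\<^sub>C a)) h" for h s t
  define p where "p t = dir_deriv f (w + cnj t *\<^sub>C b) a" for t
  define d where "d h t = cinner (p t) h" for h t
  have u_bound: "cmod (u h s t) < B * norm h" if "cmod s < r" "cmod t < r" "h \<noteq> 0" for h s t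
  proof -
    have "cmod (u h s t) \<le> norm (f (w + cnj t *\<^sub>C b + cnj s *\<^sub>C a)) * norm h"
      unfolding u_def by (rule cmod_cinner_le)
    also have "\<dots> < B * norm h"
      using near[OF that(1,2)] that(3) by (intro mult_strict_right_mono) auto
    finally show ?thesis .
  qed
  have u_s: "((\<lambda>s. u h s t) has_field_derivative
      cinner (dir_deriv f (w + cnj t *\<^sub>C b + cnj s *\<^sub>C a) a) h) (at s)"
    if "cmod s < r" "cmod t < r" for h s t
    unfolding u_def using near[OF that] by (intro cinner_line_field_derivative f) auto
  have u_t: "((\<lambda>t. u h s t) has_field_derivative
      cinner (dir_deriv f (w + cnj s *\<^sub>C a + cnj t *\<^sub>C b) b) h) (at t)"
    if "cmod s < r" "cmod t < r" for h s t
    using cinner_line_field_derivative[of f "w + cnj s *\<^sub>C a" t b h] near[OF that] f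
    by (simp add: u_def add.assoc add.commute add.left_commute)
  have hol_s: "(\<lambda>s. u h s t) holomorphic_on ball 0 r" if "cmod t < r" for h t
    unfolding holomorphic_on_def field_differentiable_def
  proof
    fix s :: complex assume "s \<in> ball 0 r"
    then show "\<exists>D. ((\<lambda>s. u h s t) has_field_derivative D) (at s within ball 0 r)"
      using has_field_derivative_at_within[OF u_s[OF _ that]] by auto
  qed
  have hol_t: "(\<lambda>t. u h s t) holomorphic_on ball 0 r" if "cmod s < r" for h s
    unfolding holomorphic_on_def field_differentiable_def
  proof
    fix t :: complex assume "t \<in> ball 0 r"
    then show "\<exists>D. ((\<lambda>t. u h s t) has_field_derivative D) (at t within ball 0 r)"
      using has_field_derivative_at_within[OF u_t[OF that]] by auto
  qed
  have deriv_u: "deriv (\<lambda>s. u h s t) 0 = d h t" if "cmod t < r" for h t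
    using u_s[of 0 t h] that r by (simp add: DERIV_imp_deriv d_def p_def)
  have d_bound: "cmod (d h t) \<le> B * norm h / (r / 4)" if "cmod t < r" for h t
  proof (cases "h = 0")
    case False
    have "cmod ((deriv ^^ 1) (\<lambda>s. u h s t) 0) \<le> fact 1 * (B * norm h) / (r / 4) ^ 1"
      using r that False by (intro Cauchy_deriv_bound[OF hol_s] u_bound) auto
    then show ?thesis
      by (simp add: deriv_u[OF that])
  qed (simp add: d_def)
  have hol_d: "d h holomorphic_on ball 0 r" for h
  proof (cases "h = 0")
    case True
    then show ?thesis by (simp add: d_def[abs_def])
  next
    case False
    \<comment> \<open>Increments for the difference quotients in the direction \<open>a\<close>, within half the radius as the
      remainder estimate demands.\<close>
    define \<sigma> where "\<sigma> n = complex_of_real (r / 2 / real (Suc n))" for n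
    have \<sigma>: "cmod (\<sigma> n) = r / 2 / real (Suc n)" for n
      using r unfolding \<sigma>_def norm_of_real by simp
    have \<sigma>_le: "cmod (\<sigma> n) \<le> r / 2" and \<sigma>_nz: "\<sigma> n \<noteq> 0" for n
    proof -
      show "cmod (\<sigma> n) \<le> r / 2"
        unfolding \<sigma> using r by (simp add: field_simps)
      show "\<sigma> n \<noteq> 0"
        using \<sigma>[of n] r by (metis divide_pos_pos norm_zero of_nat_0_less_iff order_less_irrefl zero_less_Suc zero_less_numeral)
    qed
    define C where "C = 32 * (B * norm h) / r\<^sup>2"
    show ?thesis
    proof (rule holomorphic_uniform_sequence[where f = "\<lambda>n t. (u h (\<sigma> n) t - u h 0 t) / \<sigma> n"])
      show "(\<lambda>t. (u h (\<sigma> n) t - u h 0 t) / \<sigma> n) holomorphic_on ball 0 r" for n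
        using \<sigma>_le[of n] \<sigma>_nz[of n] r by (intro holomorphic_intros hol_t) auto
      have unif: "uniform_limit (ball 0 r) (\<lambda>n t. (u h (\<sigma> n) t - u h 0 t) / \<sigma> n) (d h) sequentially"
        unfolding uniform_limit_sequentially_iff
      proof (intro allI impI)
        fix e :: real assume e: "e > 0"
        have "(\<lambda>n. C * (r / 2) * inverse (real (Suc n))) \<longlonglongrightarrow> C * (r / 2) * 0"
          by (intro tendsto_mult tendsto_const LIMSEQ_inverse_real_of_nat)
        then have "\<forall>\<^sub>F n in sequentially. C * (r / 2) * inverse (real (Suc n)) < e"
          using e by (intro order_tendstoD) auto
        then obtain N where N: "\<And>n. n \<ge> N \<Longrightarrow> C * (r / 2) * inverse (real (Suc n)) < e"
          unfolding eventually_sequentially by blast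
        show "\<exists>N. \<forall>n\<ge>N. \<forall>x\<in>ball 0 r. dist ((u h (\<sigma> n) x - u h 0 x) / \<sigma> n) (d h x) < e"
        proof (intro exI allI impI ballI)
          fix n t assume n: "N \<le> n" and t: "t \<in> ball (0::complex) r"
          then have t': "cmod t < r" by simp
          have "cmod (u h (\<sigma> n) t - u h 0 t - \<sigma> n * d h t) \<le> C * (cmod (\<sigma> n))\<^sup>2"
            unfolding C_def deriv_u[OF t', symmetric] using t' False \<sigma>_le r
            by (intro second_order_remainder[OF hol_s] u_bound) auto
          then have "cmod ((u h (\<sigma> n) t - u h 0 t - \<sigma> n * d h t) / \<sigma> n) \<le> C * cmod (\<sigma> n)"
            using \<sigma>_nz[of n] by (simp add: norm_divide power2_eq_square divide_le_eq mult.assoc)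
          moreover have "(u h (\<sigma> n) t - u h 0 t - \<sigma> n * d h t) / \<sigma> n = (u h (\<sigma> n) t - u h 0 t) / \<sigma> n - d h t"
            using \<sigma>_nz[of n] by (simp add: field_simps)
          moreover have "C * cmod (\<sigma> n) < e"
          proof -
            have "C * cmod (\<sigma> n) = C * (r / 2) * inverse (real (Suc n))"
              by (simp only: \<sigma> divide_inverse mult.assoc)
            then show ?thesis
              using N[OF n] by (simp only:)
          qed
          ultimately show "dist ((u h (\<sigma> n) t - u h 0 t) / \<sigma> n) (d h t) < e"
            by (simp add: dist_norm)
        qed
      qed
      fix x :: complex assume "x \<in> ball 0 r"
      then obtain e where "e > 0" "cball x e \<subseteq> ball 0 r"
        using open_contains_cball open_ball by blast
      then show "\<exists>e>0. cball x e \<subseteq> ball 0 r \<and>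
          uniform_limit (cball x e) (\<lambda>n t. (u h (\<sigma> n) t - u h 0 t) / \<sigma> n) (d h) sequentially"
        using uniform_limit_on_subset[OF unif] by blast
    qed auto
  qed
  have d_diff: "(d h has_field_derivative deriv (d h) 0) (at 0)" for h
    using r by (intro holomorphic_derivI[OF hol_d]) auto
  \<comment> \<open>The summand 1 makes the bound on \<open>d h\<close> strict.\<close>
  define C where "C = B / (r / 4) + 1"
  have C: "C > 0"
    using r by (simp add: C_def B_def add_nonneg_pos)
  have d_strict: "cmod (d h t) < C * norm h" if "cmod t < r" "h \<noteq> 0" for h t
  proof -
    have "cmod (d h t) < B / (r / 4) * norm h + norm h"
      using d_bound[OF that(1), of h] zero_less_norm_iff[THEN iffD2, OF that(2)]
      unfolding times_divide_eq_left by linarith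
    then show ?thesis
      by (simp only: C_def distrib_right mult_1_left)
  qed
  have deriv_d: "cmod (deriv (d h) 0) \<le> 4 * C / r * norm h" for h
  proof (cases "h = 0")
    case False
    have "cmod ((deriv ^^ 1) (d h) 0) \<le> fact 1 * (C * norm h) / (r / 4) ^ 1"
      using r False by (intro Cauchy_deriv_bound[OF hol_d] d_strict) auto
    then show ?thesis by (simp add: field_simps)
  next
    case True
    then have "d h = (\<lambda>t. 0)" by (simp add: d_def fun_eq_iff)
    then show ?thesis by (simp add: True)
  qed
  have "bounded_clinear (\<lambda>h. cnj (deriv (d h) 0))"
  proof (rule bounded_clinear_intro[where K = "4 * C / r"])
    fix h h' :: 'h and c
    have "d (h + h') = (\<lambda>t. d h t + d h' t)"
      by (simp add: d_def cinner_add_right fun_eq_iff)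
    then have "deriv (d (h + h')) 0 = deriv (d h) 0 + deriv (d h') 0"
      using DERIV_imp_deriv[OF DERIV_add[OF d_diff d_diff]] by simp
    then show "cnj (deriv (d (h + h')) 0) = cnj (deriv (d h) 0) + cnj (deriv (d h') 0)"
      by simp
    have "d (c *\<^sub>C h) = (\<lambda>t. cnj c * d h t)"
      by (simp add: d_def cinner_scaleC_right fun_eq_iff)
    then have "deriv (d (c *\<^sub>C h)) 0 = cnj c * deriv (d h) 0"
      using DERIV_imp_deriv[OF DERIV_cmult[OF d_diff]] by simp
    then show "cnj (deriv (d (c *\<^sub>C h)) 0) = c *\<^sub>C cnj (deriv (d h) 0)"
      by simp
    show "norm (cnj (deriv (d h) 0)) \<le> 4 * C / r * norm h"
      using deriv_d by simp
  qed
  then obtain q where q: "\<And>h. cnj (deriv (d h) 0) = cinner h q"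
    using Riesz_representation by blast
  have deriv_q: "deriv (d h) 0 = cinner q h" for h
    using q[of h] by (metis cinner_commute complex_cnj_cnj)
  define K where "K = 32 * C / r\<^sup>2"
  have remainder: "norm (p t - p 0 - t *\<^sub>C q) \<le> K * (cmod t)\<^sup>2" if t: "cmod t \<le> r / 2" for t
  proof (cases "p t - p 0 - t *\<^sub>C q = 0")
    case True
    then show ?thesis using C r by (simp add: K_def)
  next
    case False
    define h where "h = p t - p 0 - t *\<^sub>C q"
    have "cmod (d h t - d h 0 - t * deriv (d h) 0) \<le> 32 * (C * norm h) / r\<^sup>2 * (cmod t)\<^sup>2"
      using r t False by (intro second_order_remainder[OF hol_d] d_strict) (auto simp: h_def)
    moreover have "d h t - d h 0 - t * deriv (d h) 0 = cinner h h"
      by (simp add: d_def deriv_q h_def cinner.diff_left cinner_scaleC_left)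
    ultimately have "(norm h)\<^sup>2 \<le> K * (cmod t)\<^sup>2 * norm h"
      by (simp add: cinner_self norm_power K_def mult_ac)
    then show ?thesis
      using False by (simp add: power2_eq_square h_def)
  qed
  have "((\<lambda>t. dir_deriv f (w + t *\<^sub>R b) a) has_derivative (\<lambda>t. t *\<^sub>R q)) (at 0)"
  proof (rule has_derivativeI_sandwich[of "r / 2"])
    fix t :: real assume t: "t \<noteq> 0" "dist t 0 < r / 2"
    have "norm (p (of_real t) - p 0 - of_real t *\<^sub>C q) \<le> K * t\<^sup>2"
      using remainder[of "of_real t"] t by simp
    then show "norm (dir_deriv f (w + t *\<^sub>R b) a - dir_deriv f (w + 0 *\<^sub>R b) a - (t - 0) *\<^sub>R q) / norm (t - 0)
        \<le> K * \<bar>t\<bar>"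
      using t by (simp add: p_def scaleR_scaleC divide_le_eq power2_eq_square mult.assoc
          flip: abs_mult)
  next
    have "((\<lambda>t. K * \<bar>t\<bar>) \<longlongrightarrow> K * \<bar>0::real\<bar>) (at 0)"
      by (intro tendsto_intros)
    then show "((\<lambda>t. K * \<bar>t\<bar>) \<longlongrightarrow> 0) (at (0::real))" by simp
  qed (use r in \<open>auto intro: bounded_linear_scaleR_left\<close>)
  then show ?thesis
    by (auto simp: has_vector_derivative_def)
qed

section \<open>Frames as linearly independent families\<close>

text \<open>Stated through linear relations, independence passes along maps that are linear on one fibre only,
  such as a bundle isomorphism at a point.\<close>

lemma independent_family_iff:
  fixes f :: "'i \<Rightarrow> 'a::complex_hilbert"
  assumes I: "finite I"
  shows "inj_on f I \<and> cvs.independent (f ` I) \<longleftrightarrow>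
    (\<forall>u. (\<Sum>i\<in>I. u i *\<^sub>C f i) = 0 \<longrightarrow> (\<forall>i\<in>I. u i = 0))" (is "?L \<longleftrightarrow> ?R")
proof
  assume L: ?L
  show ?R
  proof (intro allI impI ballI)
    fix u i assume u: "(\<Sum>i\<in>I. u i *\<^sub>C f i) = 0" and i: "i \<in> I"
    have "(\<Sum>x\<in>f ` I. u (inv_into I f x) *\<^sub>C x) = (\<Sum>i\<in>I. u i *\<^sub>C f i)"
      using L by (subst sum.reindex) (auto intro!: sum.cong)
    then have "u (inv_into I f (f i)) = 0"
      using L I i u cvs.independentD[of "f ` I" "f ` I" "\<lambda>x. u (inv_into I f x)" "f i"] by simp
    then show "u i = 0"
      using L i by simp
  qed
next
  assume R: ?R
  have inj: "inj_on f I"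
  proof (rule inj_onI, rule ccontr)
    fix i j assume ij: "i \<in> I" "j \<in> I" "f i = f j" "i \<noteq> j"
    define u where "u k = (if k = i then 1 else if k = j then - 1 else 0 :: complex)" for k
    have "(\<Sum>k\<in>I. u k *\<^sub>C f k) = (\<Sum>k\<in>{i, j}. u k *\<^sub>C f k)"
      using ij I by (intro sum.mono_neutral_right) (auto simp: u_def)
    also have "\<dots> = 0"
      using ij by (simp add: u_def scaleC.minus_left)
    finally have "u i = 0"
      using spec[OF R, of u] ij(1) by blast
    then show False
      by (simp add: u_def)
  qed
  have "cvs.independent (f ` I)"
  proof
    assume "cvs.dependent (f ` I)"
    then obtain u where u: "\<exists>v\<in>f ` I. u v \<noteq> 0" "(\<Sum>v\<in>f ` I. u v *\<^sub>C v) = 0"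
      using I cvs.dependent_finite[of "f ` I"] by auto
    have "(\<Sum>i\<in>I. u (f i) *\<^sub>C f i) = 0"
      using u(2) inj by (simp add: sum.reindex)
    then have "\<forall>i\<in>I. u (f i) = 0"
      using spec[OF R, of "\<lambda>i. u (f i)"] by simp
    then show False
      using u(1) by auto
  qed
  then show ?L
    using inj by simp
qed

lemma span_family:
  fixes f :: "'i \<Rightarrow> 'a::complex_hilbert"
  assumes "finite I"
  shows "cvs.span (f ` I) = range (\<lambda>u. \<Sum>i\<in>I. u i *\<^sub>C f i)"
proof
  let ?R = "range (\<lambda>u. \<Sum>i\<in>I. u i *\<^sub>C f i)"
  show "cvs.span (f ` I) \<subseteq> ?R"
  proof (rule cvs.span_minimal)
    show "f ` I \<subseteq> ?R"
    proof clarify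
      fix j assume "j \<in> I"
      then have "f j = (\<Sum>i\<in>I. (if i = j then 1 else 0) *\<^sub>C f i)"
        using assms by (simp add: if_distrib[of "\<lambda>c. c *\<^sub>C _"] cong: if_cong)
      then show "f j \<in> ?R"
        by (rule range_eqI[of _ "\<lambda>u. \<Sum>i\<in>I. u i *\<^sub>C f i"])
    qed
    show "cvs.subspace ?R"
      unfolding cvs.subspace_def
    proof (intro conjI ballI allI)
      show "0 \<in> ?R"
        by (rule range_eqI[of _ _ "\<lambda>_. 0"]) simp
    next
      fix x y assume "x \<in> ?R" "y \<in> ?R"
      then obtain u v where "x = (\<Sum>i\<in>I. u i *\<^sub>C f i)" "y = (\<Sum>i\<in>I. v i *\<^sub>C f i)" by auto
      then show "x + y \<in> ?R"
        by (intro range_eqI[of _ _ "\<lambda>i. u i + v i"]) (simp add: scaleC_add_left sum.distrib)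
    next
      fix c x assume "x \<in> ?R"
      then obtain u where "x = (\<Sum>i\<in>I. u i *\<^sub>C f i)" by auto
      then show "c *\<^sub>C x \<in> ?R"
        by (intro range_eqI[of _ _ "\<lambda>i. c * u i"]) (simp add: scaleC.sum_right scaleC_scaleC)
    qed
  qed
  show "?R \<subseteq> cvs.span (f ` I)"
  proof clarify
    fix u
    have "u i *\<^sub>C f i \<in> cvs.span (f ` I)" if "i \<in> I" for i
      using that by (intro cvs.span_scale, intro cvs.span_base) auto
    then show "(\<Sum>i\<in>I. u i *\<^sub>C f i) \<in> cvs.span (f ` I)"
      by (rule cvs.span_sum)
  qed
qed

lemma local_frame_iff:
  assumes "finite I"
  shows "local_frame F U I f \<longleftrightarrow> open U \<and> (\<forall>i\<in>I. \<forall>w\<in>U. antihol_at (f i) w) \<and>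
    (\<forall>w\<in>U. (\<forall>u. (\<Sum>i\<in>I. u i *\<^sub>C f i w) = 0 \<longrightarrow> (\<forall>i\<in>I. u i = 0)) \<and>
      range (\<lambda>u. \<Sum>i\<in>I. u i *\<^sub>C f i w) = F w)"
  unfolding local_frame_def antiholomorphic_on_iff
  using independent_family_iff[OF assms, of "\<lambda>i. f i _"] span_family[OF assms, of "\<lambda>i. f i _"]
  by (simp flip: conj_assoc)

lemma antihol_bundle_dim:
  assumes "antihol_bundle \<Omega> m F" "w \<in> \<Omega>"
  shows "cvs.dim (F w) = m"
proof -
  obtain U f where U: "w \<in> U" and f: "local_frame F U {..<m} f"
    using assms unfolding antihol_bundle_def by blast
  have "inj_on (\<lambda>i. f i w) {..<m}" "cvs.independent ((\<lambda>i. f i w) ` {..<m})"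
    "cvs.span ((\<lambda>i. f i w) ` {..<m}) = F w"
    using f U unfolding local_frame_def by auto
  then show ?thesis
    using cvs.dim_span_eq_card_independent[of "(\<lambda>i. f i w) ` {..<m}"] by (simp add: card_image)
qed

lemma local_frame_cong:
  assumes "\<And>w. w \<in> U \<Longrightarrow> F w = G w"
  shows "local_frame F U I f \<longleftrightarrow> local_frame G U I f"
  using assms by (auto simp: local_frame_def)

lemma local_frame_reindex:
  assumes f: "local_frame F U I f" and g: "bij_betw g J I"
  shows "local_frame F U J (\<lambda>j. f (g j))"
proof -
  have J: "g ` J = I" "inj_on g J"
    using g by (auto simp: bij_betw_def)
  have im: "(\<lambda>j. f (g j) w) ` J = (\<lambda>i. f i w) ` I" for w
    using J(1) by (simp flip: image_image[of "\<lambda>i. f i w" g])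
  have inj: "inj_on (\<lambda>j. f (g j) w) J" if "inj_on (\<lambda>i. f i w) I" for w
    using comp_inj_on[OF J(2)] that J(1) by (fastforce simp: comp_def)
  show ?thesis
    using f J(1) unfolding local_frame_def im by (auto intro: inj)
qed

text \<open>At each point \<open>\<Phi>\<close> is a linear bijection of the fibres and so preserves independence and spans;
  anti-holomorphy of the new sections is part of the notion of a bundle isomorphism.\<close>

lemma bundle_iso_local_frame:
  fixes f :: "'i \<Rightarrow> complex ^ 'n \<Rightarrow> 'h::complex_hilbert"
    and F' :: "complex ^ 'n \<Rightarrow> 'k::complex_hilbert set"
  assumes \<Phi>: "bundle_iso \<Omega> F F' \<Phi>" and U: "U \<subseteq> \<Omega>" and I: "finite I" and f: "local_frame F U I f"
  shows "local_frame F' U I (\<lambda>i w. \<Phi> w (f i w))"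
proof -
  note frame = f[unfolded local_frame_iff[OF I]]
  have open_U: "open U"
    using frame by blast
  have sub: "cvs.subspace (F w)" if "w \<in> U" for w
  proof -
    have "F w = cvs.span ((\<lambda>i. f i w) ` I)"
      using f that unfolding local_frame_def by blast
    then show ?thesis
      by (simp only: cvs.subspace_span)
  qed
  have fF: "f i w \<in> F w" if "i \<in> I" "w \<in> U" for i w
  proof -
    have "F w = cvs.span ((\<lambda>i. f i w) ` I)"
      using f that unfolding local_frame_def by blast
    then show ?thesis
      using that by (auto intro: cvs.span_base)
  qed
  have lin: "(\<Sum>i\<in>J. u i *\<^sub>C \<Phi> w (f i w)) = \<Phi> w (\<Sum>i\<in>J. u i *\<^sub>C f i w)"
    if w: "w \<in> U" and "J \<subseteq> I" for w J and u :: "'i \<Rightarrow> complex"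
  proof -
    have w\<Omega>: "w \<in> \<Omega>"
      using w U by blast
    have add: "\<Phi> w (x + y) = \<Phi> w x + \<Phi> w y" and scale: "\<Phi> w (c *\<^sub>C x) = c *\<^sub>C \<Phi> w x"
      if "x \<in> F w" "y \<in> F w" for x y c
      using \<Phi> w\<Omega> that unfolding bundle_iso_def by blast+
    have "finite J"
      using that(2) I finite_subset by blast
    then show ?thesis
      using that(2)
    proof (induction J rule: finite_induct)
      case empty
      show ?case
        using scale[OF cvs.subspace_0[OF sub[OF w]] cvs.subspace_0[OF sub[OF w]], of 0] by simp
    next
      case (insert j J)
      have "(\<Sum>i\<in>J. u i *\<^sub>C f i w) \<in> F w"
        using insert.prems w
        by (intro cvs.subspace_sum[OF sub[OF w]] cvs.subspace_scale[OF sub[OF w]] fF) auto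
      moreover have "u j *\<^sub>C f j w \<in> F w" "f j w \<in> F w"
        using insert.prems w by (auto intro: cvs.subspace_scale[OF sub[OF w]] fF)
      ultimately show ?case
        using insert by (simp add: add scale)
    qed
  qed
  show ?thesis
    unfolding local_frame_iff[OF I]
  proof (intro conjI ballI allI impI open_U)
    fix i w assume i: "i \<in> I" and w: "w \<in> U"
    have "\<forall>U s. open U \<and> U \<subseteq> \<Omega> \<and> (\<forall>w\<in>U. s w \<in> F w) \<longrightarrow>
        (antiholomorphic_on s U \<longleftrightarrow> antiholomorphic_on (\<lambda>w. \<Phi> w (s w)) U)"
      using \<Phi> unfolding bundle_iso_def by blast
    moreover have "antiholomorphic_on (f i) U"
      using f i unfolding local_frame_def by blast
    ultimately have "antiholomorphic_on (\<lambda>w. \<Phi> w (f i w)) U"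
      using open_U U fF[OF i] by blast
    then show "antihol_at (\<lambda>w. \<Phi> w (f i w)) w"
      using w by (simp add: antiholomorphic_on_iff)
  next
    fix w assume w: "w \<in> U"
    then have "bij_betw (\<Phi> w) (F w) (F' w)"
      using \<Phi> U unfolding bundle_iso_def by blast
    then have inj: "inj_on (\<Phi> w) (F w)" and im: "\<Phi> w ` F w = F' w"
      by (auto simp: bij_betw_def)
    have range: "range (\<lambda>u. \<Sum>i\<in>I. u i *\<^sub>C f i w) = F w"
      using frame w by blast
    show "u i = 0" if "(\<Sum>i\<in>I. u i *\<^sub>C \<Phi> w (f i w)) = 0" "i \<in> I" for u i
    proof -
      have "\<Phi> w (\<Sum>i\<in>I. u i *\<^sub>C f i w) = \<Phi> w 0"
        using that(1) lin[OF w order_refl, of u] lin[OF w empty_subsetI, of u] by simp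
      moreover have "(\<Sum>i\<in>I. u i *\<^sub>C f i w) \<in> F w"
        unfolding range[symmetric] by blast
      ultimately have "(\<Sum>i\<in>I. u i *\<^sub>C f i w) = 0"
        using inj_onD[OF inj] cvs.subspace_0[OF sub[OF w]] by blast
      then show ?thesis
        using frame w that(2) by blast
    qed
    have "range (\<lambda>u. \<Sum>i\<in>I. u i *\<^sub>C \<Phi> w (f i w)) = \<Phi> w ` range (\<lambda>u. \<Sum>i\<in>I. u i *\<^sub>C f i w)"
      by (simp add: lin[OF w order_refl] image_image)
    then show "range (\<lambda>u. \<Sum>i\<in>I. u i *\<^sub>C \<Phi> w (f i w)) = F' w"
      by (simp only: range im)
  qed
qed

section \<open>Matrices\<close>

lemma scaleC_eq_scalar_mult: "(scaleC :: complex \<Rightarrow> complex ^ 'm \<Rightarrow> complex ^ 'm) = (*s)"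
  by (intro ext) (simp add: vec_eq_iff)

lemma cinner_vec_complex: "cinner (x :: complex ^ 'm) y = (\<Sum>i\<in>UNIV. x $ i * cnj (y $ i))"
  by (simp add: cinner_vec_def cinner_complex_def)

lemma matrix_vector_scaleC: "A *v (c *\<^sub>C x) = c *\<^sub>C (A *v (x :: complex ^ 'm))"
  unfolding scaleC_eq_scalar_mult by (rule vec.scale)

lemma conj_transpose_mult: "conj_transpose (A ** B) = conj_transpose B ** conj_transpose A"
  by (simp add: conj_transpose_def matrix_matrix_mult_def vec_eq_iff mult.commute)

lemma conj_transpose_mat_1: "conj_transpose (mat 1) = mat 1"
  by (auto simp: conj_transpose_def mat_def vec_eq_iff)

lemma cinner_matrix_vector: "cinner (A *v x) y = cinner x (conj_transpose A *v y)"
proof -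
  have "cinner (A *v x) y = (\<Sum>i\<in>UNIV. \<Sum>j\<in>UNIV. A $ i $ j * x $ j * cnj (y $ i))"
    by (simp add: cinner_vec_complex matrix_vector_mult_def sum_distrib_right)
  also have "\<dots> = (\<Sum>j\<in>UNIV. \<Sum>i\<in>UNIV. A $ i $ j * x $ j * cnj (y $ i))"
    by (rule sum.swap)
  also have "\<dots> = cinner x (conj_transpose A *v y)"
    by (simp add: cinner_vec_complex matrix_vector_mult_def conj_transpose_def sum_distrib_left
        mult_ac)
  finally show ?thesis .
qed

lemma orth_compl_range_matrix:
  "orth_compl (range (\<lambda>x. A *v x)) = {v. conj_transpose A *v v = 0}"
proof -
  have "(\<forall>x. cinner v (A *v x) = 0) \<longleftrightarrow> conj_transpose A *v v = 0" for v
  proof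
    assume "\<forall>x. cinner v (A *v x) = 0"
    then have "cinner (A *v (conj_transpose A *v v)) v = 0"
      by (metis cinner_commute complex_cnj_zero)
    then have "cinner (conj_transpose A *v v) (conj_transpose A *v v) = 0"
      by (simp only: cinner_matrix_vector[of A])
    then show "conj_transpose A *v v = 0"
      by (simp only: cinner_eq_zero_iff)
  next
    assume "conj_transpose A *v v = 0"
    then have "cinner (A *v x) v = 0" for x
      by (simp add: cinner_matrix_vector)
    then show "\<forall>x. cinner v (A *v x) = 0"
      by (metis cinner_commute complex_cnj_zero)
  qed
  then show ?thesis
    by (auto simp: orth_compl_def)
qed

lemma tendsto_det:
  fixes A :: "'a \<Rightarrow> complex ^ 'm ^ 'm"
  assumes "\<And>i j. ((\<lambda>x. A x $ i $ j) \<longlongrightarrow> L $ i $ j) F"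
  shows "((\<lambda>x. det (A x)) \<longlongrightarrow> det L) F"
  unfolding det_def by (intro tendsto_intros assms)

section \<open>The eigenbundle of a module in the class of rank one\<close>

locale line_module =
  fixes \<Omega> :: "(complex ^ 'n::finite) set"
    and M :: "'n \<Rightarrow> 'h::complex_hilbert \<Rightarrow> 'h"
  assumes open_domain: "open \<Omega>"
    and B_star_1: "B_star \<Omega> 1 UNIV M"
begin

abbreviation E :: "complex ^ 'n \<Rightarrow> 'h set" where "E \<equiv> eigenspace UNIV M"

abbreviation D :: "complex ^ 'n \<Rightarrow> 'h \<Rightarrow> 'h ^ 'n" where "D \<equiv> column_adjoint UNIV M"

abbreviation MA :: "'n \<Rightarrow> 'h \<Rightarrow> 'h" where "MA i \<equiv> adjoint_on UNIV (M i)"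

lemma bounded_clinear_M: "bounded_clinear (M i)"
  using B_star_1 by (simp add: B_star_def hilbert_module_def bounded_operator_on_UNIV)

lemma M_commute: "M i (M j x) = M j (M i x)"
  using B_star_1 by (simp add: B_star_def hilbert_module_def)

lemma bounded_clinear_MA: "bounded_clinear (MA i)"
  by (rule bounded_clinear_adjoint[OF bounded_clinear_M])

lemma cinner_MA: "cinner x (MA i y) = cinner (M i x) y"
  by (rule cinner_adjoint[OF bounded_clinear_M, symmetric])

lemma D_nth: "D w h $ i = MA i h - cnj (w $ i) *\<^sub>C h"
  unfolding column_adjoint_def
  by (simp, rule adjoint_on_eqI)
    (auto simp: cinner.diff_left cinner.diff_right cinner_MA cinner_scaleC_left cinner_scaleC_right)

lemma bounded_clinear_D: "bounded_clinear (D w)"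
proof -
  have "D w = (\<lambda>h. \<chi> i. MA i h - cnj (w $ i) *\<^sub>C h)"
    by (auto simp: vec_eq_iff D_nth)
  then show ?thesis
    by (auto intro!: bounded_clinear_intros bounded_clinear_MA)
qed

lemma eigenspace_iff: "h \<in> E w \<longleftrightarrow> (\<forall>i. MA i h = cnj (w $ i) *\<^sub>C h)"
  by (auto simp: eigenspace_def vec_eq_iff D_nth)

lemma eigenspace_eq_kernel: "E w = {h. D w h = 0}"
  by (auto simp: eigenspace_def)

lemma eigenspace_subspace: "cvs.subspace (E w)"
  unfolding eigenspace_eq_kernel by (rule kernel_subspace[OF bounded_clinear_D])

lemma eigenspace_closed: "closed (E w)"
  unfolding eigenspace_eq_kernel by (rule kernel_closed[OF bounded_clinear_D])

lemma D_closed_range: "w \<in> \<Omega> \<Longrightarrow> closed (range (D w))"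
  using B_star_1 unfolding B_star_def by blast

lemma eigenspace_line:
  assumes "w \<in> \<Omega>"
  obtains k where "k \<noteq> 0" "E w = range (\<lambda>c. c *\<^sub>C k)"
proof -
  have dim: "cvs.dim (E w) = 1"
    using B_star_1 assms unfolding B_star_def by blast
  obtain B where B: "B \<subseteq> E w" "cvs.independent B" "E w \<subseteq> cvs.span B" "card B = 1"
    using cvs.basis_exists[of "E w"] dim by metis
  then obtain k where k: "B = {k}"
    by (auto simp: card_1_singleton_iff)
  have "E w = cvs.span {k}"
    using B k eigenspace_subspace[of w] cvs.span_minimal[of B "E w"] by auto
  moreover have "k \<noteq> 0"
    using B(2) k cvs.dependent_zero by auto
  ultimately show ?thesis
    using that by (simp add: cvs.span_singleton)
qed

lemma eigenspace_eq_span: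
  assumes "w \<in> \<Omega>" "k \<in> E w" "k \<noteq> 0"
  shows "E w = range (\<lambda>c. c *\<^sub>C k)"
proof -
  obtain l where l: "l \<noteq> 0" "E w = range (\<lambda>c. c *\<^sub>C l)"
    using eigenspace_line[OF assms(1)] .
  then obtain a where a: "k = a *\<^sub>C l" "a \<noteq> 0"
    using assms by auto
  have "c *\<^sub>C l = (c / a) *\<^sub>C k" for c
    using a by (simp add: scaleC_scaleC)
  moreover have "c *\<^sub>C k = (c * a) *\<^sub>C l" for c
    using a by (simp add: scaleC_scaleC)
  ultimately show ?thesis
    unfolding l(2) by blast
qed

lemma eigenvectors_dense: "closure (cvs.span (\<Union>w\<in>\<Omega>. E w)) = UNIV"
  using B_star_1 unfolding B_star_def by blast

text \<open>As the eigenvectors span a dense subspace, identities between bounded operators need only be tested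
  on them, where multipliers and coordinate operators act as scalars.\<close>

lemma operators_eq_on_eigenvectors:
  fixes S T :: "'h \<Rightarrow> 'b::complex_hilbert"
  assumes S: "bounded_clinear S" and T: "bounded_clinear T"
    and eq: "\<And>w k. w \<in> \<Omega> \<Longrightarrow> k \<in> E w \<Longrightarrow> S k = T k"
  shows "S x = T x"
proof -
  have R: "bounded_clinear (\<lambda>x. S x - T x)"
    using S T by (rule bounded_clinear_diff)
  have "(\<Union>w\<in>\<Omega>. E w) \<subseteq> {x. S x - T x = 0}"
    using eq by auto
  then have "cvs.span (\<Union>w\<in>\<Omega>. E w) \<subseteq> {x. S x - T x = 0}"
    by (rule cvs.span_minimal[OF _ kernel_subspace[OF R]])
  then have "closure (cvs.span (\<Union>w\<in>\<Omega>. E w)) \<subseteq> {x. S x - T x = 0}"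
    by (rule closure_minimal[OF _ kernel_closed[OF R]])
  then show ?thesis
    using eigenvectors_dense by auto
qed

subsection \<open>Anti-holomorphic local sections\<close>

lemma D_shift:
  assumes "h \<in> E w"
  shows "D v h = tensor h (\<chi> i. cnj ((w - v) $ i))"
  using assms by (simp add: vec_eq_iff D_nth eigenspace_iff tensor_def scaleC.diff_left)

lemma norm_tensor_cnj: "norm (tensor (h::'h) (\<chi> i. cnj (v $ i))) = norm h * norm (v :: complex ^ 'n)"
proof -
  have "norm (\<chi> i. cnj (v $ i)) = norm v"
    by (simp add: norm_vec_def)
  then show ?thesis
    by (simp add: norm_tensor)
qed

text \<open>Let \<open>c\<close> be the constant by which \<open>D w0\<close> is bounded below on the complement of \<open>E w0\<close>, and put
  \<open>J v h = tensor h (\<chi> i. cnj (v $ i))\<close>. An eigenvector \<open>h\<close> at \<open>w\<close> satisfies \<open>D w0 h = J (w - w0) h\<close>, which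
  is small, so its component orthogonal to \<open>E w0\<close> is small and its component in \<open>E w0\<close> does not vanish.
  As \<open>E w0\<close> is a line, \<open>h\<close> can be scaled to have the component \<open>k0\<close>; the eigenvectors normalised in this
  way form the section. Comparing \<open>D w0 (y w - k0) = J (w - w0) (y w)\<close> with the solution of
  \<open>D w0 (A v) = J v k0\<close> shows that \<open>A\<close> is its derivative, and \<open>A\<close> is anti-linear because \<open>J\<close> is anti-linear
  in \<open>v\<close>.\<close>

lemma local_section:
  assumes w0: "w0 \<in> \<Omega>" and k0: "k0 \<in> E w0" "k0 \<noteq> 0"
  obtains r y where "r > 0" "ball w0 r \<subseteq> \<Omega>" "\<And>w. w \<in> ball w0 r \<Longrightarrow> y w \<in> E w" "y w0 = k0"
    "antihol_at y w0"
proof -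
  define J where "J v h = tensor (h::'h) (\<chi> i. cnj (v $ i))" for v :: "complex ^ 'n" and h
  have J_nth: "J v h $ i = cnj (v $ i) *\<^sub>C h" for v h i
    by (simp add: J_def tensor_def)
  have norm_J: "norm (J v h) = norm h * norm v" for v h
    by (simp add: J_def norm_tensor_cnj)
  interpret D: bounded_linear "D w0"
    by (rule bounded_clinear_imp_bounded_linear[OF bounded_clinear_D])
  have D_eq: "D w0 h = J (w - w0) h" if "h \<in> E w" for w h
    unfolding J_def by (rule D_shift[OF that])
  let ?N = "E w0" and ?P = "orth_proj (E w0)"
  note N = eigenspace_subspace[of w0] eigenspace_closed[of w0]
  obtain c where c: "c > 0" "\<And>h. h \<in> orth_compl ?N \<Longrightarrow> norm h \<le> c * norm (D w0 h)"
    using bounded_below_on_orth_kernel[OF bounded_clinear_D D_closed_range[OF w0]]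
    unfolding eigenspace_eq_kernel by blast
  obtain r0 where r0: "r0 > 0" "ball w0 r0 \<subseteq> \<Omega>"
    using open_domain w0 openE by blast
  \<comment> \<open>With this radius the orthogonal component of an eigenvector is at most half of its length.\<close>
  define r where "r = min r0 (1 / (2 * c))"
  have r: "r > 0" "ball w0 r \<subseteq> \<Omega>"
    using r0 c(1) by (auto simp: r_def)
  have near: "c * norm (w - w0) \<le> 1 / 2" if "w \<in> ball w0 r" for w
    using that c(1) by (auto simp: r_def dist_norm norm_minus_commute field_simps)
  \<comment> \<open>Components orthogonal to \<open>E w0\<close> are small compared with the whole eigenvector.\<close>
  have perp_small: "norm (h - ?P h) \<le> c * norm (w - w0) * norm h" if "h \<in> E w" for w h
  proof -
    have "D w0 (h - ?P h) = J (w - w0) h"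
      using D_eq[OF that] orth_proj_mem[OF N, of h] by (simp add: D.diff eigenspace_eq_kernel)
    then show ?thesis
      using c(2)[OF orth_proj_compl[OF N, of h]] by (simp add: norm_J mult_ac)
  qed
  have "\<exists>h. h \<in> E w \<and> h - k0 \<in> orth_compl ?N" if w: "w \<in> ball w0 r" for w
  proof -
    obtain h where h: "h \<noteq> 0" "h \<in> E w"
      using eigenspace_line[of w] w r(2) by (metis rangeI scaleC_one subsetD)
    have "norm (h - ?P h) \<le> norm h / 2"
      using perp_small[OF h(2)] mult_right_mono[OF near[OF w], of "norm h"] by simp
    then have "?P h \<noteq> 0"
      using h(1) by auto
    moreover have "?P h \<in> range (\<lambda>c. c *\<^sub>C k0)"
      using orth_proj_mem[OF N, of h] eigenspace_eq_span[OF w0 k0] by simp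
    ultimately obtain a where a: "?P h = a *\<^sub>C k0" "a \<noteq> 0"
      by auto
    have "(1 / a) *\<^sub>C (h - ?P h) = (1 / a) *\<^sub>C h - k0"
      using a by (simp add: scaleC.diff_right scaleC_scaleC)
    then show ?thesis
      using cvs.subspace_scale[OF orth_compl_subspace orth_proj_compl[OF N, of h], of "1 / a"]
        cvs.subspace_scale[OF eigenspace_subspace h(2), of "1 / a"] by metis
  qed
  then obtain y where y: "\<And>w. w \<in> ball w0 r \<Longrightarrow> y w \<in> E w"
    "\<And>w. w \<in> ball w0 r \<Longrightarrow> y w - k0 \<in> orth_compl ?N"
    by metis
  have y_w0: "y w0 = k0"
    using y[of w0] r(1) k0(1) orth_compl_self_disjoint[of "y w0 - k0" ?N]
      cvs.subspace_diff[OF N(1), of "y w0" k0] by simp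
  have y_close: "norm (y w - k0) \<le> c * norm (w - w0) * norm (y w)" if w: "w \<in> ball w0 r" for w
  proof -
    have "D w0 (y w - k0) = J (w - w0) (y w)"
      using D_eq[OF y(1)[OF w]] k0(1) by (simp add: D.diff eigenspace_eq_kernel)
    then show ?thesis
      using c(2)[OF y(2)[OF w]] by (simp add: norm_J mult_ac)
  qed
  have y_bound: "norm (y w) \<le> 2 * norm k0" if w: "w \<in> ball w0 r" for w
    using y_close[OF w] mult_right_mono[OF near[OF w], of "norm (y w)"]
      norm_triangle_ineq2[of "y w" k0] by simp
  have y_lip: "norm (y w - k0) \<le> 2 * c * norm k0 * norm (w - w0)" if w: "w \<in> ball w0 r" for w
  proof -
    have "c * norm (w - w0) * norm (y w) \<le> c * norm (w - w0) * (2 * norm k0)"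
      using c(1) by (intro mult_left_mono y_bound[OF w]) auto
    then show ?thesis
      using y_close[OF w] by (simp add: mult_ac)
  qed
  have y_tendsto: "(y \<longlongrightarrow> k0) (at w0)"
  proof (rule LIM_zero_cancel, rule Lim_null_comparison)
    show "\<forall>\<^sub>F w in at w0. norm (y w - k0) \<le> 2 * c * norm k0 * norm (w - w0)"
      using y_lip r(1) unfolding eventually_at
      by (intro exI[of _ r]) (auto simp: dist_commute)
    show "((\<lambda>w. 2 * c * norm k0 * norm (w - w0)) \<longlongrightarrow> 0) (at w0)"
      by (intro tendsto_mult_right_zero tendsto_norm_zero LIM_zero tendsto_ident_at)
  qed
  \<comment> \<open>The derivative solves \<open>D w0 (A v) = J v k0\<close>; the right-hand side is a limit of elements of
    the closed range of \<open>D w0\<close>.\<close>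
  have "J v k0 \<in> range (D w0)" for v
  proof (cases "v = 0")
    case True
    then have "J v k0 = D w0 0"
      by (simp add: vec_eq_iff J_nth D.zero)
    then show ?thesis by (rule range_eqI)
  next
    case False
    have lim0: "filterlim (\<lambda>t::real. w0 + t *\<^sub>R v) (at w0) (at_right 0)"
    proof (rule filterlim_atI)
      have "((\<lambda>t::real. w0 + t *\<^sub>R v) \<longlongrightarrow> w0 + 0 *\<^sub>R v) (at_right 0)"
        by (intro tendsto_intros)
      then show "((\<lambda>t::real. w0 + t *\<^sub>R v) \<longlongrightarrow> w0) (at_right 0)" by simp
      show "\<forall>\<^sub>F t in at_right (0::real). w0 + t *\<^sub>R v \<noteq> w0"
        using False by (simp add: eventually_at_right_less eventually_at_filter)
    qed
    have "bounded_linear (J v)"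
      unfolding J_def by (rule bounded_bilinear.bounded_linear_left[OF bounded_bilinear_tensor])
    then have "((\<lambda>t. J v (y (w0 + t *\<^sub>R v))) \<longlongrightarrow> J v k0) (at_right 0)"
      using filterlim_compose[OF y_tendsto lim0] by (rule bounded_linear.tendsto)
    moreover have "\<forall>\<^sub>F t in at_right (0::real). J v (y (w0 + t *\<^sub>R v)) \<in> range (D w0)"
    proof -
      have "\<forall>\<^sub>F t in at_right (0::real). 0 < t \<and> t < r / norm v"
        using r(1) False by (auto simp: eventually_at_right_less eventually_at_right_field
            intro!: exI[of _ "r / norm v"])
      then show ?thesis
      proof eventually_elim
        case (elim t)
        then have "w0 + t *\<^sub>R v \<in> ball w0 r"
          using False by (simp add: dist_norm field_simps)
        then have "D w0 (y (w0 + t *\<^sub>R v)) = J (t *\<^sub>R v) (y (w0 + t *\<^sub>R v))"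
          using D_eq[OF y(1), of "w0 + t *\<^sub>R v"] by simp
        also have "\<dots> = t *\<^sub>R J v (y (w0 + t *\<^sub>R v))"
          by (simp add: vec_eq_iff J_nth scaleC.scaleR_left)
        finally have "D w0 ((1 / t) *\<^sub>R y (w0 + t *\<^sub>R v)) = J v (y (w0 + t *\<^sub>R v))"
          using elim by (simp add: D.scaleR)
        then show ?case by (metis rangeI)
      qed
    qed
    ultimately show ?thesis
      by (intro Lim_in_closed_set[OF D_closed_range[OF w0]]) auto
  qed
  then have "\<exists>x. D w0 x = J v k0 \<and> x \<in> orth_compl ?N" for v
  proof -
    obtain x where x: "D w0 x = J v k0"
      using \<open>J v k0 \<in> range (D w0)\<close> by auto
    then have "D w0 (x - ?P x) = J v k0"
      using orth_proj_mem[OF N, of x] by (simp add: D.diff eigenspace_eq_kernel)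
    then show ?thesis
      using orth_proj_compl[OF N, of x] by blast
  qed
  then obtain A where A: "\<And>v. D w0 (A v) = J v k0" "\<And>v. A v \<in> orth_compl ?N"
    by metis
  have A_eqI: "A v = x" if "D w0 x = J v k0" "x \<in> orth_compl ?N" for v x
  proof -
    have "A v - x \<in> ?N"
      using A(1)[of v] that(1) by (simp add: eigenspace_eq_kernel D.diff)
    moreover have "A v - x \<in> orth_compl ?N"
      using cvs.subspace_diff[OF orth_compl_subspace A(2) that(2)] .
    ultimately show ?thesis
      using orth_compl_self_disjoint by fastforce
  qed
  have D_scaleC: "D w0 (a *\<^sub>C x) = a *\<^sub>C D w0 x" for a x
    using bounded_clinear_D by (rule bounded_clinear_scaleC)
  have A_scaleC: "A (a *\<^sub>C v) = cnj a *\<^sub>C A v" for a v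
  proof (rule A_eqI)
    show "D w0 (cnj a *\<^sub>C A v) = J (a *\<^sub>C v) k0"
      by (simp add: D_scaleC A(1)) (simp add: vec_eq_iff J_nth scaleC_scaleC)
    show "cnj a *\<^sub>C A v \<in> orth_compl ?N"
      by (rule cvs.subspace_scale[OF orth_compl_subspace A(2)])
  qed
  have A_add: "A (u + v) = A u + A v" for u v
  proof (rule A_eqI)
    show "D w0 (A u + A v) = J (u + v) k0"
      by (simp add: D.add A(1)) (simp add: vec_eq_iff J_nth scaleC_add_left)
    show "A u + A v \<in> orth_compl ?N"
      by (rule cvs.subspace_add[OF orth_compl_subspace A(2) A(2)])
  qed
  have "bounded_linear A"
  proof (rule bounded_linear_intro[where K = "c * norm k0"])
    show "A (a *\<^sub>R v) = a *\<^sub>R A v" for a v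
      by (simp add: scaleR_scaleC A_scaleC)
    show "norm (A v) \<le> norm v * (c * norm k0)" for v
      using c(2)[OF A(2)[of v]] by (simp add: A(1) norm_J mult_ac)
  qed (rule A_add)
  have "(y has_derivative A) (at w0)"
  proof (rule has_derivativeI_sandwich[OF r(1) \<open>bounded_linear A\<close>])
    fix w assume "w \<noteq> w0" "dist w w0 < r"
    then have w: "w \<in> ball w0 r" by (simp add: dist_commute)
    have "D w0 (y w - k0 - A (w - w0)) = J (w - w0) (y w) - J (w - w0) k0"
      using D_eq[OF y(1)[OF w]] k0(1) by (simp add: D.diff A(1) eigenspace_eq_kernel)
    also have "\<dots> = J (w - w0) (y w - k0)"
      by (simp add: vec_eq_iff J_nth scaleC.diff_right)
    finally have "norm (y w - k0 - A (w - w0)) \<le> c * (norm (y w - k0) * norm (w - w0))"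
      using c(2)[OF cvs.subspace_diff[OF orth_compl_subspace y(2)[OF w] A(2)], of "w - w0"]
      by (simp add: norm_J)
    also have "\<dots> \<le> c * ((2 * c * norm k0 * norm (w - w0)) * norm (w - w0))"
      using c(1) y_lip[OF w] by (intro mult_left_mono mult_right_mono) auto
    finally show "norm (y w - y w0 - A (w - w0)) / norm (w - w0) \<le> 2 * c\<^sup>2 * norm k0 * norm (w - w0)"
      using \<open>w \<noteq> w0\<close> by (simp add: y_w0 field_simps power2_eq_square)
  next
    show "((\<lambda>w. 2 * c\<^sup>2 * norm k0 * norm (w - w0)) \<longlongrightarrow> 0) (at w0)"
      by (intro tendsto_mult_right_zero tendsto_norm_zero LIM_zero tendsto_ident_at)
  qed
  then have "antihol_at y w0"
    using A_scaleC by (auto simp: antihol_at_def)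
  then show ?thesis
    using that r y(1) y_w0 by blast
qed

text \<open>Normalising by \<open>cinner x k0 = 1\<close> makes the section unique, so that the sections through
  different points, each of them differentiable at one point, agree up to a scalar factor.\<close>

lemma local_frame_exists:
  assumes w0: "w0 \<in> \<Omega>"
  obtains U s k0 where "w0 \<in> U" "open U" "U \<subseteq> \<Omega>" "antiholomorphic_on s U"
    "\<And>w. w \<in> U \<Longrightarrow> s w \<in> E w" "\<And>w. w \<in> U \<Longrightarrow> cinner (s w) k0 = 1"
proof -
  obtain k0 where k0: "k0 \<noteq> 0" "E w0 = range (\<lambda>c. c *\<^sub>C k0)"
    using eigenspace_line[OF w0] .
  define U where "U = {w\<in>\<Omega>. \<exists>x\<in>E w. cinner x k0 \<noteq> 0}"
  define s where "s w = (SOME x. x \<in> E w \<and> cinner x k0 = 1)" for w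
  have s: "s w \<in> E w" "cinner (s w) k0 = 1" if w: "w \<in> U" for w
  proof -
    obtain x where x: "x \<in> E w" "cinner x k0 \<noteq> 0"
      using w unfolding U_def by blast
    then have "(1 / cinner x k0) *\<^sub>C x \<in> E w \<and> cinner ((1 / cinner x k0) *\<^sub>C x) k0 = 1"
      by (simp add: cinner_scaleC_left cvs.subspace_scale[OF eigenspace_subspace])
    then have "s w \<in> E w \<and> cinner (s w) k0 = 1"
      unfolding s_def by (rule someI)
    then show "s w \<in> E w" "cinner (s w) k0 = 1" by auto
  qed
  have s_nz: "s w \<noteq> 0" if "w \<in> U" for w
    using s(2)[OF that] by auto
  have s_unique: "x = cinner x k0 *\<^sub>C s w" if w: "w \<in> U" and x: "x \<in> E w" for x w
  proof -
    have "w \<in> \<Omega>"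
      using w by (simp add: U_def)
    then obtain a where "x = a *\<^sub>C s w"
      using eigenspace_eq_span[OF _ s(1)[OF w] s_nz[OF w]] x by auto
    then show ?thesis
      using s(2)[OF w] by (simp add: cinner_scaleC_left)
  qed
  have local: "\<exists>V. open V \<and> w \<in> V \<and> V \<subseteq> U \<and> antihol_at s w" if w: "w \<in> U" for w
  proof -
    have "w \<in> \<Omega>" using w by (simp add: U_def)
    obtain r y where y: "r > 0" "ball w r \<subseteq> \<Omega>" "\<And>v. v \<in> ball w r \<Longrightarrow> y v \<in> E v"
      "y w = s w" "antihol_at y w"
      using local_section[OF \<open>w \<in> \<Omega>\<close> s(1)[OF w] s_nz[OF w]] by blast
    have anti: "antihol_at (\<lambda>v. cinner (y v) k0) w"
      using y(5) by (rule antihol_at_cinner_left)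
    have nz: "cinner (y w) k0 \<noteq> 0"
      using s(2)[OF w] y(4) by simp
    have "\<forall>\<^sub>F v in nhds w. cinner (y v) k0 \<noteq> 0"
      using antihol_at_imp_isCont[OF anti] nz
      by (auto simp: continuous_at_imp_continuous_at_within isCont_def
          intro: tendsto_imp_eventually_ne tendsto_at_iff_tendsto_nhds[THEN iffD1])
    moreover have "\<forall>\<^sub>F v in nhds w. v \<in> ball w r"
      using y(1) by (intro eventually_nhds_in_open) auto
    ultimately have "\<forall>\<^sub>F v in nhds w. v \<in> ball w r \<and> cinner (y v) k0 \<noteq> 0"
      by eventually_elim auto
    then obtain V where V: "open V" "w \<in> V" "\<And>v. v \<in> V \<Longrightarrow> v \<in> ball w r \<and> cinner (y v) k0 \<noteq> 0"
      by (auto simp: eventually_nhds)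
    have VU: "V \<subseteq> U"
      using V(3) y(2,3) by (fastforce simp: U_def)
    have s_eq: "s v = (1 / cinner (y v) k0) *\<^sub>C y v" if "v \<in> V" for v
    proof -
      have "y v = cinner (y v) k0 *\<^sub>C s v"
        using s_unique VU V(3) y(3) that by blast
      then have "(1 / cinner (y v) k0) *\<^sub>C y v = (1 / cinner (y v) k0) *\<^sub>C (cinner (y v) k0 *\<^sub>C s v)"
        by (rule arg_cong)
      then show ?thesis
        using V(3)[OF that] by (simp add: scaleC_scaleC)
    qed
    have "antihol_at (\<lambda>v. (1 / cinner (y v) k0) *\<^sub>C y v) w"
      using nz by (intro antihol_at_scaleC antihol_at_inverse anti y(5))
    then have "antihol_at s w"
      by (subst antihol_at_cong[OF V(1,2) s_eq])
    then show ?thesis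
      using V VU by blast
  qed
  have "open U"
    using local by (subst open_subopen) blast
  moreover have "w0 \<in> U"
  proof -
    have "k0 \<in> E w0"
      unfolding k0(2) by (rule range_eqI[of _ _ 1]) simp
    moreover have "cinner k0 k0 \<noteq> 0"
      using k0(1) by simp
    ultimately show ?thesis
      using w0 unfolding U_def by blast
  qed
  moreover have "antiholomorphic_on s U"
    using local by (auto simp: antiholomorphic_on_iff)
  ultimately show ?thesis
    using that[of U s k0] s unfolding U_def by blast
qed

end

section \<open>Multipliers\<close>

context line_module
begin

lemma eq_if_cinner_eigenvectors_eq:
  assumes "\<And>w k. w \<in> \<Omega> \<Longrightarrow> k \<in> E w \<Longrightarrow> cinner x k = cinner y k"
  shows "x = y"
proof (rule cinner_ext_right)
  have bc: "bounded_clinear (\<lambda>z. cinner z x)" for x :: 'h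
    by (simp add: bounded_clinear_def cinner.bounded_linear_left cinner_scaleC_left)
  fix z
  show "cinner z x = cinner z y"
    by (rule operators_eq_on_eigenvectors[OF bc bc]) (metis assms cinner_commute)
qed

text \<open>The eigenvectors separate points, so an operator of multiplication is determined by its symbol and
  the definite description in \<open>mult_op\<close> denotes it.\<close>

lemma is_mult_op_mult_op:
  assumes "\<phi> \<in> multipliers \<Omega> M"
  shows "is_mult_op \<Omega> M \<phi> (mult_op \<Omega> M \<phi>)"
proof -
  obtain T where T: "is_mult_op \<Omega> M \<phi> T"
    using assms by (auto simp: multipliers_def)
  have "T' = T" if "is_mult_op \<Omega> M \<phi> T'" for T'
    using T that unfolding is_mult_op_def
    by (intro ext eq_if_cinner_eigenvectors_eq) auto
  with T show ?thesis
    unfolding mult_op_def by (rule theI)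
qed

definition mult_adj :: "(complex ^ 'n \<Rightarrow> complex) \<Rightarrow> 'h \<Rightarrow> 'h" where
  "mult_adj \<phi> = adjoint_on UNIV (mult_op \<Omega> M \<phi>)"

context
  fixes \<phi> assumes \<phi>: "\<phi> \<in> multipliers \<Omega> M"
begin

lemma bounded_clinear_mult_op: "bounded_clinear (mult_op \<Omega> M \<phi>)"
  using is_mult_op_mult_op[OF \<phi>] by (simp add: is_mult_op_def bounded_operator_on_UNIV)

lemma bounded_clinear_mult_adj: "bounded_clinear (mult_adj \<phi>)"
  unfolding mult_adj_def by (rule bounded_clinear_adjoint[OF bounded_clinear_mult_op])

lemma cinner_mult_op: "cinner (mult_op \<Omega> M \<phi> x) y = cinner x (mult_adj \<phi> y)"
  unfolding mult_adj_def by (rule cinner_adjoint[OF bounded_clinear_mult_op])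

lemma mult_adj_eigenvector:
  assumes "w \<in> \<Omega>" "k \<in> E w"
  shows "mult_adj \<phi> k = cnj (\<phi> w) *\<^sub>C k"
proof (rule cinner_ext_right)
  fix x
  have "cinner x (mult_adj \<phi> k) = cinner (mult_op \<Omega> M \<phi> x) k"
    by (rule cinner_mult_op[symmetric])
  also have "\<dots> = \<phi> w * cinner x k"
    using is_mult_op_mult_op[OF \<phi>] assms unfolding is_mult_op_def by blast
  finally show "cinner x (mult_adj \<phi> k) = cinner x (cnj (\<phi> w) *\<^sub>C k)"
    by (simp only: cinner_scaleC_right complex_cnj_cnj)
qed

lemma mult_adj_commute: "mult_adj \<phi> (MA i x) = MA i (mult_adj \<phi> x)"
proof (rule operators_eq_on_eigenvectors[where S = "\<lambda>x. mult_adj \<phi> (MA i x)"])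
  show "bounded_clinear (\<lambda>x. mult_adj \<phi> (MA i x))"
    by (rule bounded_clinear_compose[OF bounded_clinear_mult_adj bounded_clinear_MA])
  show "bounded_clinear (\<lambda>x. MA i (mult_adj \<phi> x))"
    by (rule bounded_clinear_compose[OF bounded_clinear_MA bounded_clinear_mult_adj])
  fix w k assume w: "w \<in> \<Omega>" and k: "k \<in> E w"
  have "MA i k = cnj (w $ i) *\<^sub>C k"
    using k eigenspace_iff by blast
  then show "mult_adj \<phi> (MA i k) = MA i (mult_adj \<phi> k)"
    by (simp only: mult_adj_eigenvector[OF w k] bounded_clinear_scaleC[OF bounded_clinear_MA]
        bounded_clinear_scaleC[OF bounded_clinear_mult_adj] scaleC_scaleC mult.commute)
qed

text \<open>For a section \<open>s\<close> of the eigenbundle normalised by \<open>cinner (s w) k0 = 1\<close>, the eigenvalue \<open>cnj (\<phi> w)\<close> is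
  recovered as \<open>cinner (mult_adj \<phi> (s w)) k0\<close>.\<close>

lemma multiplier_antihol:
  assumes "w0 \<in> \<Omega>"
  shows "antihol_at (\<lambda>w. cnj (\<phi> w)) w0"
proof -
  obtain U s k0 where U: "w0 \<in> U" "open U" "U \<subseteq> \<Omega>" "antiholomorphic_on s U"
    "\<And>w. w \<in> U \<Longrightarrow> s w \<in> E w" "\<And>w. w \<in> U \<Longrightarrow> cinner (s w) k0 = 1"
    using local_frame_exists[OF assms] by metis
  have eq: "cnj (\<phi> w) = cinner (mult_adj \<phi> (s w)) k0" if "w \<in> U" for w
    using U(3,5,6) that by (subst mult_adj_eigenvector[of w]) (auto simp: cinner_scaleC_left)
  have "antihol_at (\<lambda>w. cinner (mult_adj \<phi> (s w)) k0) w0"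
    using U(1,4)
    by (intro antihol_at_cinner_left antihol_at_bounded_clinear[OF bounded_clinear_mult_adj])
      (simp add: antiholomorphic_on_iff)
  then show ?thesis
    by (subst antihol_at_cong[OF U(2,1) eq])
qed

end

subsection \<open>Matrices of multipliers\<close>

text \<open>The adjoint of \<open>matrix_mult_op\<close>, by the lemma \<open>cinner_matrix_mult_op\<close> below.\<close>

definition matrix_adj :: "(complex ^ 'n \<Rightarrow> complex ^ 'a ^ 'b) \<Rightarrow> 'h ^ 'b \<Rightarrow> 'h ^ 'a" where
  "matrix_adj A x = (\<chi> l. \<Sum>j\<in>UNIV. mult_adj (\<lambda>w. A w $ j $ l) (x $ j))"

lemma operators_eq_on_tensors:
  fixes S T :: "'h ^ 'm::finite \<Rightarrow> 'b::complex_hilbert"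
  assumes S: "bounded_clinear S" and T: "bounded_clinear T"
    and eq: "\<And>w k v. w \<in> \<Omega> \<Longrightarrow> k \<in> E w \<Longrightarrow> S (tensor k v) = T (tensor k v)"
  shows "S x = T x"
proof -
  have tens: "bounded_clinear (\<lambda>h. tensor (h::'h) (axis j 1 :: complex ^ 'm))" for j
    by (simp add: bounded_clinear_def tensor_scaleC_left
        bounded_bilinear.bounded_linear_left[OF bounded_bilinear_tensor])
  have x: "x = (\<Sum>j\<in>UNIV. tensor (x $ j) (axis j 1))"
    by (simp add: vec_eq_iff tensor_def axis_def if_distrib[of "\<lambda>c. c *\<^sub>C _"] cong: if_cong)
  have "S (tensor h (axis j 1)) = T (tensor h (axis j 1))" for h j
    by (rule operators_eq_on_eigenvectors[where S = "\<lambda>h. S (tensor h (axis j 1))"])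
      (auto intro: eq bounded_clinear_compose[OF S tens] bounded_clinear_compose[OF T tens])
  then show ?thesis
    using linear_sum[OF bounded_linear.linear[OF bounded_clinear_imp_bounded_linear[OF S]],
        of "\<lambda>j. tensor (x $ j) (axis j 1)" UNIV]
      linear_sum[OF bounded_linear.linear[OF bounded_clinear_imp_bounded_linear[OF T]],
        of "\<lambda>j. tensor (x $ j) (axis j 1)" UNIV]
    by (simp flip: x)
qed

definition MAq :: "'n \<Rightarrow> 'h ^ 'm \<Rightarrow> 'h ^ 'm" where
  "MAq i x = (\<chi> j. MA i (x $ j))"

lemma bounded_clinear_MAq: "bounded_clinear (MAq i :: 'h ^ 'm::finite \<Rightarrow> _)"
  unfolding MAq_def
  by (intro bounded_clinear_vec_lambda bounded_clinear_compose[OF bounded_clinear_MA]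
      bounded_clinear_vec_nth)

lemma MA_sum: "MA i (\<Sum>j\<in>J. g j) = (\<Sum>j\<in>J. MA i (g j))"
  by (rule linear_sum[OF bounded_linear.linear[OF bounded_clinear_imp_bounded_linear[OF bounded_clinear_MA]]])

context
  fixes A :: "complex ^ 'n \<Rightarrow> complex ^ 'a::finite ^ 'b::finite"
  assumes A: "\<forall>i j. (\<lambda>w. A w $ i $ j) \<in> multipliers \<Omega> M"
begin

lemma bounded_clinear_matrix_adj: "bounded_clinear (matrix_adj A)"
  unfolding matrix_adj_def using A
  by (intro bounded_clinear_vec_lambda bounded_clinear_sum
      bounded_clinear_compose[OF bounded_clinear_mult_adj] bounded_clinear_vec_nth) auto

lemma cinner_matrix_mult_op: "cinner (matrix_mult_op \<Omega> M A y) x = cinner y (matrix_adj A x)"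
proof -
  have "cinner (matrix_mult_op \<Omega> M A y) x =
      (\<Sum>i\<in>UNIV. \<Sum>j\<in>UNIV. cinner (y $ j) (mult_adj (\<lambda>w. A w $ i $ j) (x $ i)))"
    using A by (simp add: cinner_vec_def matrix_mult_op_def cinner.sum_left cinner_mult_op)
  also have "\<dots> = (\<Sum>j\<in>UNIV. \<Sum>i\<in>UNIV. cinner (y $ j) (mult_adj (\<lambda>w. A w $ i $ j) (x $ i)))"
    by (rule sum.swap)
  also have "\<dots> = cinner y (matrix_adj A x)"
    by (simp add: cinner_vec_def matrix_adj_def cinner.sum_right)
  finally show ?thesis .
qed

lemma matrix_adj_tensor:
  assumes "w \<in> \<Omega>" "k \<in> E w"
  shows "matrix_adj A (tensor k v) = tensor k (conj_transpose (A w) *v v)"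
  using A assms
  by (simp add: matrix_adj_def tensor_def vec_eq_iff bounded_clinear_scaleC[OF bounded_clinear_mult_adj]
      mult_adj_eigenvector scaleC_scaleC conj_transpose_def matrix_vector_mult_def scaleC.sum_left
      mult.commute)

lemma matrix_adj_commute: "matrix_adj A (MAq i x) = MAq i (matrix_adj A x)"
  using A
  by (simp add: matrix_adj_def MAq_def vec_eq_iff mult_adj_commute MA_sum)

end

end

section \<open>The kernel bundle of a left invertible multiplier\<close>

locale quotient_module = line_module \<Omega> M
  for \<Omega> :: "(complex ^ 'n::finite) set" and M :: "'n \<Rightarrow> 'h::complex_hilbert \<Rightarrow> 'h" +
  fixes \<Theta> :: "complex ^ 'n \<Rightarrow> complex ^ 'p::finite ^ 'q::finite"
    and \<Psi> :: "complex ^ 'n \<Rightarrow> complex ^ 'q ^ 'p"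
  assumes card_less: "CARD('p) < CARD('q)"
    and Theta_mult: "\<forall>i j. (\<lambda>w. \<Theta> w $ i $ j) \<in> multipliers \<Omega> M"
    and Psi_mult: "\<forall>i j. (\<lambda>w. \<Psi> w $ i $ j) \<in> multipliers \<Omega> M"
    and left_inverse: "\<And>w. w \<in> \<Omega> \<Longrightarrow> \<Psi> w ** \<Theta> w = mat 1"
begin

abbreviation \<Theta>A :: "complex ^ 'n \<Rightarrow> complex ^ 'q ^ 'p" where "\<Theta>A w \<equiv> conj_transpose (\<Theta> w)"

abbreviation \<Psi>A :: "complex ^ 'n \<Rightarrow> complex ^ 'p ^ 'q" where "\<Psi>A w \<equiv> conj_transpose (\<Psi> w)"

definition V :: "complex ^ 'n \<Rightarrow> (complex ^ 'q) set" where
  "V w = {v. \<Theta>A w *v v = 0}"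

text \<open>The idempotent with range \<open>V w\<close> and kernel the range of \<open>\<Psi>A w\<close>. Unlike the orthogonal projection onto
  \<open>V w\<close> it is anti-holomorphic in \<open>w\<close>.\<close>

definition Q :: "complex ^ 'n \<Rightarrow> complex ^ 'q ^ 'q" where
  "Q w = mat 1 - \<Psi>A w ** \<Theta>A w"

lemma right_inverse: "w \<in> \<Omega> \<Longrightarrow> \<Theta>A w *v (\<Psi>A w *v y) = y"
  using left_inverse[of w]
  by (simp add: matrix_vector_mul_assoc conj_transpose_mat_1 flip: conj_transpose_mult)

lemma Q_apply: "Q w *v x = x - \<Psi>A w *v (\<Theta>A w *v x)"
  by (simp add: Q_def matrix_vector_mult_diff_rdistrib matrix_vector_mul_assoc)

lemma Q_mem: "w \<in> \<Omega> \<Longrightarrow> Q w *v x \<in> V w"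
  by (simp add: V_def Q_apply matrix_vector_mult_diff_distrib right_inverse)

lemma Q_fixes: "v \<in> V w \<Longrightarrow> Q w *v v = v"
  by (simp add: V_def Q_apply)

lemma V_subspace: "cvs.subspace (V w)"
  by (auto simp: V_def cvs.subspace_def matrix_vector_right_distrib matrix_vector_scaleC)

text \<open>The space is the direct sum of \<open>V w\<close> and the range of the injective map \<open>\<Psi>A w\<close>.\<close>

lemma dim_V:
  assumes w: "w \<in> \<Omega>"
  shows "cvs.dim (V w) = CARD('q) - CARD('p)"
proof -
  let ?R = "range (\<lambda>y. \<Psi>A w *v y)"
  have V: "vec.subspace (V w)"
    using V_subspace[of w] unfolding scaleC_eq_scalar_mult .
  have R: "vec.subspace ?R"
    by (rule vec.subspace_image) (rule vec.subspace_UNIV)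
  have "{x + y |x y. x \<in> V w \<and> y \<in> ?R} = UNIV"
  proof safe
    fix x
    have "x = Q w *v x + \<Psi>A w *v (\<Theta>A w *v x)"
      by (simp add: Q_apply)
    then show "\<exists>a b. x = a + b \<and> a \<in> V w \<and> b \<in> ?R"
      using Q_mem[OF w, of x] by blast
  qed auto
  moreover have "V w \<inter> ?R = {0}"
    using right_inverse[OF w] by (auto simp: V_def intro!: range_eqI[of _ _ 0])
  moreover have "vec.dim ?R = CARD('p)"
  proof -
    have "inj_on (\<lambda>y. \<Psi>A w *v y) (vec.span UNIV)"
      by (rule inj_on_inverseI[of _ "\<lambda>x. \<Theta>A w *v x"]) (rule right_inverse[OF w])
    from vec.dim_image_eq[OF matrix_vector_mul_linear_gen this]
    show ?thesis by (simp add: card_cart_basis vec.dimension_def vec.dim_UNIV)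
  qed
  ultimately have "vec.dim (V w) + CARD('p) = CARD('q)"
    using vec.dim_sums_Int[OF V R] by (simp add: card_cart_basis vec.dimension_def vec.dim_UNIV)
  then show ?thesis
    unfolding scaleC_eq_scalar_mult by simp
qed

lemma antihol_\<Theta>A: "w \<in> \<Omega> \<Longrightarrow> antihol_at (\<lambda>w. \<Theta>A w $ i $ j) w"
  using Theta_mult by (simp add: conj_transpose_def multiplier_antihol)

lemma antihol_\<Psi>A: "w \<in> \<Omega> \<Longrightarrow> antihol_at (\<lambda>w. \<Psi>A w $ i $ j) w"
  using Psi_mult by (simp add: conj_transpose_def multiplier_antihol)

lemma antihol_Q_entry: "w \<in> \<Omega> \<Longrightarrow> antihol_at (\<lambda>w. Q w $ i $ j) w"
  unfolding Q_def matrix_matrix_mult_def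
  by (simp, intro antihol_at_diff antihol_at_const antihol_at_sum antihol_at_mult antihol_\<Theta>A
      antihol_\<Psi>A) auto

lemma antihol_Q: "w \<in> \<Omega> \<Longrightarrow> antihol_at (\<lambda>w. Q w *v v) w"
  unfolding matrix_vector_mult_def
  by (intro antihol_at_vec_lambda antihol_at_sum antihol_at_mult antihol_at_const antihol_Q_entry)
    auto

text \<open>The vectors \<open>Q w *v b i\<close>, for a basis \<open>b\<close> of \<open>V w0\<close>, form the frame near \<open>w0\<close>.\<close>

lemma antihol_bundle_V: "antihol_bundle \<Omega> (CARD('q) - CARD('p)) V"
  unfolding antihol_bundle_def
proof
  fix w0 assume w0: "w0 \<in> \<Omega>"
  let ?m = "CARD('q) - CARD('p)"
  obtain B where B: "B \<subseteq> V w0" "cvs.independent B" "V w0 \<subseteq> cvs.span B" "card B = ?m"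
    using cvs.basis_exists[of "V w0"] dim_V[OF w0] by metis
  have "finite B"
    using B(4) card_less by (intro card_ge_0_finite) simp
  then obtain b where b: "bij_betw b {..<?m} B"
    using B(4) ex_bij_betw_nat_finite[of B] by (auto simp: atLeast0LessThan)
  then have bB: "inj_on b {..<?m}" "b ` {..<?m} = B"
    by (auto simp: bij_betw_def)
  have b_V: "b i \<in> V w0" if "i < ?m" for i
    using that bB(2) B(1) by auto
  have b_indep: "\<forall>i<?m. u i = 0" if "(\<Sum>i<?m. u i *\<^sub>C b i) = 0" for u
    using independent_family_iff[of "{..<?m}" b] bB B(2) that by auto
  have b_span: "range (\<lambda>u. \<Sum>i<?m. u i *\<^sub>C b i) = V w0"
  proof -
    have "cvs.span B = V w0"
      using B(1,3) cvs.span_minimal[OF B(1) V_subspace] by blast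
    then show ?thesis
      using span_family[of "{..<?m}" b] bB by simp
  qed
  \<comment> \<open>\<open>S w\<close> intertwines the idempotents \<open>Q w0\<close> and \<open>Q w\<close>, and is the identity at \<open>w0\<close>.\<close>
  define S where "S w = Q w ** Q w0 + (mat 1 - Q w) ** (mat 1 - Q w0)" for w
  have S_apply: "S w *v x = Q w *v (Q w0 *v x) + ((x - Q w0 *v x) - Q w *v (x - Q w0 *v x))" for w x
    by (simp add: S_def matrix_vector_mult_add_rdistrib matrix_vector_mult_diff_rdistrib
        flip: matrix_vector_mul_assoc)
  have QQ: "Q w *v (Q w *v x) = Q w *v x" if "w \<in> \<Omega>" for w x
    by (rule Q_fixes[OF Q_mem[OF that]])
  have S_V: "S w *v v = Q w *v v" if "v \<in> V w0" for v w
    using Q_fixes[OF that] by (simp add: S_apply)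
  have S_intertwines: "S w *v (Q w0 *v x) = Q w *v (S w *v x)" if "w \<in> \<Omega>" for w x
    by (simp only: S_apply matrix_vector_right_distrib matrix_vector_mult_diff_distrib
        QQ[OF that] QQ[OF w0]) simp
  have "S w0 *v x = x" for x
    by (simp add: S_apply QQ[OF w0] matrix_vector_mult_diff_distrib)
  then have S_w0: "S w0 = mat 1"
    by (metis matrix_eq matrix_vector_mul_lid)
  have "((\<lambda>w. det (S w)) \<longlongrightarrow> det (S w0)) (at w0)"
  proof (rule tendsto_det)
    fix i j
    have "antihol_at (\<lambda>w. S w $ i $ j) w0"
      unfolding S_def matrix_matrix_mult_def
      by (simp, intro antihol_at_diff antihol_at_const antihol_at_sum antihol_at_mult antihol_at_add
          antihol_Q_entry w0) auto
    then show "((\<lambda>w. S w $ i $ j) \<longlongrightarrow> S w0 $ i $ j) (at w0)"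
      using antihol_at_imp_isCont isCont_def by blast
  qed
  then have "((\<lambda>w. det (S w)) \<longlongrightarrow> det (S w0)) (nhds w0)"
    by (rule tendsto_at_iff_tendsto_nhds[THEN iffD1])
  then have "\<forall>\<^sub>F w in nhds w0. det (S w) \<noteq> 0"
    by (rule tendsto_imp_eventually_ne) (simp add: S_w0)
  moreover have "\<forall>\<^sub>F w in nhds w0. w \<in> \<Omega>"
    using open_domain w0 by (rule eventually_nhds_in_open)
  ultimately have "\<forall>\<^sub>F w in nhds w0. det (S w) \<noteq> 0 \<and> w \<in> \<Omega>"
    by eventually_elim simp
  then obtain U where U: "open U" "w0 \<in> U" "\<And>w. w \<in> U \<Longrightarrow> det (S w) \<noteq> 0" "U \<subseteq> \<Omega>"
    unfolding eventually_nhds by blast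
  have "local_frame V U {..<?m} (\<lambda>i w. Q w *v b i)"
    unfolding local_frame_iff[OF finite_lessThan]
  proof (intro conjI ballI allI impI)
    show "antihol_at (\<lambda>w. Q w *v b i) w" if "w \<in> U" for i w
      using U(4) that by (intro antihol_Q) auto
  next
    fix w assume w: "w \<in> U"
    then have w\<Omega>: "w \<in> \<Omega>"
      using U(4) by blast
    have frame: "(\<Sum>i<?m. u i *\<^sub>C (Q w *v b i)) = S w *v (\<Sum>i<?m. u i *\<^sub>C b i)" for u
      using linear_sum[OF bounded_linear.linear[OF matrix_vector_mul_bounded_linear[of "S w"]],
          of "\<lambda>i. u i *\<^sub>C b i" "{..<?m}"]
      by (simp add: matrix_vector_scaleC S_V b_V)
    obtain T where T: "T ** S w = mat 1" "S w ** T = mat 1"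
      using U(3)[OF w] unfolding invertible_det_nz[symmetric] invertible_def by blast
    have TS: "T *v (S w *v x) = x" and ST: "S w *v (T *v x) = x" for x
      by (simp_all add: matrix_vector_mul_assoc T)
    show "u i = 0" if "(\<Sum>i<?m. u i *\<^sub>C (Q w *v b i)) = 0" "i \<in> {..<?m}" for u i
    proof -
      have "T *v (S w *v (\<Sum>i<?m. u i *\<^sub>C b i)) = 0"
        using that(1) by (simp add: frame)
      then show ?thesis
        using b_indep that(2) by (simp add: TS)
    qed
    show "range (\<lambda>u. \<Sum>i<?m. u i *\<^sub>C (Q w *v b i)) = V w"
    proof
      show "range (\<lambda>u. \<Sum>i<?m. u i *\<^sub>C (Q w *v b i)) \<subseteq> V w"
        using Q_mem[OF w\<Omega>]
        by (auto intro!: cvs.subspace_sum[OF V_subspace] cvs.subspace_scale[OF V_subspace])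
      show "V w \<subseteq> range (\<lambda>u. \<Sum>i<?m. u i *\<^sub>C (Q w *v b i))"
      proof
        fix v assume v: "v \<in> V w"
        have "v = S w *v (Q w0 *v (T *v v))"
          by (simp add: S_intertwines[OF w\<Omega>] ST Q_fixes[OF v])
        moreover have "Q w0 *v (T *v v) \<in> range (\<lambda>u. \<Sum>i<?m. u i *\<^sub>C b i)"
          unfolding b_span by (rule Q_mem[OF w0])
        then obtain u where "Q w0 *v (T *v v) = (\<Sum>i<?m. u i *\<^sub>C b i)"
          by auto
        ultimately have "v = (\<Sum>i<?m. u i *\<^sub>C (Q w *v b i))"
          by (simp only: frame)
        then show "v \<in> range (\<lambda>u. \<Sum>i<?m. u i *\<^sub>C (Q w *v b i))"
          by (rule range_eqI[of _ "\<lambda>u. \<Sum>i<?m. u i *\<^sub>C (Q w *v b i)"])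
      qed
    qed
  qed (rule U(1))
  then show "\<exists>U f. w0 \<in> U \<and> U \<subseteq> \<Omega> \<and> local_frame V U {..<?m} f"
    using U(2,4) by blast
qed

section \<open>The quotient module\<close>

abbreviation \<open>S \<equiv> quot_space \<Omega> M \<Theta>\<close>

abbreviation N :: "'n \<Rightarrow> 'h ^ 'q \<Rightarrow> 'h ^ 'q" where "N \<equiv> quot_action \<Omega> M \<Theta>"

abbreviation E\<Theta> :: "complex ^ 'n \<Rightarrow> ('h ^ 'q) set" where "E\<Theta> \<equiv> eigenspace S N"

text \<open>The counterpart of \<open>Q\<close> on the module: on vectors \<open>tensor k v\<close> with \<open>k\<close> in \<open>E w\<close> it acts as \<open>Q w\<close> on \<open>v\<close>.\<close>

definition R :: "'h ^ 'q \<Rightarrow> 'h ^ 'q" where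
  "R x = x - matrix_adj \<Psi> (matrix_adj \<Theta> x)"

lemma quot_space_eq: "S = {x. matrix_adj \<Theta> x = 0}"
proof -
  have "(\<forall>y. cinner x (matrix_mult_op \<Omega> M \<Theta> y) = 0) \<longleftrightarrow> matrix_adj \<Theta> x = 0" for x
  proof -
    have "(\<forall>y. cinner x (matrix_mult_op \<Omega> M \<Theta> y) = 0) \<longleftrightarrow> (\<forall>y. cinner y (matrix_adj \<Theta> x) = 0)"
      unfolding cinner_matrix_mult_op[OF Theta_mult, symmetric]
      by (metis cinner_commute complex_cnj_zero)
    also have "\<dots> \<longleftrightarrow> matrix_adj \<Theta> x = 0"
      by (metis cinner_eq_zero_iff cinner.zero_right)
    finally show ?thesis .
  qed
  then show ?thesis
    by (auto simp: quot_space_def orth_compl_def)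
qed

lemma S_subspace: "cvs.subspace S" and S_closed: "closed S"
  by (simp_all add: quot_space_def orth_compl_subspace orth_compl_closed)

lemma matrix_adj_right_inverse: "matrix_adj \<Theta> (matrix_adj \<Psi> y) = y"
proof (rule operators_eq_on_tensors[where S = "\<lambda>y. matrix_adj \<Theta> (matrix_adj \<Psi> y)"])
  show "bounded_clinear (\<lambda>y. matrix_adj \<Theta> (matrix_adj \<Psi> y))"
    by (intro bounded_clinear_compose[OF bounded_clinear_matrix_adj[OF Theta_mult]]
        bounded_clinear_matrix_adj[OF Psi_mult])
  fix w k v assume w: "w \<in> \<Omega>" and k: "k \<in> E w"
  show "matrix_adj \<Theta> (matrix_adj \<Psi> (tensor k v)) = tensor k v"
    by (simp only: matrix_adj_tensor[OF Theta_mult w k] matrix_adj_tensor[OF Psi_mult w k]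
        right_inverse[OF w])
qed (rule bounded_clinear_ident)

lemma bounded_clinear_R: "bounded_clinear R"
  unfolding R_def
  by (intro bounded_clinear_diff bounded_clinear_ident
      bounded_clinear_compose[OF bounded_clinear_matrix_adj[OF Psi_mult]]
      bounded_clinear_matrix_adj[OF Theta_mult])

lemma R_mem: "R x \<in> S"
  using bounded_clinear_imp_bounded_linear[OF bounded_clinear_matrix_adj[OF Theta_mult]]
  by (simp add: quot_space_eq R_def linear_simps matrix_adj_right_inverse)

lemma R_fixes: "x \<in> S \<Longrightarrow> R x = x"
  using bounded_clinear_imp_bounded_linear[OF bounded_clinear_matrix_adj[OF Psi_mult]]
  by (simp add: quot_space_eq R_def linear_simps)

lemma R_tensor: "w \<in> \<Omega> \<Longrightarrow> k \<in> E w \<Longrightarrow> R (tensor k v) = tensor k (Q w *v v)"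
  by (simp add: R_def matrix_adj_tensor[OF Theta_mult] matrix_adj_tensor[OF Psi_mult] Q_apply
      bounded_bilinear.diff_right[OF bounded_bilinear_tensor])

lemma R_commute: "R (MAq i x) = MAq i (R x)"
  by (simp add: R_def matrix_adj_commute[OF Theta_mult] matrix_adj_commute[OF Psi_mult]
      linear_diff[OF bounded_linear.linear[OF
        bounded_clinear_imp_bounded_linear[OF bounded_clinear_MAq]]])

lemma MAq_mem: "x \<in> S \<Longrightarrow> MAq i x \<in> S"
  by (metis R_commute R_fixes R_mem)

definition Mq :: "'n \<Rightarrow> 'h ^ 'q \<Rightarrow> 'h ^ 'q" where
  "Mq i x = (\<chi> j. M i (x $ j))"

lemma bounded_clinear_Mq: "bounded_clinear (Mq i)"
  unfolding Mq_def
  by (intro bounded_clinear_vec_lambda bounded_clinear_compose[OF bounded_clinear_M]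
      bounded_clinear_vec_nth)

lemma cinner_Mq: "cinner (Mq i x) y = cinner x (MAq i y)"
  by (simp add: cinner_vec_def Mq_def MAq_def cinner_MA)

lemma N_eq: "N i x = orth_proj S (Mq i x)"
  by (simp add: quot_action_def Mq_def)

lemma N_mem: "N i x \<in> S"
  unfolding N_eq by (rule orth_proj_mem[OF S_subspace S_closed])

lemma cinner_N: "y \<in> S \<Longrightarrow> cinner (N i x) y = cinner x (MAq i y)"
  by (simp add: N_eq cinner_orth_proj[OF S_subspace S_closed] cinner_Mq)

text \<open>Since \<open>S\<close> is invariant under the adjoints \<open>MAq i\<close>, the compressions to \<open>S\<close> compose like the operators
  \<open>Mq i\<close> do and inherit their commutativity.\<close>

lemma hilbert_module_quotient: "hilbert_module S N"
  unfolding hilbert_module_def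
proof (intro conjI allI ballI S_subspace S_closed)
  fix i
  show "bounded_operator_on S (N i)"
  proof (rule bounded_operator_onI)
    show "bounded_clinear (N i)"
      unfolding N_eq[abs_def]
      by (rule bounded_clinear_compose[OF bounded_clinear_orth_proj[OF S_subspace S_closed]
            bounded_clinear_Mq])
  qed (rule N_mem)
next
  fix i j x
  have "cinner (N i (N j x)) y = cinner (Mq i (Mq j x)) y" if "y \<in> S" for i j y
    using that by (simp add: cinner_N MAq_mem cinner_Mq)
  moreover have "Mq i (Mq j x) = Mq j (Mq i x)"
    by (simp add: Mq_def vec_eq_iff M_commute[of i])
  ultimately have "cinner (N i (N j x)) y = cinner (N j (N i x)) y" if "y \<in> S" for y
    using that by simp
  then have "\<forall>y\<in>S. cinner y (N i (N j x)) = cinner y (N j (N i x))"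
    by (metis cinner_commute)
  then show "N i (N j x) = N j (N i x)"
    by (rule adjoint_on_unique[OF S_subspace N_mem N_mem])
qed

lemma column_adjoint_quotient:
  assumes h: "h \<in> S"
  shows "column_adjoint S N w h $ i = MAq i h - cnj (w $ i) *\<^sub>C h"
  unfolding column_adjoint_def
proof (simp, rule adjoint_on_eqI[OF S_subspace])
  show "MAq i h - cnj (w $ i) *\<^sub>C h \<in> S"
    using h by (intro cvs.subspace_diff[OF S_subspace] cvs.subspace_scale[OF S_subspace] MAq_mem)
  fix x
  show "cinner (N i x - (w $ i) *\<^sub>C x) h = cinner x (MAq i h - cnj (w $ i) *\<^sub>C h)"
    using h by (simp add: cinner.diff_left cinner.diff_right cinner_N cinner_scaleC_left
        cinner_scaleC_right)
qed

lemma column_adjoint_quotient_nth: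
  "h \<in> S \<Longrightarrow> column_adjoint S N w h $ i $ j = D w (h $ j) $ i"
  by (simp add: column_adjoint_quotient D_nth MAq_def)

text \<open>The range on \<open>S\<close> consists of the tuples in the range on \<open>'h ^ 'q\<close> that are fixed by \<open>R\<close>,
  because \<open>R\<close> commutes with the adjoints and projects onto \<open>S\<close>.\<close>

lemma closed_range_quotient:
  assumes w: "w \<in> \<Omega>"
  shows "closed (column_adjoint S N w ` S)"
proof -
  define pr where "pr j z = (\<chi> i. z $ i $ j)" for j and z :: "('h ^ 'q) ^ 'n"
  define Rn where "Rn z = (\<chi> i. R (z $ i))" for z :: "('h ^ 'q) ^ 'n"
  have pr: "bounded_clinear (pr j)" for j
    unfolding pr_def
    by (intro bounded_clinear_vec_lambda bounded_clinear_compose[OF bounded_clinear_vec_nth]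
        bounded_clinear_vec_nth)
  have Rn: "bounded_clinear (\<lambda>z. Rn z - z)"
    unfolding Rn_def
    by (intro bounded_clinear_diff bounded_clinear_ident bounded_clinear_vec_lambda
        bounded_clinear_compose[OF bounded_clinear_R] bounded_clinear_vec_nth)
  have pr_col: "pr j (column_adjoint S N w x) = D w (x $ j)" if "x \<in> S" for j x
    using that by (simp add: pr_def vec_eq_iff column_adjoint_quotient_nth)
  have "column_adjoint S N w ` S = {z. \<forall>j. pr j z \<in> range (D w)} \<inter> {z. Rn z - z = 0}"
  proof (intro equalityI subsetI IntI CollectI)
    fix z assume "z \<in> column_adjoint S N w ` S"
    then obtain x where x: "x \<in> S" "z = column_adjoint S N w x" by auto
    show "\<forall>j. pr j z \<in> range (D w)"
      using x by (simp add: pr_col)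
    have "z $ i \<in> S" for i
      unfolding x(2) column_adjoint_quotient[OF x(1)]
      by (intro cvs.subspace_diff[OF S_subspace] cvs.subspace_scale[OF S_subspace] MAq_mem x(1))
    then show "Rn z - z = 0"
      by (simp add: Rn_def vec_eq_iff R_fixes)
  next
    fix z assume "z \<in> {z. \<forall>j. pr j z \<in> range (D w)} \<inter> {z. Rn z - z = 0}"
    then have z: "\<forall>j. pr j z \<in> range (D w)" "Rn z = z"
      by auto
    then have "\<forall>j. \<exists>y. pr j z = D w y" by blast
    then obtain y where y: "\<And>j. pr j z = D w (y j)" by metis
    define x where "x = (\<chi> j. y j)"
    have zi: "z $ i = MAq i x - cnj (w $ i) *\<^sub>C x" for i
      using y by (simp add: vec_eq_iff pr_def x_def MAq_def D_nth)
    have "z $ i = R (z $ i)" for i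
      using z(2) by (simp add: Rn_def vec_eq_iff)
    also have "R (z $ i) = MAq i (R x) - cnj (w $ i) *\<^sub>C R x" for i
      unfolding zi using bounded_clinear_imp_bounded_linear[OF bounded_clinear_R]
      by (simp add: linear_simps R_commute bounded_clinear_scaleC[OF bounded_clinear_R])
    finally have "z = column_adjoint S N w (R x)"
      by (subst vec_eq_iff) (simp add: column_adjoint_quotient R_mem)
    then show "z \<in> column_adjoint S N w ` S"
      using R_mem by blast
  qed
  moreover have "closed {z. \<forall>j. pr j z \<in> range (D w)}"
  proof -
    have "closed (pr j -` range (D w))" for j
      using bounded_clinear_imp_bounded_linear[OF pr] D_closed_range[OF w]
      by (intro continuous_closed_vimage) (auto intro: linear_continuous_at)
    then have "closed (\<Inter>j. pr j -` range (D w))"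
      by (intro closed_INT) auto
    moreover have "{z. \<forall>j. pr j z \<in> range (D w)} = (\<Inter>j. pr j -` range (D w))"
      by auto
    ultimately show ?thesis by simp
  qed
  ultimately show ?thesis
    using kernel_closed[OF Rn] by (simp add: closed_Int)
qed

lemma tensor_bundle_fibre:
  assumes "w \<in> \<Omega>" "s \<in> E w" "s \<noteq> 0"
  shows "tensor_bundle E V w = tensor s ` V w"
proof -
  have "{tensor k v |k v. k \<in> E w \<and> v \<in> V w} = tensor s ` V w"
  proof (intro equalityI subsetI)
    fix x assume "x \<in> {tensor k v |k v. k \<in> E w \<and> v \<in> V w}"
    then obtain c v where v: "x = tensor (c *\<^sub>C s) v" "v \<in> V w"
      using eigenspace_eq_span[OF assms] by auto
    have "x = tensor s (c *\<^sub>C v)"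
      using v(1) by (simp add: tensor_scaleC_left tensor_scaleC_right)
    then show "x \<in> tensor s ` V w"
      using cvs.subspace_scale[OF V_subspace v(2)] by blast
  qed (use assms(2) in blast)
  moreover have "cvs.span (tensor s ` V w) = tensor s ` V w"
  proof (rule cvs.span_eq_iff[THEN iffD2], unfold cvs.subspace_def, intro conjI ballI allI)
    show "0 \<in> tensor s ` V w"
      by (rule image_eqI[of _ _ 0])
        (simp_all add: bounded_bilinear.zero_right[OF bounded_bilinear_tensor]
          cvs.subspace_0[OF V_subspace])
  next
    fix x y assume "x \<in> tensor s ` V w" "y \<in> tensor s ` V w"
    then show "x + y \<in> tensor s ` V w"
      using cvs.subspace_add[OF V_subspace]
      by (auto simp flip: bounded_bilinear.add_right[OF bounded_bilinear_tensor])
  next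
    fix c x assume "x \<in> tensor s ` V w"
    then show "c *\<^sub>C x \<in> tensor s ` V w"
      using cvs.subspace_scale[OF V_subspace] by (auto simp flip: tensor_scaleC_right)
  qed
  ultimately show ?thesis
    by (simp add: tensor_bundle_def)
qed

text \<open>The adjoint of the compressed action is the restriction of \<open>MAq\<close>, so an eigenvector of the quotient
  has all its components in the line \<open>E w\<close> and is \<open>tensor s v\<close> for one vector \<open>v\<close>; membership in \<open>S\<close> then
  says that \<open>v\<close> is in \<open>V w\<close>.\<close>

lemma eigenspace_quotient:
  assumes w: "w \<in> \<Omega>"
  shows "E\<Theta> w = tensor_bundle E V w"
proof -
  obtain s where s: "s \<noteq> 0" "E w = range (\<lambda>c. c *\<^sub>C s)"
    using eigenspace_line[OF w] .
  have sE: "s \<in> E w"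
    unfolding s(2) by (rule range_eqI[of _ _ 1]) simp
  have tens0: "tensor s v = 0 \<longleftrightarrow> v = 0" for v :: "complex ^ 'p"
    using s(1) norm_tensor[of s v] norm_eq_zero[of "tensor s v"] by simp
  have "E\<Theta> w = {x\<in>S. \<forall>j. x $ j \<in> E w}"
    by (auto simp: eigenspace_def[of S] vec_eq_iff column_adjoint_quotient_nth eigenspace_eq_kernel)
  also have "\<dots> = tensor s ` V w"
  proof (intro equalityI subsetI)
    fix x assume x: "x \<in> {x\<in>S. \<forall>j. x $ j \<in> E w}"
    then have "\<forall>j. \<exists>c. x $ j = c *\<^sub>C s"
      unfolding s(2) by auto
    then obtain c where c: "\<And>j. x $ j = c j *\<^sub>C s" by metis
    have xt: "x = tensor s (\<chi> j. c j)"
      using c by (simp add: tensor_def vec_eq_iff)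
    have "tensor s (\<Theta>A w *v (\<chi> j. c j)) = 0"
      using x by (simp add: quot_space_eq flip: matrix_adj_tensor[OF Theta_mult w sE] xt)
    then show "x \<in> tensor s ` V w"
      unfolding tens0 by (auto simp: xt V_def)
  next
    fix x assume "x \<in> tensor s ` V w"
    then obtain v where v: "x = tensor s v" "\<Theta>A w *v v = 0"
      by (auto simp: V_def)
    have "x \<in> S"
      using v by (simp add: quot_space_eq matrix_adj_tensor[OF Theta_mult w sE] tens0)
    moreover have "x $ j \<in> E w" for j
      using v sE by (simp add: tensor_def cvs.subspace_scale[OF eigenspace_subspace])
    ultimately show "x \<in> {x\<in>S. \<forall>j. x $ j \<in> E w}"
      by simp
  qed
  finally show ?thesis
    by (simp add: tensor_bundle_fibre[OF w sE s(1)])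
qed

lemma local_frame_tensor:
  assumes U: "U \<subseteq> \<Omega>" and I: "finite I"
    and s: "\<And>w. w \<in> U \<Longrightarrow> antihol_at s w" "\<And>w. w \<in> U \<Longrightarrow> s w \<in> E w" "\<And>w. w \<in> U \<Longrightarrow> s w \<noteq> 0"
    and f: "local_frame V U I f"
  shows "local_frame (tensor_bundle E V) U I (\<lambda>i w. tensor (s w) (f i w))"
proof -
  note f = f[unfolded local_frame_iff[OF I]]
  have sum: "(\<Sum>i\<in>I. u i *\<^sub>C tensor (s w) (f i w)) = tensor (s w) (\<Sum>i\<in>I. u i *\<^sub>C f i w)" for u w
    by (simp add: bounded_bilinear.sum_right[OF bounded_bilinear_tensor] tensor_scaleC_right)
  show ?thesis
    unfolding local_frame_iff[OF I] sum
  proof (intro conjI ballI allI impI)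
    show "open U"
      using f by blast
    show "antihol_at (\<lambda>w. tensor (s w) (f i w)) w" if "i \<in> I" "w \<in> U" for i w
      using f s(1) that by (intro antihol_at_tensor) auto
    fix w assume w: "w \<in> U"
    show "u i = 0" if "tensor (s w) (\<Sum>i\<in>I. u i *\<^sub>C f i w) = 0" "i \<in> I" for u i
    proof -
      have "norm (s w) * norm (\<Sum>i\<in>I. u i *\<^sub>C f i w) = 0"
        using that(1) by (simp flip: norm_tensor)
      then have "(\<Sum>i\<in>I. u i *\<^sub>C f i w) = 0"
        using s(3)[OF w] by simp
      then show ?thesis
        using f w that(2) by blast
    qed
    have "range (\<lambda>u. tensor (s w) (\<Sum>i\<in>I. u i *\<^sub>C f i w)) = tensor (s w) ` range (\<lambda>u. \<Sum>i\<in>I. u i *\<^sub>C f i w)"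
      by auto
    also have "range (\<lambda>u. \<Sum>i\<in>I. u i *\<^sub>C f i w) = V w"
      using f w by blast
    finally show "range (\<lambda>u. tensor (s w) (\<Sum>i\<in>I. u i *\<^sub>C f i w)) = tensor_bundle E V w"
      using U w s(2,3) by (simp add: tensor_bundle_fibre[of w "s w"] subsetD)
  qed
qed

lemma antihol_bundle_tensor: "antihol_bundle \<Omega> (CARD('q) - CARD('p)) (tensor_bundle E V)"
  unfolding antihol_bundle_def
proof
  fix w assume w: "w \<in> \<Omega>"
  obtain U1 s k0 where U1: "w \<in> U1" "open U1" "U1 \<subseteq> \<Omega>" "antiholomorphic_on s U1"
    "\<And>w. w \<in> U1 \<Longrightarrow> s w \<in> E w" "\<And>w. w \<in> U1 \<Longrightarrow> cinner (s w) k0 = 1"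
    using local_frame_exists[OF w] by metis
  obtain U2 f where U2: "w \<in> U2" "U2 \<subseteq> \<Omega>" "local_frame V U2 {..<CARD('q) - CARD('p)} f"
    using antihol_bundle_V w unfolding antihol_bundle_def by blast
  have "local_frame V (U1 \<inter> U2) {..<CARD('q) - CARD('p)} f"
    using U2(3) U1(2) unfolding local_frame_iff[OF finite_lessThan] by blast
  moreover have "s v \<noteq> 0" if "v \<in> U1" for v
    using U1(6)[OF that] by auto
  ultimately have "local_frame (tensor_bundle E V) (U1 \<inter> U2) {..<CARD('q) - CARD('p)}
      (\<lambda>i w. tensor (s w) (f i w))"
    using U1 U2(2) by (intro local_frame_tensor) (auto simp: antiholomorphic_on_iff)
  then show "\<exists>U f. w \<in> U \<and> U \<subseteq> \<Omega> \<and> local_frame (tensor_bundle E V) U {..<CARD('q) - CARD('p)} f"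
    using U1(1,3) U2(1) by (intro exI[of _ "U1 \<inter> U2"] exI[of _ "\<lambda>i w. tensor (s w) (f i w)"]) auto
qed

lemma antihol_bundle_quotient: "antihol_bundle \<Omega> (CARD('q) - CARD('p)) E\<Theta>"
  unfolding antihol_bundle_def
proof
  fix w assume "w \<in> \<Omega>"
  then obtain U f where U: "w \<in> U" "U \<subseteq> \<Omega>"
    "local_frame (tensor_bundle E V) U {..<CARD('q) - CARD('p)} f"
    using antihol_bundle_tensor unfolding antihol_bundle_def by blast
  then have "local_frame E\<Theta> U {..<CARD('q) - CARD('p)} f"
    using eigenspace_quotient by (subst local_frame_cong[of U _ "tensor_bundle E V"]) auto
  with U show "\<exists>U f. w \<in> U \<and> U \<subseteq> \<Omega> \<and> local_frame E\<Theta> U {..<CARD('q) - CARD('p)} f"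
    by blast
qed

lemma bundle_equiv_quotient: "bundle_equiv \<Omega> E\<Theta> (tensor_bundle E V)"
proof -
  have "bundle_iso \<Omega> E\<Theta> (tensor_bundle E V) (\<lambda>w x. x)"
    unfolding bundle_iso_def using eigenspace_quotient by (simp add: bij_betw_def)
  then show ?thesis
    using antihol_bundle_quotient antihol_bundle_tensor unfolding bundle_equiv_def by blast
qed

text \<open>The map \<open>R\<close> sends the vectors \<open>tensor k v\<close>, whose span is dense, to eigenvectors of the quotient module
  and has range \<open>S\<close>.\<close>

lemma eigenvectors_dense_quotient: "closure (cvs.span (\<Union>w\<in>\<Omega>. E\<Theta> w)) = S"
proof
  let ?C = "closure (cvs.span (\<Union>w\<in>\<Omega>. E\<Theta> w))"
  have "(\<Union>w\<in>\<Omega>. E\<Theta> w) \<subseteq> S"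
    by (auto simp: eigenspace_def)
  then show "?C \<subseteq> S"
    by (intro closure_minimal cvs.span_minimal S_subspace S_closed)
  have C: "cvs.subspace ?C" "closed ?C"
    by (auto intro: closure_cvs_subspace cvs.subspace_span)
  have "R x - orth_proj ?C (R x) = 0" for x
  proof (rule operators_eq_on_tensors[where S = "\<lambda>x. R x - orth_proj ?C (R x)" and T = "\<lambda>x. 0"])
    show "bounded_clinear (\<lambda>x. R x - orth_proj ?C (R x))"
      by (intro bounded_clinear_diff bounded_clinear_R
          bounded_clinear_compose[OF bounded_clinear_orth_proj[OF C]])
    fix w k v assume w: "w \<in> \<Omega>" and k: "k \<in> E w"
    have "tensor k (Q w *v v) \<in> tensor_bundle E V w"
      unfolding tensor_bundle_def using k Q_mem[OF w] by (intro cvs.span_base) blast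
    then have "R (tensor k v) \<in> (\<Union>w\<in>\<Omega>. E\<Theta> w)"
      using w by (auto simp: R_tensor[OF w k] eigenspace_quotient)
    then have "R (tensor k v) \<in> ?C"
      by (intro subsetD[OF closure_subset] cvs.span_base)
    then show "R (tensor k v) - orth_proj ?C (R (tensor k v)) = 0"
      by (simp add: orth_proj_fixes[OF C])
  qed (rule bounded_clinear_zero)
  then have "R x \<in> ?C" for x
    using orth_proj_mem[OF C, of "R x"] by simp
  then show "S \<subseteq> ?C"
    using R_fixes by (metis subsetI)
qed

lemma B_star_quotient: "B_star \<Omega> (CARD('q) - CARD('p)) S N"
  unfolding B_star_def
  by (intro conjI ballI hilbert_module_quotient closed_range_quotient
      eigenvectors_dense_quotient antihol_bundle_dim[OF antihol_bundle_quotient])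
    (use card_less in simp)

end

section \<open>Curvature of a tensor product\<close>

subsection \<open>The inverse matrix\<close>

lemma matrix_inv_eqI:
  fixes A B :: "complex ^ 'm ^ 'm"
  assumes "A ** B = mat 1"
  shows "matrix_inv A = B"
proof -
  have BA: "B ** A = mat 1"
    using assms by (rule matrix_left_right_inverse1)
  have "A ** matrix_inv A = mat 1 \<and> matrix_inv A ** A = mat 1"
    unfolding matrix_inv_def using assms BA by (rule someI[where x = B, OF conjI])
  then have inv: "A ** matrix_inv A = mat 1" by simp
  have "matrix_inv A = (B ** A) ** matrix_inv A"
    by (simp add: BA)
  also have "\<dots> = B ** (A ** matrix_inv A)"
    by (simp only: matrix_mul_assoc)
  also have "\<dots> = B"
    by (simp add: inv)
  finally show ?thesis .
qed

lemma matrix_inv_right: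
  fixes A :: "complex ^ 'm ^ 'm"
  assumes "det A \<noteq> 0"
  shows "A ** matrix_inv A = mat 1"
proof -
  obtain B where "A ** B = mat 1"
    using assms unfolding invertible_det_nz[symmetric] invertible_def by blast
  then show ?thesis
    using matrix_inv_eqI[of A B] by simp
qed

lemma matrix_inv_left:
  fixes A :: "complex ^ 'm ^ 'm"
  assumes "det A \<noteq> 0"
  shows "matrix_inv A ** A = mat 1"
  by (rule matrix_left_right_inverse1[OF matrix_inv_right[OF assms]])

text \<open>Cramer's rule shows that the entries of the inverse are differentiable functions of the entries.\<close>

lemma matrix_inv_cramer:
  fixes A :: "complex ^ 'm ^ 'm"
  assumes "det A \<noteq> 0"
  shows "matrix_inv A $ k $ l = det (\<chi> i j. if j = k then axis l 1 $ i else A $ i $ j) / det A"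
proof -
  have "A *v column l (matrix_inv A) = column l (A ** matrix_inv A)"
    by (simp add: vec_eq_iff column_def matrix_matrix_mult_def matrix_vector_mult_def)
  also have "\<dots> = axis l 1"
    by (auto simp: matrix_inv_right[OF assms] vec_eq_iff column_def mat_def axis_def)
  finally have "column l (matrix_inv A) = (\<chi> k. det (\<chi> i j. if j = k then axis l 1 $ i else A $ i $ j) / det A)"
    unfolding cramer[OF assms] .
  then show ?thesis
    by (simp add: vec_eq_iff column_def)
qed

lemma differentiable_prod:
  fixes f :: "'i \<Rightarrow> real \<Rightarrow> complex"
  assumes "finite I" "\<And>i. i \<in> I \<Longrightarrow> f i differentiable (at x)"
  shows "(\<lambda>t. \<Prod>i\<in>I. f i t) differentiable (at x)"
  using assms by (induction I rule: finite_induct) auto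

lemma differentiable_det:
  fixes A :: "real \<Rightarrow> complex ^ 'm ^ 'm"
  assumes "\<And>i j. (\<lambda>t. A t $ i $ j) differentiable (at x)"
  shows "(\<lambda>t. det (A t)) differentiable (at x)"
  unfolding det_def
  by (intro differentiable_sum ballI differentiable_mult differentiable_const differentiable_prod
      assms finite_permutations) auto

lemma differentiable_matrix_inv:
  fixes A :: "real \<Rightarrow> complex ^ 'm ^ 'm"
  assumes A: "\<And>i j. (\<lambda>t. A t $ i $ j) differentiable (at x)"
    and det: "\<forall>\<^sub>F t in nhds x. det (A t) \<noteq> 0"
  shows "(\<lambda>t. matrix_inv (A t) $ k $ l) differentiable (at x)"
proof -
  let ?C = "\<lambda>t. det (\<chi> i j. if j = k then axis l 1 $ i else A t $ i $ j) / det (A t)"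
  have "(\<lambda>t. (\<chi> i j. if j = k then axis l 1 $ i else A t $ i $ j) $ i $ j) differentiable (at x)" for i j
    using A by (cases "j = k") simp_all
  then have C: "?C differentiable (at x)"
    using det by (intro differentiable_divide differentiable_det A) (auto dest: eventually_nhds_x_imp_x)
  obtain e where e: "e > 0" "\<And>t. dist t x < e \<Longrightarrow> det (A t) \<noteq> 0"
    using det unfolding eventually_nhds_metric by blast
  show ?thesis
    by (rule differentiable_transform_within[OF C e(1) UNIV_I]) (simp add: matrix_inv_cramer e(2))
qed

subsection \<open>Directional derivatives\<close>

text \<open>The value of \<open>dir_deriv\<close> is meaningful only where this holds, so it is the side condition of the
  rules for directional derivatives.\<close>

definition line_diff ::
  "(complex ^ 'n \<Rightarrow> 'a::complex_hilbert) \<Rightarrow> complex ^ 'n \<Rightarrow> complex ^ 'n \<Rightarrow> bool" where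
  "line_diff g w v \<longleftrightarrow> (\<lambda>t. g (w + t *\<^sub>R v)) differentiable (at 0)"

lemma line_diffD:
  "line_diff g w v \<Longrightarrow> ((\<lambda>t. g (w + t *\<^sub>R v)) has_vector_derivative dir_deriv g w v) (at 0)"
  unfolding line_diff_def dir_deriv_def by (simp add: vector_derivative_works)

lemma line_diffI:
  assumes "((\<lambda>t. g (w + t *\<^sub>R v)) has_vector_derivative d) (at 0)"
  shows "line_diff g w v" "dir_deriv g w v = d"
  using assms unfolding line_diff_def dir_deriv_def
  by (auto intro: differentiableI_vector vector_derivative_at)

lemma eventually_line:
  fixes w v :: "complex ^ 'n"
  assumes "open U" "w \<in> U"
  shows "\<forall>\<^sub>F t::real in nhds 0. w + t *\<^sub>R v \<in> U"
proof -
  have "((\<lambda>t::real. w + t *\<^sub>R v) \<longlongrightarrow> w + 0 *\<^sub>R v) (nhds 0)"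
    by (intro tendsto_intros filterlim_ident)
  then show ?thesis
    using assms by (intro topological_tendstoD[where f = "\<lambda>t. w + t *\<^sub>R v"]) auto
qed

lemma line_cong:
  fixes f g :: "complex ^ 'n \<Rightarrow> 'a::complex_hilbert"
  assumes U: "open U" "w \<in> U" and eq: "\<And>z. z \<in> U \<Longrightarrow> f z = g z"
  shows "dir_deriv f w v = dir_deriv g w v" "line_diff f w v \<longleftrightarrow> line_diff g w v"
proof -
  have ev: "\<forall>\<^sub>F t::real in nhds 0. w + t *\<^sub>R v \<in> U"
    by (rule eventually_line[OF U])
  show "dir_deriv f w v = dir_deriv g w v"
    unfolding dir_deriv_def using ev eq by (intro vector_derivative_cong_eq) (auto elim: eventually_mono)
  obtain e where e: "e > 0" "\<And>t::real. dist t 0 < e \<Longrightarrow> w + t *\<^sub>R v \<in> U"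
    using ev unfolding eventually_nhds_metric by blast
  have "line_diff g w v" if "line_diff f w v" and fg: "\<And>z. z \<in> U \<Longrightarrow> f z = g z"
    for f g :: "complex ^ 'n \<Rightarrow> 'a"
    unfolding line_diff_def
  proof (rule differentiable_transform_within[OF _ e(1) UNIV_I])
    show "(\<lambda>t. f (w + t *\<^sub>R v)) differentiable (at 0)"
      using that(1) by (simp add: line_diff_def)
    show "f (w + t *\<^sub>R v) = g (w + t *\<^sub>R v)" if "dist t 0 < e" for t
      by (rule fg[OF e(2)[OF that]])
  qed
  then show "line_diff f w v \<longleftrightarrow> line_diff g w v"
    using eq by metis
qed

lemma line_add:
  assumes "line_diff f w v" "line_diff g w v"
  shows "line_diff (\<lambda>z. f z + g z) w v"
    and "dir_deriv (\<lambda>z. f z + g z) w v = dir_deriv f w v + dir_deriv g w v"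
  using line_diffI[OF has_vector_derivative_add[OF line_diffD[OF assms(1)] line_diffD[OF assms(2)]]]
  by auto

lemma line_bilinear:
  assumes "bounded_bilinear h" "line_diff f w v" "line_diff g w v"
  shows "line_diff (\<lambda>z. h (f z) (g z)) w v"
    and "dir_deriv (\<lambda>z. h (f z) (g z)) w v = h (f w) (dir_deriv g w v) + h (dir_deriv f w v) (g w)"
  using line_diffI[OF bounded_bilinear.has_vector_derivative[OF assms(1) line_diffD[OF assms(2)]
      line_diffD[OF assms(3)]]]
  by auto

lemma line_vec_lambda:
  fixes f :: "'m::finite \<Rightarrow> complex ^ 'n \<Rightarrow> 'a::complex_hilbert"
  assumes "\<And>i. line_diff (f i) w v"
  shows "line_diff (\<lambda>z. \<chi> i. f i z) w v"
    and "dir_deriv (\<lambda>z. \<chi> i. f i z) w v = (\<chi> i. dir_deriv (f i) w v)"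
proof -
  have "((\<lambda>t. \<chi> i. f i (w + t *\<^sub>R v)) has_derivative (\<lambda>t. \<chi> i. t *\<^sub>R dir_deriv (f i) w v)) (at 0)"
    using line_diffD[OF assms] unfolding has_vector_derivative_def by (rule has_derivative_vec_lambda)
  moreover have "(\<lambda>t. \<chi> i. t *\<^sub>R dir_deriv (f i) w v) = (\<lambda>t. t *\<^sub>R (\<chi> i. dir_deriv (f i) w v))"
    by (simp add: fun_eq_iff vec_eq_iff)
  ultimately have "((\<lambda>t. \<chi> i. f i (w + t *\<^sub>R v)) has_vector_derivative (\<chi> i. dir_deriv (f i) w v)) (at 0)"
    by (simp add: has_vector_derivative_def)
  then show "line_diff (\<lambda>z. \<chi> i. f i z) w v"
    "dir_deriv (\<lambda>z. \<chi> i. f i z) w v = (\<chi> i. dir_deriv (f i) w v)"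
    using line_diffI[of "\<lambda>z. \<chi> i. f i z"] by auto
qed

lemma line_vec_nth: "line_diff f w v \<Longrightarrow> line_diff (\<lambda>z. f z $ i) w v"
  using bounded_linear.has_derivative[OF bounded_linear_vec_nth[of i]]
  unfolding line_diff_def differentiable_def by blast

lemma line_const: "line_diff (\<lambda>z. c) w v" "dir_deriv (\<lambda>z. c) w v = 0"
  using line_diffI[of "\<lambda>z. c" w v 0] by auto

lemma antihol_at_imp_line_diff: "antihol_at f w \<Longrightarrow> line_diff f w v"
  by (rule line_diffI(1)[OF antihol_at_line(2)])

subsection \<open>Kronecker products\<close>

lemma bounded_bilinear_kron:
  "bounded_bilinear (kron :: complex ^ 'a::finite ^ 'a \<Rightarrow> complex ^ 'b::finite ^ 'b \<Rightarrow> _)"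
proof
  fix A A' :: "complex ^ 'a ^ 'a" and B B' :: "complex ^ 'b ^ 'b" and r
  show "kron (A + A') B = kron A B + kron A' B" "kron A (B + B') = kron A B + kron A B'"
    by (simp_all add: kron_def vec_eq_iff algebra_simps)
  show "kron (r *\<^sub>R A) B = r *\<^sub>R kron A B" "kron A (r *\<^sub>R B) = r *\<^sub>R kron A B"
    by (simp_all add: kron_def vec_eq_iff)
  have entry: "cmod (A $ i $ j) \<le> norm A" for A :: "complex ^ 'c::finite ^ 'c" and i j
    using Finite_Cartesian_Product.norm_nth_le[of "A $ i" j]
      Finite_Cartesian_Product.norm_nth_le[of A i] by linarith
  show "\<exists>K. \<forall>A B. norm (kron A B :: complex ^ ('a \<times> 'b) ^ ('a \<times> 'b)) \<le> norm A * norm B * K"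
  proof (intro exI allI)
    fix A :: "complex ^ 'a ^ 'a" and B :: "complex ^ 'b ^ 'b"
    have "norm (kron A B) \<le> (\<Sum>r\<in>UNIV. \<Sum>s\<in>UNIV. norm (kron A B $ r $ s))"
      by (intro order_trans[OF norm_vec_le_sum] sum_mono norm_vec_le_sum)
    also have "\<dots> \<le> (\<Sum>r\<in>(UNIV :: ('a \<times> 'b) set). \<Sum>s\<in>(UNIV :: ('a \<times> 'b) set). norm A * norm B)"
      by (intro sum_mono) (simp add: kron_def norm_mult mult_mono entry)
    finally show "norm (kron A B) \<le> norm A * norm B * (real CARD('a \<times> 'b) * real CARD('a \<times> 'b))"
      by (simp add: mult_ac)
  qed
qed

lemma kron_scaleC: "kron (c *\<^sub>C A) B = c *\<^sub>C kron A B" "kron A (c *\<^sub>C B) = c *\<^sub>C kron A B"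
  by (simp_all add: kron_def vec_eq_iff)

lemma kron_mult: "kron A B ** kron C D = kron (A ** C) (B ** D)"
proof -
  have "(kron A B ** kron C D) $ r $ s = kron (A ** C) (B ** D) $ r $ s" for r s
  proof -
    have "(kron A B ** kron C D) $ r $ s =
        (\<Sum>t\<in>UNIV \<times> UNIV. (A $ fst r $ fst t * C $ fst t $ fst s) * (B $ snd r $ snd t * D $ snd t $ snd s))"
      by (simp add: matrix_matrix_mult_def kron_def UNIV_Times_UNIV mult_ac)
    also have "\<dots> = (\<Sum>a\<in>UNIV. \<Sum>b\<in>UNIV. (A $ fst r $ a * C $ a $ fst s) * (B $ snd r $ b * D $ b $ snd s))"
      by (simp add: sum.cartesian_product case_prod_unfold)
    also have "\<dots> = kron (A ** C) (B ** D) $ r $ s"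
      by (simp add: matrix_matrix_mult_def kron_def sum_product)
    finally show ?thesis .
  qed
  then show ?thesis
    by (simp add: vec_eq_iff)
qed

lemma kron_mat_1: "kron (mat 1) (mat 1) = mat 1"
  by (auto simp: kron_def mat_def vec_eq_iff prod_eq_iff)

lemma matrix_inv_kron:
  assumes "det A \<noteq> 0" "det B \<noteq> 0"
  shows "matrix_inv (kron A B) = kron (matrix_inv A) (matrix_inv B)"
  using assms by (intro matrix_inv_eqI) (simp add: kron_mult matrix_inv_right kron_mat_1)

subsection \<open>The connection form\<close>

text \<open>The coefficient of \<open>d w\<^sub>i\<close> in the Chern connection form of the frame \<open>f\<close>.\<close>

definition connection ::
  "('r \<Rightarrow> complex ^ 'n \<Rightarrow> 'h::complex_hilbert) \<Rightarrow> 'n \<Rightarrow> complex ^ 'n \<Rightarrow> complex ^ 'r ^ 'r" where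
  "connection f i z = matrix_inv (gramian f z) ** del i (gramian f) z"

lemma axis_ii: "axis i \<i> = \<i> *\<^sub>C (axis i 1 :: complex ^ 'n)"
  by (simp add: axis_def vec_eq_iff)

locale antihol_family =
  fixes U :: "(complex ^ 'n::finite) set"
    and f :: "'r::finite \<Rightarrow> complex ^ 'n \<Rightarrow> 'h::complex_hilbert"
  assumes open_U: "open U"
    and antihol: "\<And>a z. z \<in> U \<Longrightarrow> antihol_at (f a) z"
    and independent: "\<And>z u a. z \<in> U \<Longrightarrow> (\<Sum>a\<in>UNIV. u a *\<^sub>C f a z) = 0 \<Longrightarrow> u a = 0"
begin

text \<open>A vector in the kernel of the Gramian gives a linear combination of the family that is orthogonal to
  every member of it, hence to itself.\<close>

lemma det_gramian_nonzero:
  assumes z: "z \<in> U"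
  shows "det (gramian f z) \<noteq> 0"
proof -
  have "x = 0" if x: "gramian f z *v x = 0" for x
  proof -
    define y where "y = (\<Sum>b\<in>UNIV. cnj (x $ b) *\<^sub>C f b z)"
    have "cinner (f a z) y = 0" for a
      using arg_cong[OF x, of "\<lambda>v. v $ a"]
      by (simp add: y_def cinner.sum_right cinner_scaleC_right gramian_def matrix_vector_mult_def
          mult.commute)
    then have "cinner y y = 0"
      by (subst y_def) (simp add: cinner.sum_left cinner_scaleC_left)
    then have "cnj (x $ b) = 0" for b
      by (intro independent[OF z, of "\<lambda>b. cnj (x $ b)"]) (simp add: y_def)
    then show ?thesis
      by (simp add: vec_eq_iff)
  qed
  then obtain B where "B ** gramian f z = mat 1"
    using matrix_left_invertible_ker by blast
  then show ?thesis
    unfolding invertible_det_nz[symmetric] invertible_def using matrix_left_right_inverse1 by blast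
qed

lemma line_gramian:
  assumes z: "z \<in> U"
  shows "line_diff (gramian f) z v"
    and "dir_deriv (gramian f) z v =
      (\<chi> a b. cinner (f a z) (dir_deriv (f b) z v) + cinner (dir_deriv (f a) z v) (f b z))"
proof -
  note l = antihol_at_imp_line_diff[OF antihol[OF z]]
  note b = line_bilinear[OF cinner.bounded_bilinear_axioms l l]
  show "line_diff (gramian f) z v"
    unfolding gramian_def by (intro line_vec_lambda(1) b(1))
  show "dir_deriv (gramian f) z v =
      (\<chi> a b. cinner (f a z) (dir_deriv (f b) z v) + cinner (dir_deriv (f a) z v) (f b z))"
    unfolding gramian_def by (simp add: line_vec_lambda b)
qed

text \<open>The holomorphic derivative annihilates the anti-holomorphic first factor of the inner product and
  meets the second factor through the conjugation there.\<close>

lemma del_gramian: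
  assumes z: "z \<in> U"
  shows "del i (gramian f) z = (\<chi> a b. cinner (f a z) (dir_deriv (f b) z (axis i 1)))"
  unfolding del_def line_gramian(2)[OF z] axis_ii antihol_at_line(3)[OF antihol[OF z]]
  by (simp add: vec_eq_iff cinner_scaleC_left cinner_scaleC_right cinner.minus_left
      cinner.minus_right algebra_simps)

text \<open>This is where second derivatives of the family enter.\<close>

lemma line_diff_del_gramian:
  assumes z: "z \<in> U"
  shows "line_diff (del i (gramian f)) z v"
proof -
  have "line_diff (\<lambda>z. dir_deriv (f b) z (axis i 1)) z v" for b
  proof -
    obtain q where "((\<lambda>t. dir_deriv (f b) (z + t *\<^sub>R v) (axis i 1)) has_vector_derivative q) (at 0)"
      using dir_deriv_differentiable[OF open_U z antihol] by blast
    then show ?thesis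
      by (rule line_diffI(1))
  qed
  then have "line_diff (\<lambda>z. \<chi> a b. cinner (f a z) (dir_deriv (f b) z (axis i 1))) z v"
    using antihol_at_imp_line_diff[OF antihol[OF z]]
    by (intro line_vec_lambda(1) line_bilinear(1)[OF cinner.bounded_bilinear_axioms])
  then show ?thesis
    by (subst line_cong(2)[OF open_U z del_gramian])
qed

lemma line_diff_connection:
  assumes z: "z \<in> U"
  shows "line_diff (connection f i) z v"
proof -
  have inv: "line_diff (\<lambda>z. matrix_inv (gramian f z) $ a $ c) z v" for a c
    unfolding line_diff_def
  proof (rule differentiable_matrix_inv)
    show "(\<lambda>t. gramian f (z + t *\<^sub>R v) $ i $ j) differentiable (at 0)" for i j
      using line_vec_nth[OF line_vec_nth[OF line_gramian(1)[OF z]]] unfolding line_diff_def .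
    show "\<forall>\<^sub>F t in nhds 0. det (gramian f (z + t *\<^sub>R v)) \<noteq> 0"
      using eventually_line[OF open_U z] by eventually_elim (rule det_gramian_nonzero)
  qed
  have del: "line_diff (\<lambda>z. del i (gramian f) z $ c $ b) z v" for c b
    by (intro line_vec_nth line_diff_del_gramian z)
  have "line_diff (\<lambda>z. matrix_inv (gramian f z) $ a $ c * del i (gramian f) z $ c $ b) z v" for a b c
    by (rule line_bilinear(1)[OF bounded_bilinear_mult inv del])
  then have "line_diff (\<lambda>z. \<Sum>c\<in>UNIV. matrix_inv (gramian f z) $ a $ c * del i (gramian f) z $ c $ b) z v" for a b
    unfolding line_diff_def by (intro differentiable_sum) auto
  then show ?thesis
    unfolding connection_def[abs_def] matrix_matrix_mult_def by (intro line_vec_lambda(1))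
qed

end

lemma curvature_connection:
  "curvature f w u v = (\<Sum>i\<in>UNIV. \<Sum>j\<in>UNIV. (cnj (u $ j) * v $ i - cnj (v $ j) * u $ i) *\<^sub>C
     delbar j (connection f i) w)"
  by (simp add: curvature_def connection_def[abs_def])

text \<open>The Gramian of a tensor product of frames is the Kronecker product of the Gramians, so the
  connection form is a sum of two terms by the product rule, one from each factor.\<close>

lemma curvature_tensor_product:
  fixes k :: "'a::finite \<Rightarrow> complex ^ 'n::finite \<Rightarrow> 'h::complex_hilbert"
    and f :: "'b::finite \<Rightarrow> complex ^ 'n \<Rightarrow> 'k::complex_hilbert"
    and e :: "'a \<times> 'b \<Rightarrow> complex ^ 'n \<Rightarrow> 'l::complex_hilbert"
  assumes k: "antihol_family U k" and f: "antihol_family U f"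
    and e: "\<And>z. z \<in> U \<Longrightarrow> gramian e z = kron (gramian k z) (gramian f z)" and w: "w \<in> U"
  shows "curvature e w u v = kron (curvature k w u v) (mat 1) + kron (mat 1) (curvature f w u v)"
proof -
  interpret k: antihol_family U k by (rule k)
  interpret f: antihol_family U f by (rule f)
  note kron_add = bounded_bilinear.add_left[OF bounded_bilinear_kron]
    bounded_bilinear.add_right[OF bounded_bilinear_kron]
  note kron_diff = bounded_bilinear.diff_left[OF bounded_bilinear_kron]
    bounded_bilinear.diff_right[OF bounded_bilinear_kron]
  have del_e: "del i (gramian e) z = kron (del i (gramian k) z) (gramian f z)
      + kron (gramian k z) (del i (gramian f) z)" if z: "z \<in> U" for i z
  proof -
    have "dir_deriv (gramian e) z v = kron (gramian k z) (dir_deriv (gramian f) z v)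
        + kron (dir_deriv (gramian k) z v) (gramian f z)" for v
      by (subst line_cong(1)[OF k.open_U z e])
        (auto intro: line_bilinear(2)[OF bounded_bilinear_kron k.line_gramian(1)[OF z]
          f.line_gramian(1)[OF z]])
    then show ?thesis
      by (simp add: del_def kron_scaleC kron_diff scaleC.diff_right scaleC_add_right algebra_simps)
  qed
  have conn_e: "connection e i z = kron (connection k i z) (mat 1) + kron (mat 1) (connection f i z)"
    if z: "z \<in> U" for i z
  proof -
    have inv: "matrix_inv (gramian e z) = kron (matrix_inv (gramian k z)) (matrix_inv (gramian f z))"
      unfolding e[OF z]
      by (rule matrix_inv_kron[OF k.det_gramian_nonzero[OF z] f.det_gramian_nonzero[OF z]])
    have left: "matrix_inv (gramian k z) ** gramian k z = mat 1"
      "matrix_inv (gramian f z) ** gramian f z = mat 1"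
      by (simp_all add: matrix_inv_left k.det_gramian_nonzero[OF z] f.det_gramian_nonzero[OF z])
    show ?thesis
      by (simp add: connection_def inv del_e[OF z] matrix_add_ldistrib kron_mult left)
  qed
  have delbar_e: "delbar j (connection e i) w =
      kron (delbar j (connection k i) w) (mat 1) + kron (mat 1) (delbar j (connection f i) w)" for i j
  proof -
    have "dir_deriv (connection e i) w v = kron (dir_deriv (connection k i) w v) (mat 1)
        + kron (mat 1) (dir_deriv (connection f i) w v)" for v
    proof -
      note lk = line_bilinear[OF bounded_bilinear_kron k.line_diff_connection[OF w] line_const(1)]
      note lf = line_bilinear[OF bounded_bilinear_kron line_const(1) f.line_diff_connection[OF w]]
      have "dir_deriv (connection e i) w v =
          dir_deriv (\<lambda>z. kron (connection k i z) (mat 1) + kron (mat 1) (connection f i z)) w v"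
        by (rule line_cong(1)[OF k.open_U w conn_e])
      also have "\<dots> = dir_deriv (\<lambda>z. kron (connection k i z) (mat 1)) w v
          + dir_deriv (\<lambda>z. kron (mat 1) (connection f i z)) w v"
        by (rule line_add(2)[OF lk(1) lf(1)])
      also have "\<dots> = kron (dir_deriv (connection k i) w v) (mat 1)
          + kron (mat 1) (dir_deriv (connection f i) w v)"
        by (simp add: lk(2) lf(2) line_const(2) bounded_bilinear.zero_left[OF bounded_bilinear_kron]
            bounded_bilinear.zero_right[OF bounded_bilinear_kron])
      finally show ?thesis .
    qed
    then show ?thesis
      by (simp add: delbar_def kron_scaleC kron_add scaleC_add_right algebra_simps)
  qed
  show ?thesis
    unfolding curvature_connection delbar_e
    by (simp add: scaleC_add_right sum.distrib kron_scaleC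
        bounded_bilinear.sum_left[OF bounded_bilinear_kron]
        bounded_bilinear.sum_right[OF bounded_bilinear_kron])
qed

lemma local_frame_imp_antihol_family:
  fixes f :: "'r::finite \<Rightarrow> complex ^ 'n::finite \<Rightarrow> 'h::complex_hilbert"
  assumes "local_frame F U UNIV f"
  shows "antihol_family U f"
  using assms unfolding local_frame_iff[OF finite_class.finite_UNIV] by unfold_locales blast+

section \<open>Curvature of the quotient module\<close>

context quotient_module
begin

text \<open>Since \<open>\<Phi>\<close> is isometric, the Gramian of \<open>e\<close> is that of the frame \<open>tensor (k a) (f b)\<close>, a Kronecker
  product.\<close>

lemma curvature_quotient:
  fixes k :: "unit \<Rightarrow> complex ^ 'n \<Rightarrow> 'h" and f :: "'r::finite \<Rightarrow> complex ^ 'n \<Rightarrow> complex ^ 'q"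
  assumes \<Phi>: "bundle_iso \<Omega> (tensor_bundle E V) E\<Theta> \<Phi>" and U: "U \<subseteq> \<Omega>"
    and k: "local_frame E U UNIV k" and f: "local_frame V U UNIV f"
  defines "e \<equiv> (\<lambda>(a, b) w. \<Phi> w (tensor (k a w) (f b w)))"
  shows "local_frame E\<Theta> U UNIV e"
    and "w \<in> U \<Longrightarrow> curvature e w u v - kron (curvature k w u v) (mat 1)
      = kron (mat 1) (curvature f w u v)"
proof -
  note k_frame = k[unfolded local_frame_iff[OF finite_class.finite_UNIV]]
  have kE: "k () w \<in> E w" and k_nz: "k () w \<noteq> 0" if "w \<in> U" for w
  proof -
    have "range (\<lambda>u. \<Sum>i\<in>UNIV. u i *\<^sub>C k i w) = E w"
      using k_frame that by blast
    moreover have "k () w \<in> range (\<lambda>u. \<Sum>i\<in>UNIV. u i *\<^sub>C k i w)"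
      by (rule range_eqI[of _ _ "\<lambda>_. 1"]) (simp add: UNIV_unit)
    ultimately show "k () w \<in> E w" by simp
    show "k () w \<noteq> 0"
    proof
      assume "k () w = 0"
      then have zero: "(\<Sum>i\<in>UNIV. 1 *\<^sub>C k i w) = 0"
        by (simp add: UNIV_unit)
      have "\<forall>u. (\<Sum>i\<in>UNIV. u i *\<^sub>C k i w) = 0 \<longrightarrow> (\<forall>i\<in>UNIV. u i = 0)"
        using k_frame that by blast
      from spec[OF this, of "\<lambda>_. 1"] zero show False
        by simp
    qed
  qed
  have "local_frame (tensor_bundle E V) U UNIV (\<lambda>b w. tensor (k () w) (f b w))"
    using k_frame kE k_nz by (intro local_frame_tensor[OF U finite_class.finite_UNIV _ _ _ f]) auto
  then have "local_frame E\<Theta> U UNIV (\<lambda>b w. \<Phi> w (tensor (k () w) (f b w)))"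
    by (rule bundle_iso_local_frame[OF \<Phi> U finite_class.finite_UNIV])
  moreover have "bij_betw snd (UNIV :: (unit \<times> 'r) set) UNIV"
    by (auto simp: bij_betw_def inj_on_def)
  ultimately have "local_frame E\<Theta> U (UNIV :: (unit \<times> 'r) set)
      (\<lambda>ab w. \<Phi> w (tensor (k () w) (f (snd ab) w)))"
    by (rule local_frame_reindex)
  also have "(\<lambda>ab w. \<Phi> w (tensor (k () w) (f (snd ab) w))) = e"
    by (auto simp: e_def fun_eq_iff)
  finally show "local_frame E\<Theta> U UNIV e" .
  have gram: "gramian e z = kron (gramian k z) (gramian f z)" if z: "z \<in> U" for z
  proof -
    have fV: "f b z \<in> V z" for b
    proof -
      have "cvs.span (range (\<lambda>b. f b z)) = V z"
        using f z unfolding local_frame_def by blast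
      then show ?thesis
        using cvs.span_base[of "f b z" "range (\<lambda>b. f b z)"] by blast
    qed
    have t: "tensor (k a z) (f b z) \<in> tensor_bundle E V z" for a b
      unfolding tensor_bundle_def using kE[OF z] fV by (intro cvs.span_base) auto
    have "cinner (\<Phi> z x) (\<Phi> z y) = cinner x y" if "x \<in> tensor_bundle E V z" "y \<in> tensor_bundle E V z" for x y
      using \<Phi> U z that unfolding bundle_iso_def by blast
    then show ?thesis
      by (simp add: vec_eq_iff gramian_def kron_def e_def case_prod_unfold t cinner_tensor)
  qed
  show "curvature e w u v - kron (curvature k w u v) (mat 1) = kron (mat 1) (curvature f w u v)"
    if "w \<in> U"
    by (simp add: curvature_tensor_product[OF local_frame_imp_antihol_family[OF k]
          local_frame_imp_antihol_family[OF f] gram that])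
qed

end

theorem theorem3p3:
  fixes \<Omega> :: "(complex ^ 'n::finite) set"
    and M :: "'n \<Rightarrow> 'h::complex_hilbert \<Rightarrow> 'h"
    and \<Theta> :: "complex ^ 'n \<Rightarrow> complex ^ 'p::finite ^ 'q::finite"
    and \<Psi> :: "complex ^ 'n \<Rightarrow> complex ^ 'q ^ 'p"
  assumes domain: "open \<Omega>" "connected \<Omega>"
    and H: "B_star \<Omega> 1 UNIV M"
    and p_less_q: "CARD('p) < CARD('q)"
    and Theta: "\<forall>i j. (\<lambda>w. \<Theta> w $ i $ j) \<in> multipliers \<Omega> M"
    and Psi: "\<forall>i j. (\<lambda>w. \<Psi> w $ i $ j) \<in> multipliers \<Omega> M"
    and left_inverse: "\<forall>w\<in>\<Omega>. \<Psi> w ** \<Theta> w = mat 1"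
  defines "E \<equiv> eigenspace UNIV M"
    and "E\<Theta> \<equiv> eigenspace (quot_space \<Omega> M \<Theta>) (quot_action \<Omega> M \<Theta>)"
  shows "\<exists>V :: complex ^ 'n \<Rightarrow> (complex ^ 'q) set.
     antihol_bundle \<Omega> (CARD('q) - CARD('p)) V \<and>
     (\<forall>w\<in>\<Omega>. V w = orth_compl (range (\<lambda>x. \<Theta> w *v x)) \<and>
              V w = {v. conj_transpose (\<Theta> w) *v v = 0}) \<and>
     bundle_equiv \<Omega> E\<Theta> (tensor_bundle E V) \<and>
     B_star \<Omega> (CARD('q) - CARD('p)) (quot_space \<Omega> M \<Theta>) (quot_action \<Omega> M \<Theta>) \<and>
     (\<forall>\<Phi> U (k :: unit \<Rightarrow> complex ^ 'n \<Rightarrow> 'h) (f :: 'r::finite \<Rightarrow> complex ^ 'n \<Rightarrow> complex ^ 'q).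
        bundle_iso \<Omega> (tensor_bundle E V) E\<Theta> \<Phi> \<and> U \<subseteq> \<Omega> \<and>
        local_frame E U UNIV k \<and> local_frame V U UNIV f \<longrightarrow>
        (let e = (\<lambda>(a, b) w. \<Phi> w (tensor (k a w) (f b w))) in
           local_frame E\<Theta> U UNIV e \<and>
           (\<forall>w\<in>U. \<forall>u v.
              curvature e w u v - kron (curvature k w u v) (mat 1)
                = kron (mat 1) (curvature f w u v))))"
proof -
  interpret quotient_module \<Omega> M \<Theta> \<Psi>
    using domain(1) H p_less_q Theta Psi left_inverse by unfold_locales auto
  show ?thesis
    unfolding E_def E\<Theta>_def Let_def
  proof (intro exI[of _ V] conjI ballI allI impI antihol_bundle_V bundle_equiv_quotient
      B_star_quotient; (elim conjE)?)
    show "V w = orth_compl (range (\<lambda>x. \<Theta> w *v x))" "V w = {v. conj_transpose (\<Theta> w) *v v = 0}"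
      for w
      by (simp_all add: orth_compl_range_matrix V_def)
  qed (rule curvature_quotient, assumption+)+
qed

end
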